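(* Let $d\in\mathbb{N}$, let $f$ be a non-constant Bernstein function, and suppose that $u\in V_{f(-\Delta)}$. Let $\sigma$ denote the surface measure of $\mathbb{S}^{d-1}$. Then $u\in B^{\ast}(\mathbb{R}^d)$ if and only if there exists $\Phi\in L^2(\mathbb{S}^{d-1})$ such that $$u(x)=\int_{\mathbb{S}^{d-1}}\Phi(\xi)\,e^{-ix\cdot\xi}\,d\sigma(\xi)\quad\text{for every } x\in\mathbb{R}^d.$$
   Context: $B^{\ast}(\mathbb{R}^d)$ is the space of all $u\in L^2_{\mathrm{loc}}(\mathbb{R}^d)\cap\mathcal{S}'(\mathbb{R}^d)$ with $\|u\|^2_{B^\ast(\mathbb{R}^d)}=\sup_{R>1}\frac1R\int_{\{|x|<R\}}|u|^2\,dx<\infty$. $L^2(\mathbb{S}^{d-1})$ is taken with respect to $\sigma$. Bernstein function: $f:[0,\infty)\to\mathbb{R}$ is a Bernstein function with (Lévy) triple $(a,b,\mu)$ if $f(\lambda)=a+b\lambda+\int_{(0,\infty)}(1-e^{-\lambda t})\,\mu(dt)$ for $\lambda>0$, where $a,b\ge 0$ and $\mu$ is a measure on $(0,\infty)$ with $\int_{(0,\infty)}(1\wedge t)\,\mu(dt)<\infty$. Fourier transform: $\hat\varphi(\xi)=\mathcal{F}(\varphi)(\xi)=\int_{\mathbb{R}^d}\varphi(x)e^{-ix\cdot\xi}\,dx$ for $\varphi\in\mathcal{S}(\mathbb{R}^d)$, extended to tempered distributions $\mathcal{S}'(\mathbb{R}^d)$ by duality. $\mathcal{Z}(\mathbb{R}^d):=\{\varphi\in\mathcal{S}(\mathbb{R}^d):\partial^\alpha\hat\varphi(0)=0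 \text{ for all }\alpha\in\mathbb{N}_0^d\}$ (topology inherited from $\mathcal{S}(\mathbb{R}^d)$), and $\mathcal{Z}'(\mathbb{R}^d)$ is its topological dual. Every $u\in\mathcal{Z}'(\mathbb{R}^d)$ extends to an element of $\mathcal{S}'(\mathbb{R}^d)$, uniquely modulo polynomials. The operator $f(-\Delta):\mathcal{Z}(\mathbb{R}^d)\to\mathcal{Z}(\mathbb{R}^d)$ is $\varphi\mapsto\mathcal{F}^{-1}(f(|\cdot|^2)\hat\varphi)$. Solution: $u$ is a solution of $f(-\Delta)u=f(1)u$ if $u\in\mathcal{Z}'(\mathbb{R}^d)$, $\langle u,f(-\Delta)\varphi\rangle=\langle u,f(1)\varphi\rangle$ for all $\varphi\in\mathcal{Z}(\mathbb{R}^d)$, and $0\notin\operatorname{supp}\hat u$. The last condition means that $u$ has an extension in $\mathcal{S}'(\mathbb{R}^d)$ whose Fourier transform has support not containing $0$; this extension is unique and $u$ is identified with it. $V_{f(-\Delta)}$ is the vector space of all such solutions. *)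

theory Defs
  imports "HOL-Analysis.Analysis"
begin

text \<open>Throughout, \<open>\<real>\<^sup>d\<close> is an arbitrary type of class \<^class>\<open>euclidean_space\<close> and \<open>d = DIM('a)\<close>, so
  that \<open>d \<ge> 1\<close>.\<close>

section \<open>Schwartz functions and tempered distributions\<close>

text \<open>A multi-index \<open>\<alpha> \<in> \<nat>\<^sub>0\<^sup>d\<close> is encoded as a list of standard basis vectors in which the
  \<open>j\<close>-th basis vector occurs \<open>\<alpha>\<^sub>j\<close> times. The order of the list is immaterial for smooth functions.\<close>

fun partials :: "'a list \<Rightarrow> ('a::euclidean_space \<Rightarrow> complex) \<Rightarrow> 'a \<Rightarrow> complex" where
  "partials [] \<phi> = \<phi>"
| "partials (b # bs) \<phi> = (\<lambda>x. frechet_derivative (partials bs \<phi>) (at x) b)"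

definition smooth :: "('a::euclidean_space \<Rightarrow> complex) \<Rightarrow> bool" where
  "smooth \<phi> \<longleftrightarrow> (\<forall>bs \<in> lists Basis. \<forall>x. partials bs \<phi> differentiable (at x))"

definition test_functions :: "('a::euclidean_space \<Rightarrow> complex) set" where
  "test_functions = {\<phi>. smooth \<phi> \<and> compact (closure {x. \<phi> x \<noteq> 0})}"

definition schwartz :: "('a::euclidean_space \<Rightarrow> complex) set" where
  "schwartz = {\<phi>. smooth \<phi> \<and>
     (\<forall>k. \<forall>bs \<in> lists Basis. bdd_above (range (\<lambda>x. (1 + norm x) ^ k * norm (partials bs \<phi> x))))}"

definition schwartz_seminorm ::
    "nat \<Rightarrow> 'a list \<Rightarrow> ('a::euclidean_space \<Rightarrow> complex) \<Rightarrow> real" where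
  "schwartz_seminorm k bs \<phi> = (SUP x. (1 + norm x) ^ k * norm (partials bs \<phi> x))"

definition schwartz_topology :: "('a::euclidean_space \<Rightarrow> complex) topology" where
  "schwartz_topology = topology_generated_by
     {{\<psi> \<in> schwartz. schwartz_seminorm k bs (\<lambda>x. \<psi> x - \<phi> x) < \<epsilon>} |k bs \<phi> \<epsilon>.
        bs \<in> lists Basis \<and> \<phi> \<in> schwartz \<and> \<epsilon> > 0}"

lemma partials_zero: "partials bs (\<lambda>x. 0) = (\<lambda>x. 0)"
proof (induction bs)
  case (Cons b bs)
  then show ?case by (simp add: frechet_derivative_const)
qed simp

lemma topspace_schwartz_topology: "topspace schwartz_topology = schwartz"
proof -
  have "\<phi> \<in> {\<psi> \<in> schwartz. schwartz_seminorm 0 [] (\<lambda>x. \<psi> x - \<phi> x) < 1}"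
    if "\<phi> \<in> schwartz" for \<phi> :: "'a \<Rightarrow> complex"
    using that by (simp add: schwartz_seminorm_def)
  moreover have "[] \<in> lists (Basis :: 'a set)" "(0::real) < 1" by auto
  ultimately show ?thesis
    unfolding schwartz_topology_def topology_generated_by_topspace by blast
qed

text \<open>A functional on a space \<open>X\<close> of functions is modelled by a total function on the function type,
  of which only the values on \<open>X\<close> are ever used.\<close>

definition linear_functional_on ::
    "('a \<Rightarrow> complex) set \<Rightarrow> (('a \<Rightarrow> complex) \<Rightarrow> complex) \<Rightarrow> bool" where
  "linear_functional_on X u \<longleftrightarrow>
     (\<forall>\<phi>\<in>X. \<forall>\<psi>\<in>X. u (\<lambda>x. \<phi> x + \<psi> x) = u \<phi> + u \<psi>) \<and>
     (\<forall>c. \<forall>\<phi>\<in>X. u (\<lambda>x. c * \<phi> x) = c * u \<phi>)"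

definition tempered_distributions :: "(('a::euclidean_space \<Rightarrow> complex) \<Rightarrow> complex) set" where
  "tempered_distributions =
     {u. linear_functional_on schwartz u \<and> continuous_map schwartz_topology euclidean u}"

definition fourier :: "('a::euclidean_space \<Rightarrow> complex) \<Rightarrow> 'a \<Rightarrow> complex" where
  "fourier \<phi> \<xi> = (LINT x|lborel. \<phi> x * exp (- \<i> * of_real (x \<bullet> \<xi>)))"

definition inverse_fourier :: "('a::euclidean_space \<Rightarrow> complex) \<Rightarrow> 'a \<Rightarrow> complex" where
  "inverse_fourier \<psi> x =
     (LINT \<xi>|lborel. \<psi> \<xi> * exp (\<i> * of_real (x \<bullet> \<xi>))) / of_real ((2 * pi) ^ DIM('a))"

definition fourier_distribution ::
    "(('a::euclidean_space \<Rightarrow> complex) \<Rightarrow> complex) \<Rightarrow> ('a \<Rightarrow> complex) \<Rightarrow> complex" where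
  "fourier_distribution u = (\<lambda>\<phi>. u (fourier \<phi>))"

definition distribution_support :: "(('a::euclidean_space \<Rightarrow> complex) \<Rightarrow> complex) \<Rightarrow> 'a set" where
  "distribution_support u =
     - \<Union>{W. open W \<and> (\<forall>\<phi> \<in> test_functions. closure {x. \<phi> x \<noteq> 0} \<subseteq> W \<longrightarrow> u \<phi> = 0)}"

definition locally_integrable :: "('a::euclidean_space \<Rightarrow> complex) \<Rightarrow> bool" where
  "locally_integrable g \<longleftrightarrow> (\<forall>K. compact K \<longrightarrow> set_integrable lborel K g)"

text \<open>The distribution \<open>u\<close> is (given by) the function \<open>g\<close>.\<close>

definition is_function ::
    "(('a::euclidean_space \<Rightarrow> complex) \<Rightarrow> complex) \<Rightarrow> ('a \<Rightarrow> complex) \<Rightarrow> bool" where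
  "is_function u g \<longleftrightarrow> locally_integrable g \<and>
     (\<forall>\<phi> \<in> test_functions. u \<phi> = (LINT x|lborel. g x * \<phi> x))"

section \<open>The space \<open>Z\<close> and the operator \<open>f(-\<Delta>)\<close>\<close>

definition Z_space :: "('a::euclidean_space \<Rightarrow> complex) set" where
  "Z_space = {\<phi> \<in> schwartz. \<forall>bs \<in> lists Basis. partials bs (fourier \<phi>) 0 = 0}"

definition Z_dual :: "(('a::euclidean_space \<Rightarrow> complex) \<Rightarrow> complex) set" where
  "Z_dual = {u. linear_functional_on Z_space u \<and>
     continuous_map (subtopology schwartz_topology Z_space) euclidean u}"

text \<open>Only the values of \<open>f\<close> on \<open>(0,\<infinity>)\<close> are constrained, and only these enter the notions
  below; the value at \<open>0\<close> and on the negative half-line is irrelevant.\<close>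

definition bernstein_triple :: "(real \<Rightarrow> real) \<Rightarrow> real \<Rightarrow> real \<Rightarrow> real measure \<Rightarrow> bool" where
  "bernstein_triple f a b \<mu> \<longleftrightarrow> a \<ge> 0 \<and> b \<ge> 0 \<and>
     sets \<mu> = sets (restrict_space borel {0<..}) \<and>
     (\<integral>\<^sup>+t. ennreal (min 1 t) \<partial>\<mu>) < \<infinity> \<and>
     (\<forall>x>0. f x = a + b * x + (LINT t|\<mu>. 1 - exp (- x * t)))"

definition bernstein :: "(real \<Rightarrow> real) \<Rightarrow> bool" where
  "bernstein f \<longleftrightarrow> (\<exists>a b \<mu>. bernstein_triple f a b \<mu>)"

definition f_minus_Laplacian ::
    "(real \<Rightarrow> real) \<Rightarrow> ('a::euclidean_space \<Rightarrow> complex) \<Rightarrow> 'a \<Rightarrow> complex" where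
  "f_minus_Laplacian f \<phi> = inverse_fourier (\<lambda>\<xi>. of_real (f ((norm \<xi>)\<^sup>2)) * fourier \<phi> \<xi>)"

text \<open>\<open>U\<close> is the extension of \<open>u \<in> Z'\<close> to a tempered distribution whose Fourier transform does not
  have \<open>0\<close> in its support; on Schwartz functions it is uniquely determined by \<open>u\<close>, which is identified with it.\<close>

definition identified_with ::
    "(('a::euclidean_space \<Rightarrow> complex) \<Rightarrow> complex) \<Rightarrow> (('a \<Rightarrow> complex) \<Rightarrow> complex) \<Rightarrow> bool" where
  "identified_with u U \<longleftrightarrow> U \<in> tempered_distributions \<and> (\<forall>\<phi> \<in> Z_space. U \<phi> = u \<phi>) \<and>
     0 \<notin> distribution_support (fourier_distribution U)"

definition solution_space ::
    "(real \<Rightarrow> real) \<Rightarrow> (('a::euclidean_space \<Rightarrow> complex) \<Rightarrow> complex) set" where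
  "solution_space f = {u \<in> Z_dual.
     (\<forall>\<phi> \<in> Z_space. u (f_minus_Laplacian f \<phi>) = u (\<lambda>x. of_real (f 1) * \<phi> x)) \<and>
     (\<exists>U. identified_with u U)}"

section \<open>The space \<open>B\<^sup>*\<close> and the unit sphere\<close>

definition B_star_norm_sq :: "('a::euclidean_space \<Rightarrow> complex) \<Rightarrow> ennreal" where
  "B_star_norm_sq g =
     (SUP R\<in>{1<..}. ennreal (1 / R) * (\<integral>\<^sup>+x\<in>ball 0 R. ennreal ((norm (g x))\<^sup>2) \<partial>lborel))"

definition B_star :: "(('a::euclidean_space \<Rightarrow> complex) \<Rightarrow> complex) set" where
  "B_star = {U \<in> tempered_distributions. \<exists>g \<in> borel_measurable lborel.
     (\<forall>K. compact K \<longrightarrow> set_integrable lborel K (\<lambda>x. (norm (g x))\<^sup>2)) \<and>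
     is_function U g \<and> B_star_norm_sq g < \<infinity>}"

text \<open>The surface measure \<open>\<sigma>(A) = d \<cdot> vol {r\<omega> | 0 < r \<le> 1, \<omega> \<in> A}\<close>, i.e. \<open>d\<close> times the image of
  Lebesgue measure on the punctured unit ball under \<open>x \<mapsto> x / |x|\<close>. For \<open>d = 1\<close> this is the counting
  measure on \<open>{-1, 1}\<close>.\<close>

definition sphere_measure :: "'a::euclidean_space measure" where
  "sphere_measure = scale_measure (of_nat DIM('a))
     (distr (restrict_space lborel (cball 0 1 - {0})) (restrict_space borel (sphere 0 1)) sgn)"

definition L2_sphere :: "('a::euclidean_space \<Rightarrow> complex) set" where
  "L2_sphere = {\<Phi> \<in> borel_measurable sphere_measure.
     integrable sphere_measure (\<lambda>\<xi>. (norm (\<Phi> \<xi>))\<^sup>2)}"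

lemma space_sphere_measure: "space sphere_measure = sphere 0 1"
  by (simp add: sphere_measure_def space_restrict_space space_scale_measure)

lemma measurable_sgn_sphere:
  "sgn \<in> measurable (restrict_space lborel (cball 0 1 - {0}))
     (restrict_space borel (sphere (0::'a::euclidean_space) 1))"
proof (rule measurable_restrict_space2)
  show "sgn \<in> space (restrict_space lborel (cball 0 1 - {0})) \<rightarrow> sphere (0::'a) 1"
    by (auto simp: norm_sgn space_restrict_space)
  have "(\<lambda>x::'a. x /\<^sub>R norm x) \<in> borel_measurable borel" by measurable
  then have "(sgn :: 'a \<Rightarrow> 'a) \<in> borel_measurable borel"
    by (simp add: sgn_div_norm[abs_def])
  then show "sgn \<in> measurable (restrict_space lborel (cball 0 1 - {0})) (borel :: 'a measure)"
    by (intro measurable_restrict_space1) simp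
qed

end

theory Submission
  imports Defs "HOL-Probability.Probability"
begin

text \<open>A non-constant Bernstein function \<open>f\<close> is smooth and strictly increasing on \<open>(0,\<infinity>)\<close>. Hence a test
  function \<open>\<phi>\<close> supported away from \<open>0\<close> and from the unit sphere can be divided by
  \<open>f(|\<xi>|\<^sup>2) - f(1)\<close>, and the equation shows that the Fourier transform of a solution is supported on
  the sphere. The rest is the Agmon--Hoermander characterisation of solutions of the Helmholtz equation.

  If \<open>u\<close> is the Fourier transform of \<open>\<Phi> d\<sigma>\<close>, then multiplying \<open>|u|\<^sup>2\<close> by the Gaussian \<open>exp(-|x|\<^sup>2/2R\<^sup>2)\<close>
  and integrating gives a quadratic form in \<open>\<Phi>\<close> with a Gaussian kernel on the sphere, which Schur's test
  bounds by a multiple of \<open>R\<close>.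

  Conversely, let \<open>u = g\<close> be in \<open>B\<^sup>*\<close> and mollify its Fourier transform at scale \<open>\<epsilon>\<close>. The result \<open>k\<^sub>\<epsilon>\<close> lives in the
  \<open>\<epsilon>\<close>-neighbourhood of the sphere and has squared norm \<open>O(1/\<epsilon>)\<close>, so that its radial integrals \<open>\<Phi>\<^sub>\<epsilon>\<close> are bounded
  in \<open>L\<^sup>2(\<sigma>)\<close>. A weak limit of the \<open>\<Phi>\<^sub>\<epsilon>\<close> as \<open>\<epsilon> \<rightarrow> 0\<close> is the density sought.\<close>

text \<open>The equation is tested only against \<open>Z_space\<close>, whose members have Fourier
  transforms that are flat at the origin, and f(|\<xi>|^2) need not be smooth there. The division
  therefore stays away from 0, and a neighbourhood of the origin is covered by the support condition
  in \<open>identified_with\<close>.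

  One estimate, \<open>gaussian_schur\<close>, serves both directions. On the sphere at width 1/R
  the Gaussian transform contributes R^d and the surface mass of a cap of that size R^(1-d), which
  leaves R. In the converse it replaces Plancherel's identity: the mollified transform lives in a
  fixed ball, where a Gaussian of width 1 is bounded below.

  Squared norm of order 1/\<epsilon> on a shell of thickness \<epsilon> is exactly what the
  Cauchy-Schwarz inequality in the radius can absorb. The weak limit is a norm limit of iterated
  midpoints of nearly minimal norm, so no weak compactness and no subsequence of the densities is
  used; this is enough because their pairings with the Fourier transform of each test function
  converge along the whole sequence.\<close>

section \<open>Smooth functions\<close>

text \<open>Requiring only differentiability of the partial derivatives of order less than \<open>n\<close> (instead of continuity
  at order \<open>n\<close>) keeps the closure proofs inductive and makes no difference for smooth functions.\<close>

primrec Ck :: "'a::euclidean_space set \<Rightarrow> nat \<Rightarrow> ('a \<Rightarrow> complex) \<Rightarrow> bool" where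
  "Ck S 0 \<phi> \<longleftrightarrow> True"
| "Ck S (Suc n) \<phi> \<longleftrightarrow> (\<forall>x\<in>S. \<phi> differentiable (at x)) \<and> (\<forall>b\<in>Basis. Ck S n (partials [b] \<phi>))"

definition smooth_on :: "'a::euclidean_space set \<Rightarrow> ('a \<Rightarrow> complex) \<Rightarrow> bool" where
  "smooth_on S \<phi> \<longleftrightarrow> (\<forall>n. Ck S n \<phi>)"

lemma partials_append: "partials (as @ bs) \<phi> = partials as (partials bs \<phi>)"
  by (induction as) auto

text \<open>The recursion of \<open>Ck\<close> takes the first derivative in direction b and leaves
  the others to \<open>partials [b] \<phi>\<close>, so b stands at the end of the list, while
  \<open>partials\<close> conses at the front. The induction therefore splits lists at their last
  element.\<close>

lemma Ck_iff_partials: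
  fixes \<phi> :: "'a::euclidean_space \<Rightarrow> complex"
  shows "Ck S n \<phi> \<longleftrightarrow> (\<forall>bs\<in>lists Basis. length bs < n \<longrightarrow> (\<forall>x\<in>S. partials bs \<phi> differentiable (at x)))"
proof (induction n arbitrary: \<phi>)
  case (Suc n)
  have "(\<forall>bs\<in>lists Basis. length bs < Suc n \<longrightarrow> P bs) \<longleftrightarrow>
      P [] \<and> (\<forall>b\<in>Basis. \<forall>bs\<in>lists Basis. length bs < n \<longrightarrow> P (bs @ [b]))" for P :: "'a list \<Rightarrow> bool"
  proof
    assume "\<forall>bs\<in>lists Basis. length bs < Suc n \<longrightarrow> P bs"
    then show "P [] \<and> (\<forall>b\<in>Basis. \<forall>bs\<in>lists Basis. length bs < n \<longrightarrow> P (bs @ [b]))" by auto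
  next
    assume *: "P [] \<and> (\<forall>b\<in>Basis. \<forall>bs\<in>lists Basis. length bs < n \<longrightarrow> P (bs @ [b]))"
    show "\<forall>bs\<in>lists Basis. length bs < Suc n \<longrightarrow> P bs"
    proof (intro ballI impI)
      fix bs :: "'a list" assume "bs \<in> lists Basis" "length bs < Suc n"
      with * show "P bs" by (cases bs rule: rev_cases) auto
    qed
  qed
  from this[of "\<lambda>bs. \<forall>x\<in>S. partials bs \<phi> differentiable (at x)"]
  show ?case by (simp add: Suc.IH partials_append)
qed simp

lemma smooth_iff_smooth_on: "smooth \<phi> \<longleftrightarrow> smooth_on UNIV \<phi>"
  unfolding smooth_def smooth_on_def Ck_iff_partials by auto

lemma Ck_mono: "Ck S (Suc n) \<phi> \<Longrightarrow> Ck S n \<phi>"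
  unfolding Ck_iff_partials by auto

lemma smooth_on_Un: "smooth_on S \<phi> \<Longrightarrow> smooth_on T \<phi> \<Longrightarrow> smooth_on (S \<union> T) \<phi>"
  unfolding smooth_on_def Ck_iff_partials by blast

lemma smooth_on_subset: "smooth_on S \<phi> \<Longrightarrow> T \<subseteq> S \<Longrightarrow> smooth_on T \<phi>"
  unfolding smooth_on_def Ck_iff_partials by auto

lemma smooth_on_differentiable: "smooth_on S \<phi> \<Longrightarrow> x \<in> S \<Longrightarrow> \<phi> differentiable (at x)"
  unfolding smooth_on_def by (metis Ck.simps(2))

lemma smooth_on_partial: "smooth_on S \<phi> \<Longrightarrow> b \<in> Basis \<Longrightarrow> smooth_on S (partials [b] \<phi>)"
  unfolding smooth_on_def by (metis Ck.simps(2))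

lemma smooth_onI:
  assumes "\<And>x. x \<in> S \<Longrightarrow> \<phi> differentiable (at x)"
    and "\<And>b. b \<in> Basis \<Longrightarrow> smooth_on S (partials [b] \<phi>)"
  shows "smooth_on S \<phi>"
  unfolding smooth_on_def
proof
  fix n show "Ck S n \<phi>" using assms by (cases n) (auto simp: smooth_on_def)
qed

lemma differentiable_cong_open:
  assumes "open S" "\<And>x. x \<in> S \<Longrightarrow> \<phi> x = \<psi> x" "x \<in> S"
  shows "\<phi> differentiable (at x) \<longleftrightarrow> \<psi> differentiable (at x)"
    and "frechet_derivative \<phi> (at x) = frechet_derivative \<psi> (at x)"
proof -
  have *: "(\<phi> has_derivative D) (at x) \<longleftrightarrow> (\<psi> has_derivative D) (at x)" for D
    using assms by (metis (no_types, lifting) has_derivative_transform_within_open)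
  show "\<phi> differentiable (at x) \<longleftrightarrow> \<psi> differentiable (at x)"
    unfolding differentiable_def * ..
  show "frechet_derivative \<phi> (at x) = frechet_derivative \<psi> (at x)"
    unfolding frechet_derivative_def * ..
qed

lemma partials_cong_open:
  assumes "open S" "\<And>x. x \<in> S \<Longrightarrow> \<phi> x = \<psi> x" "x \<in> S"
  shows "partials bs \<phi> x = partials bs \<psi> x"
  using assms(3)
proof (induction bs arbitrary: x)
  case (Cons b bs)
  then show ?case
    using differentiable_cong_open(2)[of S "partials bs \<phi>" "partials bs \<psi>"] assms(1) by auto
qed (use assms in auto)

lemma Ck_cong:
  assumes "open S" "\<And>x. x \<in> S \<Longrightarrow> \<phi> x = \<psi> x"
  shows "Ck S n \<phi> \<longleftrightarrow> Ck S n \<psi>"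
proof -
  have "partials bs \<phi> differentiable (at x) \<longleftrightarrow> partials bs \<psi> differentiable (at x)" if "x \<in> S" for bs x
    by (rule differentiable_cong_open(1)[OF assms(1) _ that])
      (rule partials_cong_open[OF assms(1)], simp_all add: assms(2))
  then show ?thesis by (simp add: Ck_iff_partials)
qed

lemma smooth_on_cong:
  assumes "open S" "\<And>x. x \<in> S \<Longrightarrow> \<phi> x = \<psi> x" "smooth_on S \<psi>"
  shows "smooth_on S \<phi>"
  using assms(3) Ck_cong[OF assms(1,2)] by (simp add: smooth_on_def)

lemma partial_eqI: "(\<phi> has_derivative D) (at x) \<Longrightarrow> partials [b] \<phi> x = D b"
  using frechet_derivative_at by fastforce

lemma partial_has_derivative:
  "\<phi> differentiable (at x) \<Longrightarrow> (\<phi> has_derivative (\<lambda>h. frechet_derivative \<phi> (at x) h)) (at x)"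
  by (simp add: frechet_derivative_works)

lemma partial_add:
  assumes "\<phi> differentiable (at x)" "\<psi> differentiable (at x)"
  shows "partials [b] (\<lambda>x. \<phi> x + \<psi> x) x = partials [b] \<phi> x + partials [b] \<psi> x"
  by (subst partial_eqI[OF has_derivative_add[OF assms[THEN partial_has_derivative]]]) simp

lemma partial_mult:
  assumes "\<phi> differentiable (at x)" "\<psi> differentiable (at x)"
  shows "partials [b] (\<lambda>x. \<phi> x * \<psi> x) x = \<phi> x * partials [b] \<psi> x + partials [b] \<phi> x * \<psi> x"
  by (subst partial_eqI[OF has_derivative_mult[OF assms[THEN partial_has_derivative]]]) simp

lemma partial_const: "partials [b] (\<lambda>x. c) = (\<lambda>x. 0)"
  by (simp add: frechet_derivative_const)

lemma Ck_add:
  assumes "open S" shows "Ck S n \<phi> \<Longrightarrow> Ck S n \<psi> \<Longrightarrow> Ck S n (\<lambda>x. \<phi> x + \<psi> x)"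
proof (induction n arbitrary: \<phi> \<psi>)
  case (Suc n)
  have "Ck S n (partials [b] (\<lambda>x. \<phi> x + \<psi> x))" if "b \<in> Basis" for b
    using Suc that by (subst Ck_cong[OF assms partial_add]) (auto simp del: partials.simps)
  with Suc show ?case by auto
qed simp

lemma Ck_mult:
  assumes "open S" shows "Ck S n \<phi> \<Longrightarrow> Ck S n \<psi> \<Longrightarrow> Ck S n (\<lambda>x. \<phi> x * \<psi> x)"
proof (induction n arbitrary: \<phi> \<psi>)
  case (Suc n)
  \<comment> \<open>Each term of the product rule keeps one factor undifferentiated, so the
    induction hypothesis is also applied to \<open>\<phi>\<close> and \<open>\<psi>\<close>
    themselves, at order \<open>n\<close>.\<close>
  note m = Suc.prems[THEN Ck_mono]
  have "Ck S n (partials [b] (\<lambda>x. \<phi> x * \<psi> x))" if "b \<in> Basis" for b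
  proof -
    have "Ck S n (partials [b] \<phi>)" "Ck S n (partials [b] \<psi>)" using Suc.prems that by auto
    then have "Ck S n (\<lambda>x. \<phi> x * partials [b] \<psi> x + partials [b] \<phi> x * \<psi> x)"
      using m by (intro Ck_add[OF assms] Suc.IH)
    then show ?thesis using Suc.prems
      by (subst Ck_cong[OF assms partial_mult]) (auto simp del: partials.simps)
  qed
  with Suc show ?case by auto
qed simp

lemma smooth_on_const: "smooth_on S (\<lambda>x. c)"
proof -
  have "partials bs (\<lambda>x. c) differentiable at x" for bs and x :: 'a
    by (cases bs rule: rev_cases) (auto simp: partials_append frechet_derivative_const partials_zero)
  then show ?thesis unfolding smooth_on_def Ck_iff_partials by auto
qed

text \<open>The derivative of 1/\<phi> is built from a derivative of \<phi> and from 1/\<phi>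
  itself, so an induction on the order for this one function suffices.\<close>

lemma Ck_inverse:
  assumes "open S" "\<And>x. x \<in> S \<Longrightarrow> \<phi> x \<noteq> 0"
  shows "Ck S n \<phi> \<Longrightarrow> Ck S n (\<lambda>x. inverse (\<phi> x))"
proof (induction n)
  case (Suc n)
  have d: "((\<lambda>x. inverse (\<phi> x)) has_derivative
      (\<lambda>h. - (inverse (\<phi> x) * frechet_derivative \<phi> (at x) h * inverse (\<phi> x)))) (at x)" if "x \<in> S" for x
    using Suc.prems assms(2) that by (intro Deriv.has_derivative_inverse partial_has_derivative) auto
  have "partials [b] (\<lambda>x. inverse (\<phi> x)) x = (- 1) * partials [b] \<phi> x * (inverse (\<phi> x) * inverse (\<phi> x))"
    if "x \<in> S" for x b
    using partial_eqI[OF d[OF that]] by simp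
  note p = Ck_cong[OF assms(1) this]
  have m1: "Ck S n (\<lambda>x. - 1)"
    using smooth_on_const[of S "- 1"] by (simp add: smooth_on_def)
  then have "Ck S n (partials [b] (\<lambda>x. inverse (\<phi> x)))" if "b \<in> Basis" for b
  proof -
    have "Ck S n (\<lambda>x. (- 1) * partials [b] \<phi> x * (inverse (\<phi> x) * inverse (\<phi> x)))"
      using Suc.IH[OF Ck_mono[OF Suc.prems]] Suc.prems that m1 by (intro Ck_mult[OF assms(1)]) auto
    then show ?thesis by (subst p)
  qed
  then show ?case using d by (auto simp: differentiable_def)
qed simp

lemma smooth_on_add: "open S \<Longrightarrow> smooth_on S \<phi> \<Longrightarrow> smooth_on S \<psi> \<Longrightarrow> smooth_on S (\<lambda>x. \<phi> x + \<psi> x)"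
  by (simp add: smooth_on_def Ck_add)

lemma smooth_on_mult: "open S \<Longrightarrow> smooth_on S \<phi> \<Longrightarrow> smooth_on S \<psi> \<Longrightarrow> smooth_on S (\<lambda>x. \<phi> x * \<psi> x)"
  by (simp add: smooth_on_def Ck_mult)

lemma smooth_on_cmult: "open S \<Longrightarrow> smooth_on S \<phi> \<Longrightarrow> smooth_on S (\<lambda>x. c * \<phi> x)"
  by (simp add: smooth_on_mult smooth_on_const)

lemma smooth_on_inverse:
  "open S \<Longrightarrow> (\<And>x. x \<in> S \<Longrightarrow> \<phi> x \<noteq> 0) \<Longrightarrow> smooth_on S \<phi> \<Longrightarrow> smooth_on S (\<lambda>x. inverse (\<phi> x))"
  by (simp add: smooth_on_def Ck_inverse)

lemma smooth_on_inner: "smooth_on S (\<lambda>x. of_real (x \<bullet> b))"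
proof (rule smooth_onI)
  have d: "((\<lambda>x. complex_of_real (x \<bullet> b)) has_derivative (\<lambda>h. of_real (h \<bullet> b))) (at x)" for x
    by (auto intro!: derivative_eq_intros)
  show "(\<lambda>x. complex_of_real (x \<bullet> b)) differentiable (at x)" for x
    using d by (auto simp: differentiable_def)
  have "partials [c] (\<lambda>x. complex_of_real (x \<bullet> b)) = (\<lambda>x. of_real (c \<bullet> b))" for c
    using partial_eqI[OF d] by auto
  then show "smooth_on S (partials [c] (\<lambda>x. complex_of_real (x \<bullet> b)))" for c
    by (simp only: smooth_on_const)
qed

lemma smooth_affine:
  assumes "smooth \<phi>" shows "smooth (\<lambda>x. \<phi> (a *\<^sub>R x + c))"
    and "partials [b] (\<lambda>x. \<phi> (a *\<^sub>R x + c)) x = of_real a * partials [b] \<phi> (a *\<^sub>R x + c)"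
proof -
  have d: "((\<lambda>x. \<phi> (a *\<^sub>R x + c)) has_derivative (\<lambda>h. frechet_derivative \<phi> (at (a *\<^sub>R x + c)) (a *\<^sub>R h))) (at x)"
    if "smooth_on UNIV \<phi>" for \<phi> :: "'a \<Rightarrow> complex" and x
  proof -
    have "((\<lambda>x. a *\<^sub>R x + c) has_derivative (\<lambda>h. a *\<^sub>R h)) (at x)"
      by (auto intro!: derivative_eq_intros)
    moreover have "(\<phi> has_derivative frechet_derivative \<phi> (at (a *\<^sub>R x + c))) (at (a *\<^sub>R x + c))"
      using smooth_on_differentiable[OF that] by (simp add: partial_has_derivative)
    ultimately show ?thesis
      using has_derivative_compose by blast
  qed
  have p: "partials [b] (\<lambda>x. \<phi> (a *\<^sub>R x + c)) x = of_real a * partials [b] \<phi> (a *\<^sub>R x + c)"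
    if "smooth_on UNIV \<phi>" for \<phi> :: "'a \<Rightarrow> complex" and x b
  proof -
    have "linear (frechet_derivative \<phi> (at (a *\<^sub>R x + c)))"
      using smooth_on_differentiable[OF that] by (simp add: linear_frechet_derivative)
    then show ?thesis
      by (subst partial_eqI[OF d[OF that]]) (simp add: linear_scale scaleR_conv_of_real)
  qed
  have "Ck UNIV n (\<lambda>x. \<phi> (a *\<^sub>R x + c))" if "smooth_on UNIV \<phi>" for n and \<phi> :: "'a \<Rightarrow> complex"
    using that
  proof (induction n arbitrary: \<phi>)
    case (Suc n)
    have "Ck UNIV n (\<lambda>x. complex_of_real a)" using smooth_on_const by (auto simp: smooth_on_def)
    moreover have "partials [b] (\<lambda>x. \<phi> (a *\<^sub>R x + c)) = (\<lambda>x. of_real a * partials [b] \<phi> (a *\<^sub>R x + c))" for b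
      using p[OF Suc.prems] by (intro ext)
    ultimately show ?case
      using Suc d[OF Suc.prems] by (auto simp: differentiable_def simp del: partials.simps
          intro!: Ck_mult smooth_on_partial)
  qed simp
  then show "smooth (\<lambda>x. \<phi> (a *\<^sub>R x + c))" using assms by (simp add: smooth_iff_smooth_on smooth_on_def)
  show "partials [b] (\<lambda>x. \<phi> (a *\<^sub>R x + c)) x = of_real a * partials [b] \<phi> (a *\<^sub>R x + c)"
    using p assms by (simp only: smooth_iff_smooth_on)
qed

text \<open>A family of real functions closed under differentiation replaces explicit higher derivatives.\<close>

lemma Ck_radial:
  fixes F :: "real \<Rightarrow> real" and S :: "'a::euclidean_space set"
  assumes "open S" "\<And>x. x \<in> S \<Longrightarrow> (norm x)\<^sup>2 \<in> T"
    and closed: "\<And>F. F \<in> \<F> \<Longrightarrow> \<exists>G\<in>\<F>. \<forall>t\<in>T. (F has_real_derivative G t) (at t)"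
  shows "F \<in> \<F> \<Longrightarrow> Ck S n (\<lambda>x. of_real (F ((norm x)\<^sup>2)))"
proof (induction n arbitrary: F)
  case (Suc n)
  obtain G where G: "G \<in> \<F>" "\<And>t. t \<in> T \<Longrightarrow> (F has_real_derivative G t) (at t)"
    using closed[OF Suc.prems] by blast
  have d: "((\<lambda>x. complex_of_real (F ((norm x)\<^sup>2))) has_derivative
      (\<lambda>h. of_real (2 * (x \<bullet> h) * G ((norm x)\<^sup>2)))) (at x)" if "x \<in> S" for x
  proof -
    have "((\<lambda>x. (norm x)\<^sup>2) has_derivative (\<lambda>h. 2 * (x \<bullet> h))) (at x)"
      unfolding power2_norm_eq_inner by (auto intro!: derivative_eq_intros simp: inner_commute)
    moreover have "(F has_derivative (\<lambda>h. h * G ((norm x)\<^sup>2))) (at ((norm x)\<^sup>2))"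
      using G(2)[OF assms(2)[OF that]] by (simp add: has_field_derivative_def mult_commute_abs)
    ultimately have "((\<lambda>x. F ((norm x)\<^sup>2)) has_derivative (\<lambda>h. 2 * (x \<bullet> h) * G ((norm x)\<^sup>2))) (at x)"
      using has_derivative_compose by fastforce
    then show ?thesis by (rule has_derivative_of_real)
  qed
  have "partials [b] (\<lambda>x. complex_of_real (F ((norm x)\<^sup>2))) x =
     (2 * of_real (x \<bullet> b)) * of_real (G ((norm x)\<^sup>2))" if "x \<in> S" for x b
    using partial_eqI[OF d[OF that]] by simp
  note p = Ck_cong[OF assms(1) this]
  have "Ck S n (\<lambda>x. of_real (x \<bullet> b))" "Ck S n (\<lambda>x. 2)" for b
    using smooth_on_inner[of S b] smooth_on_const[of S 2] by (auto simp: smooth_on_def)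
  then have "Ck S n (partials [b] (\<lambda>x. of_real (F ((norm x)\<^sup>2))))" for b
    using Suc.IH[OF G(1)] by (subst p) (auto intro!: Ck_mult[OF assms(1)])
  then show ?case using d by (auto simp: differentiable_def simp del: partials.simps)
qed simp

lemma smooth_on_radial:
  fixes F :: "real \<Rightarrow> real" and S :: "'a::euclidean_space set"
  assumes "open S" "\<And>x. x \<in> S \<Longrightarrow> (norm x)\<^sup>2 \<in> T" "F \<in> \<F>"
    and "\<And>F. F \<in> \<F> \<Longrightarrow> \<exists>G\<in>\<F>. \<forall>t\<in>T. (F has_real_derivative G t) (at t)"
  shows "smooth_on S (\<lambda>x. of_real (F ((norm x)\<^sup>2)))"
  unfolding smooth_on_def using Ck_radial[OF assms(1,2,4,3)] by blast

lemma smooth_on_exp_inner: "smooth_on S (\<lambda>x. exp (\<i> * of_real (x \<bullet> \<xi>)))"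
proof -
  have d: "((\<lambda>x. exp (\<i> * of_real (x \<bullet> \<xi>))) has_derivative (\<lambda>h. (\<i> * of_real (h \<bullet> \<xi>)) * exp (\<i> * of_real (x \<bullet> \<xi>)))) (at x)" for x :: 'a
  proof -
    have "((\<lambda>x. \<i> * complex_of_real (x \<bullet> \<xi>)) has_derivative (\<lambda>h. \<i> * of_real (h \<bullet> \<xi>))) (at x)"
      by (auto intro!: derivative_eq_intros)
    from has_derivative_compose[OF this DERIV_exp[unfolded has_field_derivative_def]]
    show ?thesis by (simp add: mult.commute)
  qed
  have "Ck UNIV n (\<lambda>x::'a. exp (\<i> * of_real (x \<bullet> \<xi>)))" for n
  proof (induction n)
    case (Suc n)
    have "partials [b] (\<lambda>x. exp (\<i> * of_real (x \<bullet> \<xi>))) = (\<lambda>x. (\<i> * of_real (b \<bullet> \<xi>)) * exp (\<i> * of_real (x \<bullet> \<xi>)))" for b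
      using partial_eqI[OF d] by (intro ext)
    moreover have "Ck UNIV n (\<lambda>x::'a. \<i> * of_real (b \<bullet> \<xi>))" for b using smooth_on_const by (auto simp: smooth_on_def)
    moreover have "Ck UNIV n (\<lambda>x::'a. (\<i> * of_real (b \<bullet> \<xi>)) * exp (\<i> * of_real (x \<bullet> \<xi>)))" for b
      by (intro Ck_mult open_UNIV Suc calculation)
    moreover have "(\<lambda>x. exp (\<i> * of_real (x \<bullet> \<xi>))) differentiable (at x)" for x
      using d unfolding differentiable_def by blast
    ultimately show ?case by (simp del: partials.simps)
  qed simp
  then show ?thesis using smooth_on_subset[of UNIV _ S] by (auto simp: smooth_on_def)
qed

text \<open>Smoothness enters because \<open>frechet_derivative\<close> is an arbitrary choice where
  a function is not differentiable, and then need not be additive.\<close>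

lemma partials_add:
  assumes "smooth \<phi>" "smooth \<psi>" "bs \<in> lists Basis"
  shows "partials bs (\<lambda>x. \<phi> x + \<psi> x) = (\<lambda>x. partials bs \<phi> x + partials bs \<psi> x)"
  using assms
proof (induction bs)
  case (Cons b bs)
  have "partials bs \<phi> differentiable (at x)" "partials bs \<psi> differentiable (at x)" for x
    using Cons by (auto simp: smooth_def)
  from partial_add[OF this, of b] show ?case using Cons by (intro ext) auto
qed simp

lemma partials_cmult:
  assumes "smooth \<phi>" "bs \<in> lists Basis"
  shows "partials bs (\<lambda>x. c * \<phi> x) = (\<lambda>x. c * partials bs \<phi> x)"
  using assms
proof (induction bs)
  case (Cons b bs)
  have "partials bs \<phi> differentiable (at x)" for x
    using Cons by (auto simp: smooth_def)
  from partial_mult[OF _ this, of "\<lambda>x. c" _ b] show ?case using Cons partial_const[of b c]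
    by (intro ext) auto
qed simp

section \<open>Gaussians and Fourier inversion\<close>

lemma lborel_nn_integral_affine:
  fixes t :: "'a::euclidean_space"
  assumes [measurable]: "F \<in> borel_measurable borel" and "c \<noteq> 0"
  shows "(\<integral>\<^sup>+x. F x \<partial>lborel) = ennreal (\<bar>c\<bar> ^ DIM('a)) * (\<integral>\<^sup>+x. F (t + c *\<^sub>R x) \<partial>lborel)"
  by (subst lborel_affine[OF assms(2), of t])
     (simp add: nn_integral_density nn_integral_distr nn_integral_cmult ennreal_power)

lemma lborel_integrable_affine:
  fixes F :: "'a::euclidean_space \<Rightarrow> 'b::{banach, second_countable_topology}"
  assumes F: "integrable lborel F" and c: "c \<noteq> 0"
  shows "integrable lborel (\<lambda>x. F (t + c *\<^sub>R x))"
  using F F[THEN borel_measurable_integrable] c unfolding integrable_iff_bounded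
  by (subst (asm) lborel_nn_integral_affine[where c=c and t=t]) (auto simp: ennreal_mult_less_top)

lemma lborel_integral_affine:
  fixes F :: "'a::euclidean_space \<Rightarrow> 'b::{banach, second_countable_topology}"
  assumes F: "integrable lborel F" and c: "c \<noteq> 0"
  shows "(\<integral>x. F x \<partial>lborel) = (\<bar>c\<bar> ^ DIM('a)) *\<^sub>R (\<integral>x. F (t + c *\<^sub>R x) \<partial>lborel)"
  using F F[THEN borel_measurable_integrable] c lborel_integrable_affine[OF F c, of t]
  by (subst lborel_affine[OF c, of t]) (simp add: integral_density integral_distr ennreal_power)

text \<open>A rescaling of the characteristic function of the standard normal distribution. The
  parameter s is an inverse width, so the transform has width s.\<close>

lemma gaussian_fourier_real:
  assumes s: "s > 0"
  shows "has_bochner_integral lborel (\<lambda>x. of_real (exp (- (s * x)\<^sup>2 / 2)) * exp (- \<i> * of_real (x * t)))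
    (of_real (sqrt (2 * pi) / s * exp (- (t / s)\<^sup>2 / 2)))"
proof -
  let ?f = "\<lambda>x::real. complex_of_real (exp (- x\<^sup>2 / 2)) * exp (\<i> * of_real ((- t / s) * x))"
  have eq: "std_normal_density x *\<^sub>R exp (\<i> * of_real ((- t / s) * x)) = (1 / sqrt (2 * pi)) *\<^sub>R ?f x" for x
    by (simp add: std_normal_density_def scaleR_conv_of_real)
  have int: "integrable lborel (\<lambda>x. std_normal_density x *\<^sub>R exp (\<i> * of_real ((- t / s) * x)))"
    by (rule Bochner_Integration.integrable_bound[where f=std_normal_density]) auto
  from integrable_scaleR_right[OF this, of "sqrt (2 * pi)"] have i: "integrable lborel ?f"
    unfolding eq by simp
  have "(\<integral>x. std_normal_density x *\<^sub>R exp (\<i> * of_real ((- t / s) * x)) \<partial>lborel)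
      = char std_normal_distribution (- t / s)"
    unfolding char_def by (subst integral_density) (auto simp: normal_density_nonneg)
  also have "\<dots> = of_real (exp (- (t / s)\<^sup>2 / 2))"
    by (simp add: char_std_normal_distribution)
  finally have "(1 / sqrt (2 * pi)) *\<^sub>R (\<integral>x. ?f x \<partial>lborel) = of_real (exp (- (t / s)\<^sup>2 / 2))"
    unfolding eq integral_scaleR_right .
  then have "sqrt (2 * pi) *\<^sub>R ((1 / sqrt (2 * pi)) *\<^sub>R (\<integral>x. ?f x \<partial>lborel))
      = sqrt (2 * pi) *\<^sub>R of_real (exp (- (t / s)\<^sup>2 / 2))"
    by (rule arg_cong)
  then have v: "(\<integral>x. ?f x \<partial>lborel) = of_real (sqrt (2 * pi) * exp (- (t / s)\<^sup>2 / 2))"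
    unfolding scaleR_scaleR by (simp add: scaleR_conv_of_real)
  have f: "?f (0 + s * x) = of_real (exp (- (s * x)\<^sup>2 / 2)) * exp (- \<i> * of_real (x * t))" for x
    using s by (simp add: mult.commute mult.left_commute)
  have "integrable lborel (\<lambda>x. ?f (0 + s * x))"
    using i s by (intro lborel_integrable_real_affine) auto
  moreover have "(\<integral>x. ?f x \<partial>lborel) = \<bar>s\<bar> *\<^sub>R (\<integral>x. ?f (0 + s * x) \<partial>lborel)"
    using s by (intro lborel_integral_real_affine) auto
  ultimately show ?thesis
    using s unfolding f v has_bochner_integral_iff
    by (simp add: scaleR_conv_of_real field_simps)
qed

text \<open>Both the Gaussian and the exponential factor over the coordinates, and
  \<open>lborel\<close> is the image of a product measure.\<close>

lemma gaussian_fourier: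
  fixes \<zeta> :: "'a::euclidean_space"
  assumes s: "s > 0"
  shows "has_bochner_integral lborel
    (\<lambda>x::'a. of_real (exp (- (s * norm x)\<^sup>2 / 2)) * exp (- \<i> * of_real (x \<bullet> \<zeta>)))
    (of_real ((sqrt (2 * pi) / s) ^ DIM('a) * exp (- (norm \<zeta> / s)\<^sup>2 / 2)))"
proof -
  let ?F = "\<lambda>x::'a. complex_of_real (exp (- (s * norm x)\<^sup>2 / 2)) * exp (- \<i> * of_real (x \<bullet> \<zeta>))"
  let ?f = "\<lambda>b r. complex_of_real (exp (- (s * r)\<^sup>2 / 2)) * exp (- \<i> * of_real (r * (\<zeta> \<bullet> b)))"
  interpret P: product_sigma_finite "\<lambda>_::'a. lborel :: real measure" by standard
  have prod: "?F (\<Sum>b\<in>Basis. y b *\<^sub>R b) = (\<Prod>b\<in>Basis. ?f b (y b))" for y :: "'a \<Rightarrow> real"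
  proof -
    define x where "x = (\<Sum>b\<in>Basis. y b *\<^sub>R b)"
    have yb: "b \<in> Basis \<Longrightarrow> x \<bullet> b = y b" for b
      by (simp add: x_def)
    have 1: "(s * norm x)\<^sup>2 = (\<Sum>b\<in>Basis. (s * y b)\<^sup>2)"
        by (simp add: power_mult_distrib power2_norm_eq_inner euclidean_inner[of x x] yb)
        (simp add: sum_distrib_left power2_eq_square)
    have 2: "x \<bullet> \<zeta> = (\<Sum>b\<in>Basis. y b * (\<zeta> \<bullet> b))"
      by (simp add: euclidean_inner[of x \<zeta>] yb)
    have "- (s * norm x)\<^sup>2 / 2 = (\<Sum>b\<in>Basis. - (s * y b)\<^sup>2 / 2)"
      unfolding 1 by (simp add: sum_negf sum_divide_distrib)
    then have "exp (- (s * norm x)\<^sup>2 / 2) = (\<Prod>b\<in>Basis. exp (- (s * y b)\<^sup>2 / 2))"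
      by (simp add: exp_sum)
    moreover have "exp (- \<i> * complex_of_real (x \<bullet> \<zeta>)) = (\<Prod>b\<in>Basis. exp (- \<i> * of_real (y b * (\<zeta> \<bullet> b))))"
      unfolding 2 by (simp add: exp_sum sum_distrib_left flip: sum_negf)
    ultimately show ?thesis
      unfolding x_def[symmetric] by (simp add: prod.distrib)
  qed
  have i: "integrable lborel (?f b)" and v: "(\<integral>r. ?f b r \<partial>lborel) = of_real (sqrt (2 * pi) / s * exp (- ((\<zeta> \<bullet> b) / s)\<^sup>2 / 2))" for b
    using gaussian_fourier_real[OF s, of "\<zeta> \<bullet> b"] by (auto simp: has_bochner_integral_iff)
  have "has_bochner_integral (\<Pi>\<^sub>M b\<in>Basis. lborel) (\<lambda>y. \<Prod>b\<in>Basis. ?f b (y b))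
      (\<Prod>b\<in>Basis. of_real (sqrt (2 * pi) / s * exp (- ((\<zeta> \<bullet> b) / s)\<^sup>2 / 2)))"
    unfolding has_bochner_integral_iff
    using P.product_integrable_prod[of Basis ?f] P.product_integral_prod[of Basis ?f] i v by simp
  also have "(\<Prod>b\<in>Basis. complex_of_real (sqrt (2 * pi) / s * exp (- ((\<zeta> \<bullet> b) / s)\<^sup>2 / 2)))
      = of_real ((sqrt (2 * pi) / s) ^ DIM('a) * exp (- (norm \<zeta> / s)\<^sup>2 / 2))"
  proof -
    have "(norm \<zeta>)\<^sup>2 = (\<Sum>b\<in>Basis. (\<zeta> \<bullet> b)\<^sup>2)"
      unfolding power2_norm_eq_inner by (subst euclidean_inner) (simp add: power2_eq_square)
    then have "- (norm \<zeta> / s)\<^sup>2 / 2 = (\<Sum>b\<in>Basis. - ((\<zeta> \<bullet> b) / s)\<^sup>2 / 2)"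
      by (simp add: power_divide sum_divide_distrib sum_negf)
    then have "exp (- (norm \<zeta> / s)\<^sup>2 / 2) = (\<Prod>b\<in>Basis. exp (- ((\<zeta> \<bullet> b) / s)\<^sup>2 / 2))"
      by (simp add: exp_sum)
    then show ?thesis unfolding of_real_prod[symmetric] of_real_eq_iff prod.distrib prod_constant by simp
  qed
  finally have *: "has_bochner_integral (\<Pi>\<^sub>M b\<in>Basis. lborel) (\<lambda>y. ?F (\<Sum>b\<in>Basis. y b *\<^sub>R b))
      (of_real ((sqrt (2 * pi) / s) ^ DIM('a) * exp (- (norm \<zeta> / s)\<^sup>2 / 2)))"
    unfolding prod .
  show ?thesis
    by (subst lborel_eq, rule has_bochner_integral_distr[where f="?F", OF _ _ *]) measurable
qed

lemma gaussian_nn_integral: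
  fixes y :: "'a::euclidean_space"
  assumes s: "s > 0"
  shows "(\<integral>\<^sup>+x. ennreal (exp (- (s * norm (x - y))\<^sup>2 / 2)) \<partial>lborel) = ennreal ((sqrt (2 * pi) / s) ^ DIM('a))"
    and "integrable lborel (\<lambda>x::'a. exp (- (s * norm x)\<^sup>2 / 2))"
    and "(\<integral>x. exp (- (s * norm (x::'a))\<^sup>2 / 2) \<partial>lborel) = (sqrt (2 * pi) / s) ^ DIM('a)"
proof -
  have *: "has_bochner_integral lborel (\<lambda>x::'a. complex_of_real (exp (- (s * norm x)\<^sup>2 / 2))) (of_real ((sqrt (2 * pi) / s) ^ DIM('a)))"
    using gaussian_fourier[OF s, of 0] by simp
  then show i: "integrable lborel (\<lambda>x::'a. exp (- (s * norm x)\<^sup>2 / 2))"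
    by (simp only: has_bochner_integral_iff complex_of_real_integrable_eq)
  from * show v: "(\<integral>x. exp (- (s * norm (x::'a))\<^sup>2 / 2) \<partial>lborel) = (sqrt (2 * pi) / s) ^ DIM('a)"
    unfolding has_bochner_integral_iff integral_complex_of_real of_real_eq_iff by blast
  have "(\<integral>\<^sup>+x. ennreal (exp (- (s * norm (x - y))\<^sup>2 / 2)) \<partial>lborel) = (\<integral>\<^sup>+x. ennreal (exp (- (s * norm (x::'a))\<^sup>2 / 2)) \<partial>lborel)"
    using lborel_nn_integral_affine[of "\<lambda>x::'a. ennreal (exp (- (s * norm (x - y))\<^sup>2 / 2))" 1 y] by simp
  also have "\<dots> = ennreal ((sqrt (2 * pi) / s) ^ DIM('a))"
    using nn_integral_eq_integral[OF i] v by simp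
  finally show "(\<integral>\<^sup>+x. ennreal (exp (- (s * norm (x - y))\<^sup>2 / 2)) \<partial>lborel) = ennreal ((sqrt (2 * pi) / s) ^ DIM('a))" .
qed

lemma (in pair_sigma_finite) integrable_pair_mult:
  fixes f g :: "_ \<Rightarrow> complex"
  assumes [measurable]: "integrable M1 f" "integrable M2 g"
  shows "integrable (M1 \<Otimes>\<^sub>M M2) (\<lambda>(x, y). f x * g y)"
    and "(\<integral>z. (case z of (x, y) \<Rightarrow> f x * g y) \<partial>(M1 \<Otimes>\<^sub>M M2)) = (\<integral>x. f x \<partial>M1) * (\<integral>y. g y \<partial>M2)"
proof -
  show i: "integrable (M1 \<Otimes>\<^sub>M M2) (\<lambda>(x, y). f x * g y)"
  proof (rule Fubini_integrable)
    show "integrable M1 (\<lambda>x. \<integral>y. norm (case (x, y) of (x, y) \<Rightarrow> f x * g y) \<partial>M2)"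
      using assms by (simp add: norm_mult)
  qed (use assms in auto)
  show "(\<integral>z. (case z of (x, y) \<Rightarrow> f x * g y) \<partial>(M1 \<Otimes>\<^sub>M M2)) = (\<integral>x. f x \<partial>M1) * (\<integral>y. g y \<partial>M2)"
    by (subst integral_fst'[OF i, symmetric]) simp
qed

text \<open>Expanding the square and integrating in \<open>x\<close> gives a quadratic form with a Gaussian kernel, which is
  bounded by Schur's test.\<close>

lemma gaussian_schur:
  fixes p :: "'b \<Rightarrow> 'a::euclidean_space" and h :: "'b \<Rightarrow> complex"
  assumes "sigma_finite_measure M" and p[measurable]: "p \<in> borel_measurable M"
    and h: "integrable M h" "integrable M (\<lambda>y. (norm (h y))\<^sup>2)" and s: "s > 0" and C: "C \<ge> 0"
    and bound: "\<And>y. y \<in> space M \<Longrightarrow> (\<integral>\<^sup>+z. ennreal (exp (- (norm (p y - p z) / s)\<^sup>2 / 2)) \<partial>M) \<le> ennreal C"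
  shows "(\<integral>\<^sup>+x. ennreal (exp (- (s * norm x)\<^sup>2 / 2) * (norm (\<integral>y. h y * exp (- \<i> * of_real (x \<bullet> p y)) \<partial>M))\<^sup>2) \<partial>lborel)
     \<le> ennreal ((sqrt (2 * pi) / s) ^ DIM('a) * C * (\<integral>y. (norm (h y))\<^sup>2 \<partial>M))"
proof -
  interpret M: sigma_finite_measure M by fact
  interpret MM: pair_sigma_finite M M ..
  interpret P: pair_sigma_finite lborel "M \<Otimes>\<^sub>M M" ..
  note [measurable] = h(1)[THEN borel_measurable_integrable]
  define \<gamma> where "\<gamma> x = exp (- (s * norm x)\<^sup>2 / 2)" for x :: 'a
  define G where "G \<zeta> = (sqrt (2 * pi) / s) ^ DIM('a) * exp (- (norm \<zeta> / s)\<^sup>2 / 2)" for \<zeta> :: 'a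
  have [measurable]: "\<gamma> \<in> borel_measurable borel" "G \<in> borel_measurable borel"
    unfolding \<gamma>_def[abs_def] G_def[abs_def] by measurable
  have G0: "G \<zeta> \<ge> 0" for \<zeta>
    using s by (simp add: G_def)
  define E where "E x = (\<integral>y. h y * exp (- \<i> * of_real (x \<bullet> p y)) \<partial>M)" for x
  define K where "K = (\<lambda>(x, y, z). of_real (\<gamma> x) * ((h y * exp (- \<i> * of_real (x \<bullet> p y))) * cnj (h z * exp (- \<i> * of_real (x \<bullet> p z)))))"
  have [measurable]: "cnj \<in> borel_measurable borel"
    by (intro borel_measurable_continuous_onI continuous_intros)
  have [measurable]: "K \<in> borel_measurable (lborel \<Otimes>\<^sub>M (M \<Otimes>\<^sub>M M))"
    unfolding K_def by measurable
  have ih: "integrable M (\<lambda>y. h y * exp (- \<i> * of_real (x \<bullet> p y)))" for x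
    by (rule Bochner_Integration.integrable_bound[OF h(1)]) (auto simp: norm_mult)
  have "integrable (M \<Otimes>\<^sub>M M) (\<lambda>(y, z). h y * cnj (h z))"
    using h(1) by (intro MM.integrable_pair_mult) simp_all
  moreover have "integrable lborel (\<lambda>x. complex_of_real (\<gamma> x))"
    using gaussian_nn_integral(2)[OF s] unfolding \<gamma>_def complex_of_real_integrable_eq .
  ultimately have "integrable (lborel \<Otimes>\<^sub>M (M \<Otimes>\<^sub>M M)) (\<lambda>(x, w). of_real (\<gamma> x) * (case w of (y, z) \<Rightarrow> h y * cnj (h z)))"
    by (rule P.integrable_pair_mult(1)[rotated])
  then have iK: "integrable (lborel \<Otimes>\<^sub>M (M \<Otimes>\<^sub>M M)) K"
    by (rule Bochner_Integration.integrable_bound) (auto simp: K_def norm_mult)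
  have inner1: "(\<integral>w. K (x, w) \<partial>(M \<Otimes>\<^sub>M M)) = of_real (\<gamma> x * (norm (E x))\<^sup>2)" for x
  proof -
    have "(\<integral>w. K (x, w) \<partial>(M \<Otimes>\<^sub>M M)) = of_real (\<gamma> x) * (\<integral>w. (case w of (y, z) \<Rightarrow>
        (h y * exp (- \<i> * of_real (x \<bullet> p y))) * cnj (h z * exp (- \<i> * of_real (x \<bullet> p z)))) \<partial>(M \<Otimes>\<^sub>M M))"
      unfolding integral_mult_right_zero[symmetric]
      by (intro Bochner_Integration.integral_cong refl) (auto simp: K_def split: prod.splits)
    also have "\<dots> = of_real (\<gamma> x) * (E x * cnj (E x))"
      using ih[of x] by (subst MM.integrable_pair_mult(2)) (auto simp: E_def integrable_cnj simp del: complex_cnj_mult)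
    finally show ?thesis by (simp add: complex_norm_square[symmetric])
  qed
  have inner2: "(\<integral>x. K (x, w) \<partial>lborel) = h (fst w) * cnj (h (snd w)) * of_real (G (p (fst w) - p (snd w)))" for w
  proof -
    obtain y z where w: "w = (y, z)" by (cases w)
    have "K (x, w) = (h y * cnj (h z)) * (of_real (exp (- (s * norm x)\<^sup>2 / 2)) * exp (- \<i> * of_real (x \<bullet> (p y - p z))))" for x
    proof -
      have "exp (- \<i> * of_real (x \<bullet> (p y - p z))) = exp (- \<i> * of_real (x \<bullet> p y)) * cnj (exp (- \<i> * of_real (x \<bullet> p z)))"
        by (simp add: exp_cnj inner_diff_right ring_distribs flip: exp_add)
      then show ?thesis unfolding w K_def \<gamma>_def by (simp only: prod.case complex_cnj_mult mult_ac)
    qed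
    then show ?thesis
      using gaussian_fourier[OF s, of "p y - p z"] by (simp add: has_bochner_integral_iff G_def w)
  qed
  have ix: "integrable lborel (\<lambda>x. complex_of_real (\<gamma> x * (norm (E x))\<^sup>2))"
    using P.integrable_fst'[OF iK] unfolding inner1 .
  then have ix': "integrable lborel (\<lambda>x. \<gamma> x * (norm (E x))\<^sup>2)"
    unfolding complex_of_real_integrable_eq .
  have "(\<integral>\<^sup>+x. ennreal (\<gamma> x * (norm (E x))\<^sup>2) \<partial>lborel) = ennreal (\<integral>x. \<gamma> x * (norm (E x))\<^sup>2 \<partial>lborel)"
    using ix' by (intro nn_integral_eq_integral) (auto simp: \<gamma>_def)
  also have "\<dots> = ennreal (norm (\<integral>x. complex_of_real (\<gamma> x * (norm (E x))\<^sup>2) \<partial>lborel))"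
    unfolding integral_complex_of_real norm_of_real by (simp add: \<gamma>_def)
  also have "(\<integral>x. complex_of_real (\<gamma> x * (norm (E x))\<^sup>2) \<partial>lborel) = (\<integral>w. (\<integral>x. K (x, w) \<partial>lborel) \<partial>(M \<Otimes>\<^sub>M M))"
    unfolding inner1[symmetric]
    using P.integral_fst'[OF iK] P.integral_snd[of "\<lambda>x w. K (x, w)"] iK by simp
  also have "ennreal (norm \<dots>) \<le> (\<integral>\<^sup>+w. ennreal (norm (\<integral>x. K (x, w) \<partial>lborel)) \<partial>(M \<Otimes>\<^sub>M M))"
    using P.integrable_snd[of "\<lambda>x w. K (x, w)"] iK by (intro integral_norm_bound_ennreal) simp
  also have "\<dots> = (\<integral>\<^sup>+y. \<integral>\<^sup>+z. ennreal (norm (h y) * norm (h z) * G (p y - p z)) \<partial>M \<partial>M)"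
    unfolding inner2 by (subst M.nn_integral_fst[symmetric]) (auto simp: norm_mult G0)
  \<comment> \<open>The arithmetic-geometric mean inequality, with the kernel argument reversed in
    the second summand: after an exchange of y and z both summands have the same integral, and one
    row bound serves for both.\<close>
  also have "\<dots> \<le> (\<integral>\<^sup>+y. \<integral>\<^sup>+z. (ennreal (1/2 * (norm (h y))\<^sup>2 * G (p y - p z)) + ennreal (1/2 * (norm (h z))\<^sup>2 * G (p z - p y))) \<partial>M \<partial>M)"
  proof (intro nn_integral_mono)
    fix y z
    have G0: "G (p y - p z) \<ge> 0" and GG: "G (p z - p y) = G (p y - p z)"
      using s by (auto simp: G_def norm_minus_commute)
    have "norm (h y) * norm (h z) \<le> 1/2 * (norm (h y))\<^sup>2 + 1/2 * (norm (h z))\<^sup>2"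
      using sum_squares_bound[of "norm (h y)" "norm (h z)"] by simp
    from mult_right_mono[OF this G0]
    show "ennreal (norm (h y) * norm (h z) * G (p y - p z)) \<le>
        ennreal (1/2 * (norm (h y))\<^sup>2 * G (p y - p z)) + ennreal (1/2 * (norm (h z))\<^sup>2 * G (p z - p y))"
      using G0 unfolding GG by (subst ennreal_plus[symmetric]) (auto simp: algebra_simps simp del: ennreal_plus intro!: ennreal_leI)
  qed
  also have "\<dots> = (\<integral>\<^sup>+y. \<integral>\<^sup>+z. ennreal (1/2 * (norm (h y))\<^sup>2 * G (p y - p z)) \<partial>M \<partial>M)
      + (\<integral>\<^sup>+y. \<integral>\<^sup>+z. ennreal (1/2 * (norm (h z))\<^sup>2 * G (p z - p y)) \<partial>M \<partial>M)"
    by (subst nn_integral_add[symmetric]) (auto simp: nn_integral_add)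
  also have "(\<integral>\<^sup>+y. \<integral>\<^sup>+z. ennreal (1/2 * (norm (h z))\<^sup>2 * G (p z - p y)) \<partial>M \<partial>M)
      = (\<integral>\<^sup>+y. \<integral>\<^sup>+z. ennreal (1/2 * (norm (h y))\<^sup>2 * G (p y - p z)) \<partial>M \<partial>M)"
    by (rule MM.Fubini') measurable
  also have "(\<integral>\<^sup>+y. \<integral>\<^sup>+z. ennreal (1/2 * (norm (h y))\<^sup>2 * G (p y - p z)) \<partial>M \<partial>M)
      \<le> (\<integral>\<^sup>+y. ennreal (1/2 * ((sqrt (2 * pi) / s) ^ DIM('a) * C) * (norm (h y))\<^sup>2) \<partial>M)"
  proof (rule nn_integral_mono)
    fix y assume y: "y \<in> space M"
    have "(\<integral>\<^sup>+z. ennreal (1/2 * (norm (h y))\<^sup>2 * G (p y - p z)) \<partial>M)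
      = (\<integral>\<^sup>+z. ennreal (1/2 * (norm (h y))\<^sup>2 * (sqrt (2 * pi) / s) ^ DIM('a)) * ennreal (exp (- (norm (p y - p z) / s)\<^sup>2 / 2)) \<partial>M)"
      using s by (intro nn_integral_cong) (simp add: G_def ennreal_mult'' [symmetric] mult.assoc)
    also have "\<dots> = ennreal (1/2 * (norm (h y))\<^sup>2 * (sqrt (2 * pi) / s) ^ DIM('a)) * (\<integral>\<^sup>+z. ennreal (exp (- (norm (p y - p z) / s)\<^sup>2 / 2)) \<partial>M)"
      by (rule nn_integral_cmult) measurable
    also have "\<dots> \<le> ennreal (1/2 * (norm (h y))\<^sup>2 * (sqrt (2 * pi) / s) ^ DIM('a)) * ennreal C"
      by (intro mult_left_mono bound y) simp
    also have "\<dots> = ennreal (1/2 * ((sqrt (2 * pi) / s) ^ DIM('a) * C) * (norm (h y))\<^sup>2)"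
      using s C by (simp add: ennreal_mult'' [symmetric] mult_ac)
    finally show "(\<integral>\<^sup>+z. ennreal (1/2 * (norm (h y))\<^sup>2 * G (p y - p z)) \<partial>M) \<le> \<dots>" .
  qed
  also have "\<dots> = ennreal (\<integral>y. 1/2 * ((sqrt (2 * pi) / s) ^ DIM('a) * C) * (norm (h y))\<^sup>2 \<partial>M)"
    using h(2) s C by (intro nn_integral_eq_integral) auto
  finally have "(\<integral>\<^sup>+x. ennreal (\<gamma> x * (norm (E x))\<^sup>2) \<partial>lborel)
    \<le> ennreal (\<integral>y. 1/2 * ((sqrt (2 * pi) / s) ^ DIM('a) * C) * (norm (h y))\<^sup>2 \<partial>M)
     + ennreal (\<integral>y. 1/2 * ((sqrt (2 * pi) / s) ^ DIM('a) * C) * (norm (h y))\<^sup>2 \<partial>M)"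
    by (simp add: add_mono)
  also have "\<dots> = ennreal ((sqrt (2 * pi) / s) ^ DIM('a) * C * (\<integral>y. (norm (h y))\<^sup>2 \<partial>M))"
    using s C by (subst ennreal_plus[symmetric]) auto
  finally show ?thesis unfolding \<gamma>_def E_def .
qed

text \<open>A Gaussian factor of width 1/s makes the double integral absolutely convergent. Fubini's
  theorem and \<open>gaussian_fourier\<close> turn it into an average of \<phi> over a Gaussian of
  width s around x, and s tends to 0 on both sides.\<close>

lemma fourier_inversion:
  fixes \<phi> :: "'a::euclidean_space \<Rightarrow> complex"
  assumes cont: "continuous_on UNIV \<phi>" and B: "\<And>x. norm (\<phi> x) \<le> B"
    and int: "integrable lborel \<phi>" and intF: "integrable lborel (fourier \<phi>)"
  shows "(\<integral>\<xi>. fourier \<phi> \<xi> * exp (\<i> * of_real (x \<bullet> \<xi>)) \<partial>lborel) = of_real ((2 * pi) ^ DIM('a)) * \<phi> x"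
proof -
  define s where "s n = 1 / real (Suc n)" for n
  have s0: "s n > 0" and slim: "s \<longlonglongrightarrow> 0" for n
    using LIMSEQ_inverse_real_of_nat by (auto simp: s_def[abs_def] inverse_eq_divide simp del: of_nat_Suc)
  note [measurable] = borel_measurable_integrable[OF int] borel_measurable_integrable[OF intF]
  let ?L = "\<lambda>n. (\<integral>\<xi>. fourier \<phi> \<xi> * exp (\<i> * of_real (x \<bullet> \<xi>)) * of_real (exp (- (s n * norm \<xi>)\<^sup>2 / 2)) \<partial>lborel)"
  have L1: "?L \<longlonglongrightarrow> (\<integral>\<xi>. fourier \<phi> \<xi> * exp (\<i> * of_real (x \<bullet> \<xi>)) * of_real 1 \<partial>lborel)"
  proof (rule integral_dominated_convergence[where w="\<lambda>\<xi>. norm (fourier \<phi> \<xi>)"])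
    show "AE \<xi> in lborel. (\<lambda>n. fourier \<phi> \<xi> * exp (\<i> * of_real (x \<bullet> \<xi>)) * of_real (exp (- (s n * norm \<xi>)\<^sup>2 / 2)))
      \<longlonglongrightarrow> fourier \<phi> \<xi> * exp (\<i> * of_real (x \<bullet> \<xi>)) * of_real 1"
    proof (rule AE_I2)
      fix \<xi> :: 'a
      have "(\<lambda>n. exp (- (s n * norm \<xi>)\<^sup>2 / 2)) \<longlonglongrightarrow> exp (- (0 * norm \<xi>)\<^sup>2 / 2)"
        by (intro tendsto_intros slim) auto
      then show "(\<lambda>n. fourier \<phi> \<xi> * exp (\<i> * of_real (x \<bullet> \<xi>)) * of_real (exp (- (s n * norm \<xi>)\<^sup>2 / 2)))
      \<longlonglongrightarrow> fourier \<phi> \<xi> * exp (\<i> * of_real (x \<bullet> \<xi>)) * of_real 1"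
        by (intro tendsto_intros) simp
    qed
    show "AE \<xi> in lborel. norm (fourier \<phi> \<xi> * exp (\<i> * of_real (x \<bullet> \<xi>)) * of_real (exp (- (s n * norm \<xi>)\<^sup>2 / 2))) \<le> norm (fourier \<phi> \<xi>)" for n
      by (auto simp: norm_mult mult_left_le)
  qed (use intF in auto)
  have L2: "?L n = of_real (sqrt (2 * pi) ^ DIM('a)) * (\<integral>z. \<phi> (x + s n *\<^sub>R z) * of_real (exp (- (1 * norm z)\<^sup>2 / 2)) \<partial>lborel)" for n
  proof -
    define K where "K = (\<lambda>(\<xi>, y). of_real (exp (- (s n * norm \<xi>)\<^sup>2 / 2)) * exp (- \<i> * of_real (\<xi> \<bullet> (y - x))) * \<phi> y)"
    have [measurable]: "K \<in> borel_measurable (lborel \<Otimes>\<^sub>M lborel)" unfolding K_def by measurable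
    have "integrable lborel (\<lambda>\<xi>. complex_of_real (exp (- (s n * norm (\<xi>::'a))\<^sup>2 / 2)))"
      using gaussian_nn_integral(2)[OF s0] unfolding complex_of_real_integrable_eq .
    then have "integrable (lborel \<Otimes>\<^sub>M lborel) (\<lambda>(\<xi>::'a, y). of_real (exp (- (s n * norm \<xi>)\<^sup>2 / 2)) * \<phi> y)"
      by (rule lborel_pair.integrable_pair_mult) (rule int)
    then have iK: "integrable (lborel \<Otimes>\<^sub>M lborel) K"
      by (rule Bochner_Integration.integrable_bound) (auto simp: K_def norm_mult)
    have "?L n = (\<integral>\<xi>. (\<integral>y. K (\<xi>, y) \<partial>lborel) \<partial>lborel)"
    proof (rule Bochner_Integration.integral_cong[OF refl])
      fix \<xi> :: 'a
      have "K (\<xi>, y) = (\<phi> y * exp (- \<i> * of_real (y \<bullet> \<xi>))) * (exp (\<i> * of_real (x \<bullet> \<xi>)) * of_real (exp (- (s n * norm \<xi>)\<^sup>2 / 2)))" for y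
      proof -
        have "exp (- \<i> * of_real (\<xi> \<bullet> (y - x))) = exp (- \<i> * of_real (y \<bullet> \<xi>)) * exp (\<i> * of_real (x \<bullet> \<xi>))"
          by (simp add: inner_diff_right ring_distribs inner_commute flip: exp_add)
        then show ?thesis unfolding K_def by (simp only: prod.case mult_ac)
      qed
      then show "fourier \<phi> \<xi> * exp (\<i> * of_real (x \<bullet> \<xi>)) * of_real (exp (- (s n * norm \<xi>)\<^sup>2 / 2)) = (\<integral>y. K (\<xi>, y) \<partial>lborel)"
        unfolding fourier_def by (simp only: integral_mult_left_zero) (simp only: mult.assoc)
    qed
    also have "\<dots> = (\<integral>y. (\<integral>\<xi>. K (\<xi>, y) \<partial>lborel) \<partial>lborel)"
      using lborel_pair.integral_fst'[OF iK] lborel_pair.integral_snd[of "\<lambda>x w. K (x, w)"] iK by simp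
    also have "\<dots> = (\<integral>y. of_real ((sqrt (2 * pi) / s n) ^ DIM('a)) * (\<phi> y * of_real (exp (- (norm (y - x) / s n)\<^sup>2 / 2))) \<partial>lborel)"
    proof (rule Bochner_Integration.integral_cong[OF refl])
      fix y
      show "(\<integral>\<xi>. K (\<xi>, y) \<partial>lborel) = of_real ((sqrt (2 * pi) / s n) ^ DIM('a)) * (\<phi> y * of_real (exp (- (norm (y - x) / s n)\<^sup>2 / 2)))"
        using gaussian_fourier[OF s0[of n], of "y - x"]
        by (simp add: K_def has_bochner_integral_iff mult_ac)
    qed
    also have "\<dots> = of_real ((sqrt (2 * pi) / s n) ^ DIM('a)) * (\<integral>y. \<phi> y * of_real (exp (- (norm (y - x) / s n)\<^sup>2 / 2)) \<partial>lborel)"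
      by (rule integral_mult_right_zero)
    also have "(\<integral>y. \<phi> y * of_real (exp (- (norm (y - x) / s n)\<^sup>2 / 2)) \<partial>lborel)
       = (\<bar>s n\<bar> ^ DIM('a)) *\<^sub>R (\<integral>z. \<phi> (x + s n *\<^sub>R z) * of_real (exp (- (norm ((x + s n *\<^sub>R z) - x) / s n)\<^sup>2 / 2)) \<partial>lborel)"
      using s0[of n] by (intro lborel_integral_affine Bochner_Integration.integrable_bound[OF int]) (auto simp: norm_mult mult_left_le)
    finally show ?thesis
      using s0[of n] by (simp add: scaleR_conv_of_real power_divide)
  qed
  have L3: "(\<lambda>n. of_real (sqrt (2 * pi) ^ DIM('a)) * (\<integral>z. \<phi> (x + s n *\<^sub>R z) * of_real (exp (- (1 * norm (z::'a))\<^sup>2 / 2)) \<partial>lborel))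
    \<longlonglongrightarrow> of_real (sqrt (2 * pi) ^ DIM('a)) * (\<integral>z. \<phi> (x + 0 *\<^sub>R z) * of_real (exp (- (1 * norm (z::'a))\<^sup>2 / 2)) \<partial>lborel)"
  proof (intro tendsto_mult tendsto_const integral_dominated_convergence[where w="\<lambda>z. B * exp (- (1 * norm z)\<^sup>2 / 2)"])
    have "isCont \<phi> y" for y using cont by (simp add: continuous_on_eq_continuous_at)
    then have "(\<lambda>n. \<phi> (x + s n *\<^sub>R z)) \<longlonglongrightarrow> \<phi> (x + 0 *\<^sub>R z)" for z
      by (rule isCont_tendsto_compose) (intro tendsto_intros slim)
    then show "AE z in lborel. (\<lambda>n. \<phi> (x + s n *\<^sub>R z) * of_real (exp (- (1 * norm z)\<^sup>2 / 2)))
      \<longlonglongrightarrow> \<phi> (x + 0 *\<^sub>R z) * of_real (exp (- (1 * norm z)\<^sup>2 / 2))"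
      by (intro AE_I2 tendsto_intros)
    show "integrable lborel (\<lambda>z::'a. B * exp (- (1 * norm z)\<^sup>2 / 2))"
      using gaussian_nn_integral(2)[of 1] by (intro integrable_mult_right) simp
  qed (auto simp: norm_mult B)
  \<comment> \<open>One factor \<open>sqrt (2 * pi)\<close> per dimension comes from the transform
    of the Gaussian, the other from its total mass.\<close>
  have L4: "of_real (sqrt (2 * pi) ^ DIM('a)) * (\<integral>z. \<phi> (x + 0 *\<^sub>R z) * of_real (exp (- (1 * norm (z::'a))\<^sup>2 / 2)) \<partial>lborel)
    = of_real ((2 * pi) ^ DIM('a)) * \<phi> x"
  proof -
    have "(\<integral>z. \<phi> (x + 0 *\<^sub>R z) * of_real (exp (- (1 * norm (z::'a))\<^sup>2 / 2)) \<partial>lborel) = \<phi> x * of_real (sqrt (2 * pi) ^ DIM('a))"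
      unfolding integral_mult_right_zero scaleR_zero_left add_0_right integral_complex_of_real
      using gaussian_nn_integral(3)[of 1, where 'a='a] by simp
    moreover have "complex_of_real (sqrt (2 * pi) ^ DIM('a)) * of_real (sqrt (2 * pi) ^ DIM('a)) = of_real ((2 * pi) ^ DIM('a))"
      unfolding of_real_mult[symmetric] power_mult_distrib[symmetric] by simp
    ultimately show ?thesis by (simp only: mult.commute[of "\<phi> x"] mult.assoc[symmetric])
  qed
  from LIMSEQ_unique[OF L1 L3[folded L2]] show ?thesis
    unfolding L4 by simp
qed

section \<open>Polar coordinates\<close>

lemma sets_sphere_measure: "sets sphere_measure = sets (restrict_space borel (sphere (0::'a::euclidean_space) 1))"
  by (simp add: sphere_measure_def)

lemma borel_measurable_sphere: "F \<in> borel_measurable borel \<Longrightarrow> F \<in> borel_measurable (sphere_measure :: 'a::euclidean_space measure)"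
  using measurable_cong_sets[OF sets_sphere_measure refl] measurable_restrict_space1 by blast

lemma nn_integral_sphere:
  fixes F :: "'a::euclidean_space \<Rightarrow> ennreal"
  assumes F: "F \<in> borel_measurable borel"
  shows "(\<integral>\<^sup>+\<omega>. F \<omega> \<partial>sphere_measure) = of_nat DIM('a) * (\<integral>\<^sup>+x. F (sgn x) * indicator (cball 0 1 - {0}) x \<partial>lborel)"
  unfolding sphere_measure_def
  by (subst nn_integral_scale_measure nn_integral_distr nn_integral_restrict_space;
      (simp add: measurable_sgn_sphere measurable_restrict_space1[OF F])?)+

lemma finite_measure_sphere: "finite_measure (sphere_measure :: 'a::euclidean_space measure)"
proof
  have "emeasure sphere_measure (space (sphere_measure :: 'a measure)) = (\<integral>\<^sup>+\<omega>. 1 \<partial>(sphere_measure :: 'a measure))"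
    by simp
  also have "\<dots> = of_nat DIM('a) * (\<integral>\<^sup>+x. indicator (cball 0 1 - {0::'a}) x \<partial>lborel)"
    by (subst nn_integral_sphere) auto
  also have "\<dots> \<le> of_nat DIM('a) * emeasure lborel (cball 0 1 :: 'a set)"
    by (subst nn_integral_indicator) (auto intro!: mult_left_mono emeasure_mono)
  also have "\<dots> < \<infinity>"
    using emeasure_bounded_finite[of "cball 0 1 :: 'a set"] by (auto simp: ennreal_mult_less_top ennreal_of_nat_eq_real_of_nat)
  finally show "emeasure sphere_measure (space (sphere_measure :: 'a measure)) \<noteq> \<infinity>" by simp
qed

text \<open>With c = |y| this is the last radial integral of the polar formula: its 1/d cancels the
  factor d in \<open>sphere_measure\<close>, and \<open>1 / c ^ d\<close> cancels the power of |y|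
  left by the substitutions.\<close>

lemma nn_integral_tail_power:
  assumes "c > 0" "d > 0"
  shows "(\<integral>\<^sup>+s. ennreal (1 / s ^ (d + 1)) * indicator {c..} s \<partial>lborel) = ennreal (1 / (d * c ^ d))"
proof -
  have "((\<lambda>s. - 1 / (d * s ^ d)) has_real_derivative 1 / s ^ (d + 1)) (at s)" if "c \<le> s" for s
    using that assms
    by (auto intro!: derivative_eq_intros simp: field_simps simp flip: power_Suc2 power_Suc power_add)
  moreover have "((\<lambda>s::real. - 1 / (d * s ^ d)) \<longlongrightarrow> 0) at_top"
    using assms
    by (intro tendsto_divide_0[OF tendsto_const] filterlim_at_top_imp_at_infinity
        filterlim_tendsto_pos_mult_at_top[OF tendsto_const] filterlim_pow_at_top filterlim_ident) auto
  ultimately have "(\<integral>\<^sup>+s. ennreal (1 / s ^ (d + 1)) * indicator {c..} s \<partial>lborel) = ennreal (0 - (- 1 / (d * c ^ d)))"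
    using assms by (intro nn_integral_FTC_atLeast) auto
  then show ?thesis by simp
qed

text \<open>Insert the definition of the surface measure as an integral over \<open>x\<close> in the unit ball, substitute
  \<open>r = s|x|\<close>, exchange the integrals, and substitute \<open>y = sx\<close>. The inner integral is then that of
  \<open>1/s\<^sup>d\<^sup>+\<^sup>1\<close> over \<open>s \<ge> |y|\<close>.\<close>

lemma nn_integral_polar:
  fixes F :: "'a::euclidean_space \<Rightarrow> ennreal"
  assumes F[measurable]: "F \<in> borel_measurable borel"
  shows "(\<integral>\<^sup>+\<omega>. (\<integral>\<^sup>+r. F (r *\<^sub>R \<omega>) * ennreal (r ^ (DIM('a) - 1)) * indicator {0<..} r \<partial>lborel) \<partial>sphere_measure)
    = (\<integral>\<^sup>+x. F x \<partial>lborel)"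
proof -
  let ?d = "DIM('a)"
  define A where "A = cball 0 1 - {0::'a}"
  have [measurable]: "A \<in> sets borel" by (simp add: A_def)
  \<comment> \<open>The half-line \<open>{norm x..}\<close> moves with x; the conditional form
    exhibits joint measurability in x and s.\<close>
  have ind: "(indicator {norm x..} s :: ennreal) = (if norm x \<le> s then 1 else 0)" for x :: 'a and s :: real
    by (simp add: indicator_def)
  have d1: "?d = Suc (?d - 1)" by simp
  have "(\<integral>\<^sup>+\<omega>. (\<integral>\<^sup>+r. F (r *\<^sub>R \<omega>) * ennreal (r ^ (?d - 1)) * indicator {0<..} r \<partial>lborel) \<partial>sphere_measure)
    = of_nat ?d * (\<integral>\<^sup>+x. (\<integral>\<^sup>+r. F (r *\<^sub>R sgn x) * ennreal (r ^ (?d - 1)) * indicator {0<..} r \<partial>lborel) * indicator A x \<partial>lborel)"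
    unfolding A_def by (rule nn_integral_sphere) measurable
  also have "(\<integral>\<^sup>+x. (\<integral>\<^sup>+r. F (r *\<^sub>R sgn x) * ennreal (r ^ (?d - 1)) * indicator {0<..} r \<partial>lborel) * indicator A x \<partial>lborel)
    = (\<integral>\<^sup>+x. (\<integral>\<^sup>+s. F (s *\<^sub>R x) * ennreal (norm x ^ ?d * s ^ (?d - 1)) * indicator {0<..} s * indicator A x \<partial>lborel) \<partial>lborel)"
  proof (rule nn_integral_cong)
    fix x :: 'a
    show "(\<integral>\<^sup>+r. F (r *\<^sub>R sgn x) * ennreal (r ^ (?d - 1)) * indicator {0<..} r \<partial>lborel) * indicator A x
       = (\<integral>\<^sup>+s. F (s *\<^sub>R x) * ennreal (norm x ^ ?d * s ^ (?d - 1)) * indicator {0<..} s * indicator A x \<partial>lborel)"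
    proof (cases "x = 0")
      case False
      have "(\<integral>\<^sup>+r. F (r *\<^sub>R sgn x) * ennreal (r ^ (?d - 1)) * indicator {0<..} r \<partial>lborel)
        = ennreal \<bar>norm x\<bar> * (\<integral>\<^sup>+s. F ((0 + norm x * s) *\<^sub>R sgn x) * ennreal ((0 + norm x * s) ^ (?d - 1)) * indicator {0<..} (0 + norm x * s) \<partial>lborel)"
        using False by (intro nn_integral_real_affine) auto
      also have "\<dots> = (\<integral>\<^sup>+s. ennreal \<bar>norm x\<bar> * (F ((0 + norm x * s) *\<^sub>R sgn x) * ennreal ((0 + norm x * s) ^ (?d - 1)) * indicator {0<..} (0 + norm x * s)) \<partial>lborel)"
        by (rule nn_integral_cmult[symmetric]) measurable
      also have "\<dots> = (\<integral>\<^sup>+s. F (s *\<^sub>R x) * ennreal (norm x ^ ?d * s ^ (?d - 1)) * indicator {0<..} s \<partial>lborel)"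
      proof (rule nn_integral_cong)
        fix s :: real
        show "ennreal \<bar>norm x\<bar> * (F ((0 + norm x * s) *\<^sub>R sgn x) * ennreal ((0 + norm x * s) ^ (?d - 1)) * indicator {0<..} (0 + norm x * s))
          = F (s *\<^sub>R x) * ennreal (norm x ^ ?d * s ^ (?d - 1)) * indicator {0<..} s"
        proof (cases "s > 0")
          case True
          have "(norm x * s) *\<^sub>R sgn x = s *\<^sub>R x"
            using False by (simp add: sgn_div_norm)
          moreover have "ennreal (norm x) * ennreal ((norm x * s) ^ (?d - 1)) = ennreal (norm x ^ ?d * s ^ (?d - 1))"
            using True by (subst d1) (simp add: ennreal_mult[symmetric] power_mult_distrib mult_ac del: Suc_pred DIM_positive)
          ultimately show ?thesis using True False
            by (simp add: mult_ac) (metis mult.left_commute)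
        next
          case 2: False
          then have "\<not> 0 < norm x * s" by (simp add: zero_less_mult_iff)
          then show ?thesis using 2 by simp
        qed
      qed
      finally show ?thesis by (simp add: indicator_def A_def)
    qed (simp add: A_def)
  qed
  also have "\<dots> = (\<integral>\<^sup>+s. (\<integral>\<^sup>+x. F (s *\<^sub>R x) * ennreal (norm x ^ ?d * s ^ (?d - 1)) * indicator {0<..} s * indicator A x \<partial>lborel) \<partial>lborel)"
    by (rule lborel_pair.Fubini') measurable
  also have "\<dots> = (\<integral>\<^sup>+s. (\<integral>\<^sup>+x. F x * ennreal (norm x ^ ?d) * indicator (- {0}) x * (ennreal (1 / s ^ (?d + 1)) * indicator {norm x..} s) \<partial>lborel) \<partial>lborel)"
  proof (rule nn_integral_cong)
    fix s :: real
    let ?H = "\<lambda>x. F x * ennreal (norm x ^ ?d) * indicator (- {0}) x * (ennreal (1 / s ^ (?d + 1)) * indicator {norm x..} s)"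
    show "(\<integral>\<^sup>+x. F (s *\<^sub>R x) * ennreal (norm x ^ ?d * s ^ (?d - 1)) * indicator {0<..} s * indicator A x \<partial>lborel) = (\<integral>\<^sup>+x. ?H x \<partial>lborel)"
    proof (cases "s > 0")
      case True
      have i: "(indicator {norm x..} s :: ennreal) = indicator (cball 0 s) x" for x :: 'a
        by (simp add: indicator_def)
      have [measurable]: "cball (0::'a) s \<in> sets borel" by simp
      have m: "?H \<in> borel_measurable borel" unfolding i by measurable
      have "(\<integral>\<^sup>+x. ?H x \<partial>lborel) = ennreal (\<bar>s\<bar> ^ ?d) * (\<integral>\<^sup>+x. ?H (0 + s *\<^sub>R x) \<partial>lborel)"
        using True lborel_nn_integral_affine[OF m, of s 0] by simp
      also have "\<dots> = (\<integral>\<^sup>+x. ennreal (\<bar>s\<bar> ^ ?d) * ?H (0 + s *\<^sub>R x) \<partial>lborel)"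
        by (rule nn_integral_cmult[symmetric], unfold i) measurable
      also have "\<dots> = (\<integral>\<^sup>+x. F (s *\<^sub>R x) * ennreal (norm x ^ ?d * s ^ (?d - 1)) * indicator {0<..} s * indicator A x \<partial>lborel)"
      proof (rule nn_integral_cong)
        fix x :: 'a
        have "ennreal (s ^ ?d) * (ennreal ((s * norm x) ^ ?d) * ennreal (1 / s ^ (?d + 1))) = ennreal (norm x ^ ?d * s ^ (?d - 1))"
        proof -
          obtain m where "?d = Suc m" using d1 by blast
          then show ?thesis
            using True by (simp add: ennreal_mult[symmetric] power_mult_distrib field_simps)
        qed
        then show "ennreal (\<bar>s\<bar> ^ ?d) * ?H (0 + s *\<^sub>R x) = F (s *\<^sub>R x) * ennreal (norm x ^ ?d * s ^ (?d - 1)) * indicator {0<..} s * indicator A x"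
          using True by (simp add: indicator_def A_def mult_ac mult_le_cancel_left1)
      qed
      finally show ?thesis by simp
    next
      case False
      then have "\<not> norm x \<le> s" if "x \<noteq> 0" for x :: 'a
        using that by (smt (verit) zero_less_norm_iff)
      \<comment> \<open>For s \<le> 0 only the origin could satisfy |x| \<le> s, and the indicator
        of its complement removes it.\<close>
      then have h0: "?H x = 0" for x by (cases "x = 0") (auto simp: indicator_def)
      show ?thesis unfolding h0 using False by simp
    qed
  qed
  also have "\<dots> = (\<integral>\<^sup>+x. (\<integral>\<^sup>+s. F x * ennreal (norm x ^ ?d) * indicator (- {0}) x * (ennreal (1 / s ^ (?d + 1)) * indicator {norm x..} s) \<partial>lborel) \<partial>lborel)"
    by (rule lborel_pair.Fubini', unfold ind) measurable
  also have "of_nat ?d * \<dots> = (\<integral>\<^sup>+x. of_nat ?d * (\<integral>\<^sup>+s. F x * ennreal (norm x ^ ?d) * indicator (- {0}) x * (ennreal (1 / s ^ (?d + 1)) * indicator {norm x..} s) \<partial>lborel) \<partial>lborel)"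
    by (rule nn_integral_cmult[symmetric], unfold ind) measurable
  also have "\<dots> = (\<integral>\<^sup>+x. F x \<partial>lborel)"
  proof (rule nn_integral_cong_AE)
    have "AE x in lborel. x \<noteq> (0::'a)" by (rule AE_lborel_singleton)
    then show "AE x in lborel. of_nat ?d * (\<integral>\<^sup>+s. F x * ennreal (norm x ^ ?d) * indicator (- {0}) x * (ennreal (1 / s ^ (?d + 1)) * indicator {norm x..} s) \<partial>lborel) = F x"
    proof eventually_elim
      fix x :: 'a assume x: "x \<noteq> 0"
      have "(\<integral>\<^sup>+s. F x * ennreal (norm x ^ ?d) * indicator (- {0}) x * (ennreal (1 / s ^ (?d + 1)) * indicator {norm x..} s) \<partial>lborel)
        = F x * ennreal (norm x ^ ?d) * ennreal (1 / (?d * norm x ^ ?d))"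
        using x nn_integral_tail_power[of "norm x" ?d] by (subst nn_integral_cmult) auto
      moreover have "of_nat ?d * (ennreal (norm x ^ ?d) * ennreal (1 / (?d * norm x ^ ?d))) = 1"
        using x by (simp add: ennreal_mult[symmetric] ennreal_of_nat_eq_real_of_nat)
      ultimately show "of_nat ?d * (\<integral>\<^sup>+s. F x * ennreal (norm x ^ ?d) * indicator (- {0}) x * (ennreal (1 / s ^ (?d + 1)) * indicator {norm x..} s) \<partial>lborel) = F x"
        by (simp only: mult.assoc mult.left_commute[of "of_nat ?d" "F x"] mult_1_right)
    qed
  qed
  finally show ?thesis .
qed

section \<open>Weak limits in square-integrable functions\<close>

definition L2 :: "'b measure \<Rightarrow> ('b \<Rightarrow> complex) set" where
  "L2 M = {F \<in> borel_measurable M. integrable M (\<lambda>x. (norm (F x))\<^sup>2)}"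

definition sq_norm :: "'b measure \<Rightarrow> ('b \<Rightarrow> complex) \<Rightarrow> real" where
  "sq_norm M F = (\<integral>x. (norm (F x))\<^sup>2 \<partial>M)"

lemma parallelogram_complex: "(norm (a - b))\<^sup>2 + 4 * (norm ((a + b) / 2))\<^sup>2 = 2 * (norm a)\<^sup>2 + 2 * (norm (b::complex))\<^sup>2"
proof -
  have "4 * (norm ((a + b) / 2))\<^sup>2 = (norm (a + b))\<^sup>2" by (simp add: norm_divide power_divide)
  then show ?thesis by (simp only: cmod_power2) (simp add: power2_eq_square algebra_simps)
qed

lemma L2_measurable: "F \<in> L2 M \<Longrightarrow> F \<in> borel_measurable M"
  by (simp add: L2_def)

lemma L2_diff:
  assumes "F \<in> L2 M" "G \<in> L2 M" shows "(\<lambda>x. F x - G x) \<in> L2 M"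
proof -
  have [measurable]: "F \<in> borel_measurable M" "G \<in> borel_measurable M" using assms by (auto simp: L2_def)
  have "integrable M (\<lambda>x. (norm (F x - G x))\<^sup>2)"
  proof (rule Bochner_Integration.integrable_bound)
    show "integrable M (\<lambda>x. 2 * (norm (F x))\<^sup>2 + 2 * (norm (G x))\<^sup>2)" using assms by (simp add: L2_def)
    have "(norm (F x - G x))\<^sup>2 \<le> 2 * (norm (F x))\<^sup>2 + 2 * (norm (G x))\<^sup>2" for x
      unfolding parallelogram_complex[of "F x" "G x", symmetric] by simp
    then show "AE x in M. norm ((norm (F x - G x))\<^sup>2) \<le> norm (2 * (norm (F x))\<^sup>2 + 2 * (norm (G x))\<^sup>2)" by simp
  qed measurable
  then show ?thesis using assms by (simp add: L2_def)
qed

lemma L2_cmult: "F \<in> L2 M \<Longrightarrow> (\<lambda>x. c * F x) \<in> L2 M"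
  by (auto simp: L2_def norm_mult power_mult_distrib)

lemma L2_add:
  assumes "F \<in> L2 M" "G \<in> L2 M" shows "(\<lambda>x. F x + G x) \<in> L2 M"
  using L2_diff[OF assms(1) L2_cmult[OF assms(2), of "- 1"]] by simp

lemma L2_midpoint:
  assumes "F \<in> L2 M" "G \<in> L2 M" shows "(\<lambda>x. (F x + G x) / 2) \<in> L2 M"
  using L2_cmult[OF L2_add[OF assms], of "1/2"] by simp

lemma sq_norm_nonneg: "0 \<le> sq_norm M F"
  by (simp add: sq_norm_def)

lemma L2_mult_integrable:
  assumes "F \<in> L2 M" "G \<in> L2 M" shows "integrable M (\<lambda>x. F x * G x)"
proof (rule Bochner_Integration.integrable_bound)
  show "integrable M (\<lambda>x. (norm (F x))\<^sup>2 + (norm (G x))\<^sup>2)" using assms by (simp add: L2_def)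
  show "(\<lambda>x. F x * G x) \<in> borel_measurable M"
    by (intro borel_measurable_times assms L2_measurable)
  have "norm (F x) * norm (G x) \<le> (norm (F x))\<^sup>2 + (norm (G x))\<^sup>2" for x
    using sum_squares_bound[of "norm (F x)" "norm (G x)"]
      mult_nonneg_nonneg[OF norm_ge_zero norm_ge_zero, of "F x" "G x"] by linarith
  then show "AE x in M. norm (F x * G x) \<le> norm ((norm (F x))\<^sup>2 + (norm (G x))\<^sup>2)" by (simp add: norm_mult)
qed

text \<open>The Cauchy-Schwarz inequality with a free weight t in place of square roots; later t is
  \<open>2 ^ j\<close> and \<open>\<epsilon> * sqrt \<epsilon>\<close>.\<close>

lemma norm_integral_mult_le:
  assumes "F \<in> L2 M" "G \<in> L2 M" "t > 0"
  shows "norm (\<integral>x. F x * G x \<partial>M) \<le> (t * sq_norm M F + sq_norm M G / t) / 2"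
proof -
  have "norm (\<integral>x. F x * G x \<partial>M) \<le> (\<integral>x. norm (F x * G x) \<partial>M)" by (rule integral_norm_bound)
  also have "\<dots> \<le> (\<integral>x. (t * (norm (F x))\<^sup>2 + (norm (G x))\<^sup>2 / t) / 2 \<partial>M)"
  proof (rule integral_mono)
    show "integrable M (\<lambda>x. norm (F x * G x))" using L2_mult_integrable[OF assms(1,2)] by (rule integrable_norm)
    show "integrable M (\<lambda>x. (t * (norm (F x))\<^sup>2 + (norm (G x))\<^sup>2 / t) / 2)" using assms by (simp add: L2_def)
    fix x
    have "2 * (t * norm (F x)) * norm (G x) \<le> (t * norm (F x))\<^sup>2 + (norm (G x))\<^sup>2" by (rule sum_squares_bound)
    then show "norm (F x * G x) \<le> (t * (norm (F x))\<^sup>2 + (norm (G x))\<^sup>2 / t) / 2"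
      using assms(3) by (simp add: norm_mult field_simps power2_eq_square)
  qed
  also have "\<dots> = (t * sq_norm M F + sq_norm M G / t) / 2"
    using assms by (simp add: L2_def sq_norm_def)
  finally show ?thesis .
qed

text \<open>In midpoint form, since the minimisation compares two near-minimisers with their
  midpoint.\<close>

lemma sq_norm_parallelogram:
  assumes "F \<in> L2 M" "G \<in> L2 M"
  shows "sq_norm M (\<lambda>x. F x - G x) + 4 * sq_norm M (\<lambda>x. (F x + G x) / 2) = 2 * sq_norm M F + 2 * sq_norm M G"
proof -
  note i = L2_diff[OF assms] L2_midpoint[OF assms] assms
  have "sq_norm M (\<lambda>x. F x - G x) + 4 * sq_norm M (\<lambda>x. (F x + G x) / 2)
     = (\<integral>x. (norm (F x - G x))\<^sup>2 + 4 * (norm ((F x + G x) / 2))\<^sup>2 \<partial>M)"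
    using i unfolding sq_norm_def L2_def by (subst Bochner_Integration.integral_add) (simp_all only: mem_Collect_eq integrable_mult_right integral_mult_right_zero)
  also have "\<dots> = (\<integral>x. 2 * (norm (F x))\<^sup>2 + 2 * (norm (G x))\<^sup>2 \<partial>M)"
    by (simp only: parallelogram_complex)
  also have "\<dots> = 2 * sq_norm M F + 2 * sq_norm M G"
    using assms by (simp add: L2_def sq_norm_def)
  finally show ?thesis .
qed

text \<open>Closure under midpoints is all the convexity that the minimisation argument needs.\<close>

inductive_set midpoint_hull :: "(nat \<Rightarrow> 'b \<Rightarrow> complex) \<Rightarrow> nat \<Rightarrow> ('b \<Rightarrow> complex) set"
  for \<Phi> :: "nat \<Rightarrow> 'b \<Rightarrow> complex" and n :: nat where
  base: "n \<le> k \<Longrightarrow> \<Phi> k \<in> midpoint_hull \<Phi> n"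
| mid: "F \<in> midpoint_hull \<Phi> n \<Longrightarrow> G \<in> midpoint_hull \<Phi> n \<Longrightarrow> (\<lambda>x. (F x + G x) / 2) \<in> midpoint_hull \<Phi> n"

lemma midpoint_hull_mono:
  assumes "F \<in> midpoint_hull \<Phi> m" "n \<le> m" shows "F \<in> midpoint_hull \<Phi> n"
  using assms(1)
proof induction
  case (base k)
  then show ?case using assms(2) by (intro midpoint_hull.base) simp
qed (rule midpoint_hull.mid)

text \<open>Completeness for a fast Cauchy sequence. The decay \<open>(1/16) ^ j\<close> leaves room
  for the weight \<open>4 ^ j\<close>: the weighted sum of squared increments has a finite integral,
  so almost everywhere the increments are at most a constant times \<open>(1/2) ^ j\<close>. Fatou's
  lemma carries the norm bounds to the limit.\<close>

lemma L2_Cauchy_limit: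
  fixes H :: "nat \<Rightarrow> 'b \<Rightarrow> complex"
  assumes H: "\<And>j. H j \<in> L2 M" and cauchy: "\<And>i j. j \<le> i \<Longrightarrow> sq_norm M (\<lambda>x. H j x - H i x) \<le> (1/16) ^ j"
  obtains \<Psi> where "\<Psi> \<in> L2 M" "\<And>j. sq_norm M (\<lambda>x. \<Psi> x - H j x) \<le> (1/16) ^ j"
proof -
  have [measurable]: "H j \<in> borel_measurable M" for j using H by (simp add: L2_def)
  have nn: "(\<integral>\<^sup>+x. ennreal ((norm (H j x - H i x))\<^sup>2) \<partial>M) \<le> ennreal ((1/16) ^ j)" if "j \<le> i" for i j
  proof -
    have "(\<integral>\<^sup>+x. ennreal ((norm (H j x - H i x))\<^sup>2) \<partial>M) = ennreal (sq_norm M (\<lambda>x. H j x - H i x))"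
      unfolding sq_norm_def using L2_diff[OF H[of j] H[of i]] by (intro nn_integral_eq_integral) (auto simp: L2_def)
    then show ?thesis using cauchy[OF that] by (simp add: ennreal_leI)
  qed
  have "(\<integral>\<^sup>+x. (\<Sum>j. ennreal (4 ^ j * (norm (H j x - H (Suc j) x))\<^sup>2)) \<partial>M)
      = (\<Sum>j. ennreal (4 ^ j) * (\<integral>\<^sup>+x. ennreal ((norm (H j x - H (Suc j) x))\<^sup>2) \<partial>M))"
    by (subst nn_integral_suminf) (auto simp: ennreal_mult nn_integral_cmult)
  also have "\<dots> \<le> (\<Sum>j. ennreal ((1/4) ^ j))"
  proof (rule suminf_le)
    fix j
    have "ennreal (4 ^ j) * (\<integral>\<^sup>+x. ennreal ((norm (H j x - H (Suc j) x))\<^sup>2) \<partial>M) \<le> ennreal (4 ^ j) * ennreal ((1/16) ^ j)"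
      by (intro mult_left_mono nn) auto
    also have "\<dots> = ennreal ((1/4) ^ j)"
      by (simp add: ennreal_mult[symmetric] power_mult_distrib[symmetric])
    finally show "ennreal (4 ^ j) * (\<integral>\<^sup>+x. ennreal ((norm (H j x - H (Suc j) x))\<^sup>2) \<partial>M) \<le> ennreal ((1/4) ^ j)" .
  qed auto
  also have "\<dots> < \<infinity>" by (subst suminf_ennreal_eq[OF _ geometric_sums]) auto
  finally have "(\<integral>\<^sup>+x. (\<Sum>j. ennreal (4 ^ j * (norm (H j x - H (Suc j) x))\<^sup>2)) \<partial>M) \<noteq> \<infinity>" by simp
  then have "AE x in M. (\<Sum>j. ennreal (4 ^ j * (norm (H j x - H (Suc j) x))\<^sup>2)) \<noteq> \<infinity>"
    by (intro nn_integral_PInf_AE) auto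
  then have conv: "AE x in M. (\<lambda>j. H j x) \<longlonglongrightarrow> lim (\<lambda>j. H j x)"
  proof eventually_elim
    fix x assume fin: "(\<Sum>j. ennreal (4 ^ j * (norm (H j x - H (Suc j) x))\<^sup>2)) \<noteq> \<infinity>"
    define c where "c = enn2real (\<Sum>j. ennreal (4 ^ j * (norm (H j x - H (Suc j) x))\<^sup>2))"
    have le: "norm (H (Suc j) x - H j x) \<le> sqrt c * (1/2) ^ j" for j
    proof -
      have "ennreal (4 ^ j * (norm (H j x - H (Suc j) x))\<^sup>2) \<le> (\<Sum>j. ennreal (4 ^ j * (norm (H j x - H (Suc j) x))\<^sup>2))"
        using sum_le_suminf[OF summableI, of "{j}"] by simp
      also have "\<dots> = ennreal c" using fin by (simp add: c_def less_top)
      finally have "4 ^ j * (norm (H j x - H (Suc j) x))\<^sup>2 \<le> c" by (simp add: c_def)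
      moreover have "4 ^ j * (norm (H j x - H (Suc j) x))\<^sup>2 = (2 ^ j * norm (H j x - H (Suc j) x))\<^sup>2"
        by (simp add: power_mult_distrib power2_eq_square flip: power_mult_distrib)
      ultimately have "2 ^ j * norm (H j x - H (Suc j) x) \<le> sqrt c" by (simp add: real_le_rsqrt)
      then show ?thesis by (simp add: norm_minus_commute field_simps)
    qed
    have "summable (\<lambda>j. H (Suc j) x - H j x)"
      by (rule summable_comparison_test'[where g="\<lambda>j. sqrt c * (1/2) ^ j" and N=0]) (auto intro!: summable_mult summable_geometric le)
    then have "(\<lambda>n. \<Sum>j<n. H (Suc j) x - H j x) \<longlonglongrightarrow> (\<Sum>j. H (Suc j) x - H j x)"
      by (rule summable_LIMSEQ)
    moreover have "(\<Sum>j<n. H (Suc j) x - H j x) = H n x - H 0 x" for n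
      by (rule sum_lessThan_telescope)
    ultimately have "(\<lambda>n. H n x - H 0 x) \<longlonglongrightarrow> (\<Sum>j. H (Suc j) x - H j x)" by simp
    from tendsto_add[OF this tendsto_const[of "H 0 x"]]
    have "convergent (\<lambda>n. H n x)" by (auto simp: convergent_def)
    then show "(\<lambda>j. H j x) \<longlonglongrightarrow> lim (\<lambda>j. H j x)" by (simp add: convergent_LIMSEQ_iff)
  qed
  define \<Psi> where "\<Psi> x = lim (\<lambda>j. H j x)" for x
  have [measurable]: "\<Psi> \<in> borel_measurable M" unfolding \<Psi>_def[abs_def] by measurable
  have le: "(\<integral>\<^sup>+x. ennreal ((norm (\<Psi> x - H j x))\<^sup>2) \<partial>M) \<le> ennreal ((1/16) ^ j)" for j
  proof -
    have "(\<integral>\<^sup>+x. ennreal ((norm (\<Psi> x - H j x))\<^sup>2) \<partial>M) = (\<integral>\<^sup>+x. liminf (\<lambda>i. ennreal ((norm (H i x - H j x))\<^sup>2)) \<partial>M)"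
    proof (rule nn_integral_cong_AE)
      show "AE x in M. ennreal ((norm (\<Psi> x - H j x))\<^sup>2) = liminf (\<lambda>i. ennreal ((norm (H i x - H j x))\<^sup>2))"
        using conv
      proof eventually_elim
        fix x assume "(\<lambda>i. H i x) \<longlonglongrightarrow> lim (\<lambda>i. H i x)"
        then have "(\<lambda>i. ennreal ((norm (H i x - H j x))\<^sup>2)) \<longlonglongrightarrow> ennreal ((norm (\<Psi> x - H j x))\<^sup>2)"
          unfolding \<Psi>_def by (intro tendsto_intros)
        then show "ennreal ((norm (\<Psi> x - H j x))\<^sup>2) = liminf (\<lambda>i. ennreal ((norm (H i x - H j x))\<^sup>2))"
          by (intro lim_imp_Liminf[symmetric]) auto
      qed
    qed
    also have "\<dots> \<le> liminf (\<lambda>i. \<integral>\<^sup>+x. ennreal ((norm (H i x - H j x))\<^sup>2) \<partial>M)"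
      by (rule nn_integral_liminf) measurable
    also have "\<dots> \<le> ennreal ((1/16) ^ j)"
    proof (rule Liminf_le)
      show "\<forall>\<^sub>F i in sequentially. (\<integral>\<^sup>+x. ennreal ((norm (H i x - H j x))\<^sup>2) \<partial>M) \<le> ennreal ((1/16) ^ j)"
        using eventually_ge_at_top[of j]
      proof eventually_elim
        fix i assume "j \<le> i"
        from nn[OF this] show "(\<integral>\<^sup>+x. ennreal ((norm (H i x - H j x))\<^sup>2) \<partial>M) \<le> ennreal ((1/16) ^ j)"
          by (simp only: norm_minus_commute)
      qed
    qed (rule sequentially_bot)
    finally show ?thesis .
  qed
  have d: "(\<lambda>x. \<Psi> x - H j x) \<in> L2 M" for j
  proof -
    have "integrable M (\<lambda>x. (norm (\<Psi> x - H j x))\<^sup>2)"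
      by (rule integrableI_bounded) (use le_less_trans[OF le[of j]] in auto)
    then show ?thesis by (simp add: L2_def)
  qed
  show ?thesis
  proof (rule that)
    show "\<Psi> \<in> L2 M" using L2_add[OF d[of 0] H[of 0]] by simp
    show "sq_norm M (\<lambda>x. \<Psi> x - H j x) \<le> (1/16) ^ j" for j
    proof -
      have "ennreal (sq_norm M (\<lambda>x. \<Psi> x - H j x)) \<le> ennreal ((1/16) ^ j)"
        using le[of j] nn_integral_eq_integral[of M "\<lambda>x. (norm (\<Psi> x - H j x))\<^sup>2"] d[of j]
        by (simp add: L2_def sq_norm_def)
      then show ?thesis by simp
    qed
  qed
qed

text \<open>The sets \<open>midpoint_hull \<Phi> n\<close> decrease in n, so their infimal squared
  norms increase and, being bounded by B, converge. By the parallelogram identity near-minimisers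
  then form a Cauchy sequence, whose limit is \<open>\<Psi>\<close>. Pairings with v that are close
  to l from n on stay close on the whole n-th hull, hence in the limit.\<close>

lemma L2_weak_limit:
  fixes \<Phi> :: "nat \<Rightarrow> 'b \<Rightarrow> complex"
  assumes \<Phi>: "\<And>n. \<Phi> n \<in> L2 M" and B: "\<And>n. sq_norm M (\<Phi> n) \<le> B"
  obtains \<Psi> where "\<Psi> \<in> L2 M"
    "\<And>v l. v \<in> L2 M \<Longrightarrow> (\<lambda>n. \<integral>x. \<Phi> n x * v x \<partial>M) \<longlonglongrightarrow> l \<Longrightarrow> (\<integral>x. \<Psi> x * v x \<partial>M) = l"
proof -
  have hull: "F \<in> L2 M \<and> sq_norm M F \<le> B" if "F \<in> midpoint_hull \<Phi> n" for F n
    using that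
  proof induction
    case (mid F G)
    then have "4 * sq_norm M (\<lambda>x. (F x + G x) / 2) \<le> 2 * sq_norm M F + 2 * sq_norm M G"
      using sq_norm_parallelogram[of F M G] sq_norm_nonneg[of M "\<lambda>x. F x - G x"] by linarith
    then show ?case using mid by (auto intro: L2_midpoint)
  qed (use \<Phi> B in auto)
  \<comment> \<open>A closed ball around l is convex, so the bound passes from the tail of the
    sequence to its hull.\<close>
  have hull_v: "norm ((\<integral>x. F x * v x \<partial>M) - l) \<le> e"
    if "F \<in> midpoint_hull \<Phi> n" "v \<in> L2 M" "\<And>k. n \<le> k \<Longrightarrow> norm ((\<integral>x. \<Phi> k x * v x \<partial>M) - l) \<le> e" for F n v l e
    using that(1)
  proof induction
    case (mid F G)
    have "(\<integral>x. (F x + G x) / 2 * v x \<partial>M) = ((\<integral>x. F x * v x \<partial>M) + (\<integral>x. G x * v x \<partial>M)) / 2"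
      using L2_mult_integrable[OF hull[OF mid(1), THEN conjunct1] that(2)]
        L2_mult_integrable[OF hull[OF mid(2), THEN conjunct1] that(2)]
      by (simp add: ring_distribs add_divide_distrib)
    then have q1: "(\<integral>x. (F x + G x) / 2 * v x \<partial>M) - l = (((\<integral>x. F x * v x \<partial>M) - l) + ((\<integral>x. G x * v x \<partial>M) - l)) / 2"
      by (simp add: field_simps)
    have q2: "norm (((\<integral>x. F x * v x \<partial>M) - l) + ((\<integral>x. G x * v x \<partial>M) - l)) \<le> e + e"
      using mid by (intro norm_triangle_mono)
    show ?case unfolding q1 norm_divide using q2 by simp
  qed (use that in auto)
  define A where "A n = Inf (sq_norm M ` midpoint_hull \<Phi> n)" for n
  have bdd: "bdd_below (sq_norm M ` S)" for S by (auto intro!: bdd_belowI[of _ 0] sq_norm_nonneg)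
  have ne: "midpoint_hull \<Phi> n \<noteq> {}" for n using midpoint_hull.base[of n n \<Phi>] by auto
  have A_le: "A n \<le> sq_norm M F" if "F \<in> midpoint_hull \<Phi> n" for n F
    unfolding A_def using that bdd by (intro cINF_lower)
  have "incseq A"
    unfolding A_def mono_def
    by (intro allI impI cInf_superset_mono bdd image_mono) (use ne in \<open>auto intro: midpoint_hull_mono\<close>)
  moreover have "A n \<le> B" for n
    using A_le[OF midpoint_hull.base[of n n \<Phi>]] B[of n] by simp
  ultimately have "Cauchy A" using incseq_convergent[of A B] by (metis LIMSEQ_imp_Cauchy)
  have "\<exists>F\<in>midpoint_hull \<Phi> n. sq_norm M F < A n + inverse (real (Suc n))" for n
  proof -
    have "\<exists>y\<in>sq_norm M ` midpoint_hull \<Phi> n. y < A n + inverse (real (Suc n))"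
      using ne[of n] unfolding A_def by (intro cInf_lessD) auto
    then show ?thesis by auto
  qed
  then obtain F where F: "\<And>n. F n \<in> midpoint_hull \<Phi> n" and FA: "\<And>n. sq_norm M (F n) < A n + inverse (real (Suc n))"
    by metis
  have FL: "F n \<in> L2 M" for n using hull[OF F] by blast
  have "\<exists>N. \<forall>n\<ge>N. \<forall>m\<ge>n. sq_norm M (\<lambda>x. F n x - F m x) \<le> e" if "e > 0" for e
  proof -
    \<comment> \<open>The parallelogram identity bounds the squared distance by twice
      \<open>A m - A n\<close> plus twice each of the two excesses over the infima: six errors of
      size e/6.\<close>
    have e6: "e / 6 > 0" using that by simp
    obtain N1 where N1: "\<And>m n. m \<ge> N1 \<Longrightarrow> n \<ge> N1 \<Longrightarrow> dist (A m) (A n) < e / 6"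
      using metric_CauchyD[OF \<open>Cauchy A\<close> e6] by blast
    obtain N2 where N2: "inverse (real (Suc N2)) < e / 6" using reals_Archimedean[OF e6] by auto
    have "sq_norm M (\<lambda>x. F n x - F m x) \<le> e" if "max N1 N2 \<le> n" "n \<le> m" for n m
    proof -
      have "A n \<le> sq_norm M (\<lambda>x. (F n x + F m x) / 2)"
        by (intro A_le midpoint_hull.mid F midpoint_hull_mono[OF F]) (use that in auto)
      moreover have "inverse (real (Suc n)) \<le> inverse (real (Suc N2))" "inverse (real (Suc m)) \<le> inverse (real (Suc N2))"
        using that by (auto simp: field_simps)
      moreover have "dist (A m) (A n) < e / 6" by (rule N1) (use that in auto)
      then have "A m - A n < e / 6" unfolding dist_real_def by linarith
      ultimately show ?thesis
        using sq_norm_parallelogram[OF FL[of n] FL[of m]] FA[of n] FA[of m] N2 by linarith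
    qed
    then show ?thesis by blast
  qed
  from this[of "(1/16) ^ j" for j]
  obtain N where N: "\<And>j n m. N j \<le> n \<Longrightarrow> n \<le> m \<Longrightarrow> sq_norm M (\<lambda>x. F n x - F m x) \<le> (1/16) ^ j"
    by (simp, metis)
  \<comment> \<open>Summing the thresholds makes r monotone and keeps it above both
    \<open>N j\<close> and j.\<close>
  define r where "r j = j + (\<Sum>i\<le>j. N i)" for j
  have r: "N j \<le> r j" "j \<le> r j" for j
    unfolding r_def using member_le_sum[of j "{..j}" N] by auto
  have rm: "r j \<le> r i" if "j \<le> i" for i j
    unfolding r_def using that by (intro add_mono sum_mono2) auto
  obtain \<Psi> where \<Psi>: "\<Psi> \<in> L2 M" "\<And>j. sq_norm M (\<lambda>x. \<Psi> x - F (r j) x) \<le> (1/16) ^ j"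
    using L2_Cauchy_limit[of "\<lambda>j. F (r j)" M] FL N[OF r(1) rm] by metis
  show ?thesis
  proof (rule that[OF \<Psi>(1)])
    fix v l assume v: "v \<in> L2 M" and lim: "(\<lambda>n. \<integral>x. \<Phi> n x * v x \<partial>M) \<longlonglongrightarrow> l"
    have a: "(\<lambda>j. \<integral>x. F (r j) x * v x \<partial>M) \<longlonglongrightarrow> l"
    proof (rule LIMSEQ_I)
      fix e :: real assume "e > 0"
      then obtain n0 where n0: "\<And>k. k \<ge> n0 \<Longrightarrow> norm ((\<integral>x. \<Phi> k x * v x \<partial>M) - l) < e / 2"
        using LIMSEQ_D[OF lim, of "e / 2"] by auto
      have "norm ((\<integral>x. F (r j) x * v x \<partial>M) - l) < e" if "n0 \<le> j" for j
      proof -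
        have "norm ((\<integral>x. F (r j) x * v x \<partial>M) - l) \<le> e / 2"
          by (rule hull_v[OF F v]) (use n0 r(2)[of j] that in \<open>auto intro!: less_imp_le\<close>)
        then show ?thesis using \<open>e > 0\<close> by linarith
      qed
      then show "\<exists>no. \<forall>n\<ge>no. norm ((\<integral>x. F (r n) x * v x \<partial>M) - l) < e" by blast
    qed
    have b: "(\<lambda>j. \<integral>x. F (r j) x * v x \<partial>M) \<longlonglongrightarrow> (\<integral>x. \<Psi> x * v x \<partial>M)"
    proof (rule Lim_null[THEN iffD2], rule Lim_null_comparison)
      show "\<forall>\<^sub>F j in sequentially. norm ((\<integral>x. F (r j) x * v x \<partial>M) - (\<integral>x. \<Psi> x * v x \<partial>M)) \<le> (1 + sq_norm M v) * (1/2) ^ j"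
      proof (rule always_eventually, rule allI)
        fix j
        have "(\<integral>x. \<Psi> x * v x \<partial>M) - (\<integral>x. F (r j) x * v x \<partial>M) = (\<integral>x. (\<Psi> x - F (r j) x) * v x \<partial>M)"
          using L2_mult_integrable[OF \<Psi>(1) v] L2_mult_integrable[OF FL v] by (simp add: left_diff_distrib)
        \<comment> \<open>The weight \<open>2 ^ j\<close> is absorbed by the distance bound
          \<open>(1/16) ^ j\<close>, and it makes the second term tend to 0.\<close>
        also have "norm \<dots> \<le> (2 ^ j * sq_norm M (\<lambda>x. \<Psi> x - F (r j) x) + sq_norm M v / 2 ^ j) / 2"
          by (rule norm_integral_mult_le[OF L2_diff[OF \<Psi>(1) FL] v]) simp
        also have "\<dots> \<le> (2 ^ j * (1/16) ^ j + sq_norm M v / 2 ^ j) / 2"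
          using \<Psi>(2)[of j] by (intro divide_right_mono add_right_mono mult_left_mono) auto
        also have "2 ^ j * (1/16) ^ j \<le> (1/2::real) ^ j"
          by (simp add: power_mult_distrib[symmetric] power_mono)
        also have "((1/2) ^ j + sq_norm M v / 2 ^ j) / 2 \<le> (1 + sq_norm M v) * (1/2) ^ j"
          using sq_norm_nonneg[of M v] by (simp add: field_simps)
        finally show "norm ((\<integral>x. F (r j) x * v x \<partial>M) - (\<integral>x. \<Psi> x * v x \<partial>M)) \<le> (1 + sq_norm M v) * (1/2) ^ j"
          by (simp add: norm_minus_commute)
      qed
      have "(\<lambda>j. (1 + sq_norm M v) * (1/2) ^ j) \<longlonglongrightarrow> (1 + sq_norm M v) * 0"
        by (intro tendsto_intros LIMSEQ_power_zero) simp
      then show "(\<lambda>j. (1 + sq_norm M v) * (1/2) ^ j) \<longlonglongrightarrow> 0" by simp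
    qed
    show "(\<integral>x. \<Psi> x * v x \<partial>M) = l" using LIMSEQ_unique[OF b a] .
  qed
qed

section \<open>Bernstein functions\<close>

text \<open>A quadratic remainder estimate survives integration, so differentiation under the
  integral sign needs no limit theorem. It is used for the Laplace integrals and for the Fourier
  transform.\<close>

lemma has_derivative_quadraticI:
  assumes "bounded_linear D" "\<delta> > 0" "\<And>h. norm h < \<delta> \<Longrightarrow> norm (f (x + h) - f x - D h) \<le> C * (norm h)\<^sup>2"
  shows "(f has_derivative D) (at x)"
  unfolding has_derivative_at
proof (intro conjI assms(1))
  have l: "((\<lambda>h. C * norm (h::'a)) \<longlongrightarrow> 0) (at 0)"
    by (auto intro!: tendsto_eq_intros)
  show "((\<lambda>h. norm (f (x + h) - f x - D h) / norm h) \<longlongrightarrow> 0) (at 0)"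
  proof (rule Lim_null_comparison[OF _ l])
    have "\<forall>\<^sub>F h in at (0::'a). norm h < \<delta> \<and> h \<noteq> 0"
      using assms(2) by (auto simp: eventually_at intro!: exI[of _ \<delta>])
    then show "\<forall>\<^sub>F h in at 0. norm (norm (f (x + h) - f x - D h) / norm h) \<le> C * norm h"
    proof eventually_elim
      fix h :: 'a assume "norm h < \<delta> \<and> h \<noteq> 0"
      then show "norm (norm (f (x + h) - f x - D h) / norm h) \<le> C * norm h"
        using assms(3)[of h] by (simp add: field_simps power2_eq_square)
    qed
  qed
qed

lemma exp_remainder_le: "\<bar>exp y - 1 - y\<bar> \<le> y\<^sup>2 * exp \<bar>y\<bar>" for y :: real
proof -
  have ge: "0 \<le> exp y - 1 - y" using exp_ge_add_one_self[of y] by linarith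
  have "1 - y \<le> exp (- y)" using exp_ge_add_one_self[of "- y"] by simp
  then have "exp y * (1 - y) \<le> exp y * exp (- y)" by (intro mult_left_mono) auto
  then have 1: "exp y - 1 \<le> y * exp y" by (simp add: exp_minus algebra_simps)
  then have 2: "exp y - 1 - y \<le> y * (exp y - 1)" by (simp add: algebra_simps)
  also have "\<dots> \<le> y\<^sup>2 * exp \<bar>y\<bar>"
  proof (cases "y \<ge> 0")
    case True
    then have "y * (exp y - 1) \<le> y * (y * exp y)" using 1 by (intro mult_left_mono) auto
    then show ?thesis using True by (simp add: power2_eq_square)
  next
    case False
    have "y * (exp y - 1) \<le> y * y" using ge False by (intro mult_left_mono_neg) auto
    also have "\<dots> \<le> (y * y) * exp \<bar>y\<bar>" using mult_left_mono[of 1 "exp \<bar>y\<bar>" "y * y"] by simp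
    finally show ?thesis by (simp add: power2_eq_square)
  qed
  finally show ?thesis using ge by simp
qed

locale bernstein_rep =
  fixes f a b \<mu> assumes triple: "bernstein_triple f a b \<mu>"
begin

lemma sets_eq: "sets \<mu> = sets (restrict_space borel {0<..})"
  using triple by (simp add: bernstein_triple_def)

lemma space_eq: "space \<mu> = {0<..}"
  using sets_eq_imp_space_eq[OF sets_eq] by (simp add: space_restrict_space)

lemma borel_\<mu>: "g \<in> borel_measurable borel \<Longrightarrow> g \<in> borel_measurable \<mu>"
  using measurable_cong_sets[OF sets_eq refl] measurable_restrict_space1 by blast

lemma f_eq: "x > 0 \<Longrightarrow> f x = a + b * x + (\<integral>t. 1 - exp (- x * t) \<partial>\<mu>)"
  using triple by (simp add: bernstein_triple_def)

lemma min_integrable: "integrable \<mu> (\<lambda>t. min 1 t)"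
proof (rule integrableI_bounded)
  show "min 1 \<in> borel_measurable \<mu>" by (intro borel_\<mu>) measurable
  have "(\<integral>\<^sup>+t. ennreal (norm (min 1 t)) \<partial>\<mu>) = (\<integral>\<^sup>+t. ennreal (min 1 t) \<partial>\<mu>)"
    by (intro nn_integral_cong) (auto simp: space_eq)
  then show "(\<integral>\<^sup>+t. ennreal (norm (min 1 t)) \<partial>\<mu>) < \<infinity>" using triple by (simp add: bernstein_triple_def)
qed

text \<open>The measure is only known to integrate min 1 t and may have infinite mass near 0, where
  a factor t is therefore needed. For t > 1 the exponential absorbs \<open>t ^ k\<close> through
  \<open>(1 + x * t / k) ^ k \<le> exp (x * t)\<close>.\<close>

lemma integrable_power_exp:
  assumes x: "x > 0" and k: "k \<ge> 1"
  shows "integrable \<mu> (\<lambda>t. t ^ k * exp (- x * t))"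
proof (rule Bochner_Integration.integrable_bound)
  let ?C = "1 + (real k / x) ^ k"
  show "integrable \<mu> (\<lambda>t. ?C * min 1 t)" using min_integrable by (rule integrable_mult_right)
  show "(\<lambda>t. t ^ k * exp (- x * t)) \<in> borel_measurable \<mu>" by (intro borel_\<mu>) measurable
  have "t ^ k * exp (- x * t) \<le> ?C * min 1 t" if "t > 0" for t
  proof (cases "t \<le> 1")
    case True
    have "t ^ k \<le> t" using True that k power_decreasing[of 1 k t] by simp
    moreover have "exp (- x * t) \<le> 1" using x that by simp
    ultimately have "t ^ k * exp (- x * t) \<le> t * 1" using that by (intro mult_mono) auto
    also have "\<dots> \<le> ?C * min 1 t" using True that x by (simp add: ring_distribs)
    finally show ?thesis .
  next
    case False
    have "(x * t / k) ^ k \<le> (1 + x * t / k) ^ k" using x that by (intro power_mono) auto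
    also have "\<dots> \<le> exp (x * t)"
      using mult_pos_pos[OF x that] k by (intro exp_ge_one_plus_x_over_n_power_n) linarith+
    finally have "t ^ k \<le> (real k / x) ^ k * exp (x * t)"
      using x k by (simp add: power_divide power_mult_distrib field_simps)
    then have "t ^ k * exp (- x * t) \<le> (real k / x) ^ k * exp (x * t) * exp (- x * t)" by (intro mult_right_mono) auto
    also have "\<dots> = (real k / x) ^ k" by (simp add: exp_minus)
    finally show ?thesis using False by simp
  qed
  then show "AE t in \<mu>. norm (t ^ k * exp (- x * t)) \<le> norm (?C * min 1 t)"
    using x by (intro AE_I2) (auto simp: space_eq abs_mult)
qed

lemma integrable_one_minus_exp:
  assumes x: "x > 0" shows "integrable \<mu> (\<lambda>t. 1 - exp (- x * t))"
proof (rule Bochner_Integration.integrable_bound)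
  show "integrable \<mu> (\<lambda>t. (1 + x) * min 1 t)" using min_integrable by (rule integrable_mult_right)
  show "(\<lambda>t. 1 - exp (- x * t)) \<in> borel_measurable \<mu>" by (intro borel_\<mu>) measurable
  have "\<bar>1 - exp (- x * t)\<bar> \<le> \<bar>(1 + x) * min 1 t\<bar>" if "t > 0" for t
  proof -
    have "1 - exp (- x * t) \<le> 1" "1 - exp (- x * t) \<le> x * t" using exp_ge_add_one_self[of "- x * t"] by auto
    moreover have "0 \<le> 1 - exp (- x * t)" using x that by simp
    moreover have "1 \<le> (1 + x) * min 1 t \<or> x * t \<le> (1 + x) * min 1 t" using x that by (auto simp: min_def algebra_simps)
    ultimately show ?thesis by linarith
  qed
  then show "AE t in \<mu>. norm (1 - exp (- x * t)) \<le> norm ((1 + x) * min 1 t)"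
    by (intro AE_I2) (auto simp: space_eq)
qed

text \<open>The condition |h| < x/2 lets half of the decay rate absorb the factor exp |h t| from
  \<open>exp_remainder_le\<close>.\<close>

lemma laplace_remainder:
  fixes x h t :: real
  assumes x: "x > 0" and h: "\<bar>h\<bar> < x / 2" and t: "t > 0"
  shows "\<bar>exp (- (x + h) * t) - exp (- x * t) + h * t * exp (- x * t)\<bar> \<le> h\<^sup>2 * (t\<^sup>2 * exp (- (x / 2) * t))"
proof -
  have "exp (- (x + h) * t) - exp (- x * t) + h * t * exp (- x * t) = exp (- x * t) * (exp (- h * t) - 1 - (- h * t))"
  proof -
    have "- (x + h) * t = - x * t + - h * t" by (simp add: algebra_simps)
    then have "exp (- (x + h) * t) = exp (- x * t) * exp (- h * t)" by (simp only: exp_add)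
    then show ?thesis by (simp add: algebra_simps)
  qed
  also have "\<bar>\<dots>\<bar> \<le> exp (- x * t) * ((- h * t)\<^sup>2 * exp \<bar>- h * t\<bar>)"
    by (subst abs_mult, subst abs_exp_cancel, intro mult_left_mono exp_remainder_le) simp
  also have "\<dots> \<le> exp (- x * t) * ((- h * t)\<^sup>2 * exp (x / 2 * t))"
    using h t by (intro mult_left_mono) (auto simp: abs_mult)
  also have "exp (- x * t) * ((- h * t)\<^sup>2 * exp (x / 2 * t)) = (h\<^sup>2 * t\<^sup>2) * (exp (- x * t) * exp (x / 2 * t))"
    by (simp add: power_mult_distrib)
  also have "exp (- x * t) * exp (x / 2 * t) = exp (- (x / 2) * t)"
    by (simp flip: exp_add)
  finally show ?thesis by simp
qed

text \<open>The function c covers two cases: c = 1 with k = 0 for the Bernstein integral, whose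
  exponential alone need not be integrable, and c = 0 for all higher derivatives.\<close>

lemma laplace_derivative:
  assumes x: "x > 0"
    and L: "\<And>y. y > 0 \<Longrightarrow> integrable \<mu> (\<lambda>t. c t - t ^ k * exp (- y * t))"
  shows "((\<lambda>y. \<integral>t. c t - t ^ k * exp (- y * t) \<partial>\<mu>) has_real_derivative (\<integral>t. t ^ Suc k * exp (- x * t) \<partial>\<mu>)) (at x)"
  unfolding has_field_derivative_def
proof (rule has_derivative_quadraticI[where \<delta>="x / 2" and C="\<integral>t. t ^ Suc (Suc k) * exp (- (x / 2) * t) \<partial>\<mu>"])
  show "bounded_linear ((*) (\<integral>t. t ^ Suc k * exp (- x * t) \<partial>\<mu>))" by (rule bounded_linear_mult_right)
  show "x / 2 > 0" using x by simp
  fix h :: real assume h: "norm h < x / 2"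
  then have xh: "x + h > 0" by auto
  note i1 = L[OF xh] and i2 = L[OF x]
  have i3: "integrable \<mu> (\<lambda>t. (t ^ Suc k * exp (- x * t)) * h)"
    by (intro integrable_mult_left integrable_power_exp[OF x]) simp
  note i12 = Bochner_Integration.integrable_diff[OF i1 i2]
  have e1: "(\<integral>t. c t - t ^ k * exp (- (x + h) * t) \<partial>\<mu>) - (\<integral>t. c t - t ^ k * exp (- x * t) \<partial>\<mu>) - (\<integral>t. t ^ Suc k * exp (- x * t) \<partial>\<mu>) * h
     = (\<integral>t. (c t - t ^ k * exp (- (x + h) * t)) - (c t - t ^ k * exp (- x * t)) - (t ^ Suc k * exp (- x * t)) * h \<partial>\<mu>)"
    by (simp only: Bochner_Integration.integral_diff[OF i12 i3] Bochner_Integration.integral_diff[OF i1 i2] integral_mult_left_zero)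
  have e2: "norm (\<integral>t. (c t - t ^ k * exp (- (x + h) * t)) - (c t - t ^ k * exp (- x * t)) - (t ^ Suc k * exp (- x * t)) * h \<partial>\<mu>)
      \<le> (\<integral>t. (t ^ Suc (Suc k) * exp (- (x / 2) * t)) * (norm h)\<^sup>2 \<partial>\<mu>)"
  proof (rule order_trans[OF integral_norm_bound integral_mono])
    show "integrable \<mu> (\<lambda>t. (t ^ Suc (Suc k) * exp (- (x / 2) * t)) * (norm h)\<^sup>2)"
      using x by (intro integrable_mult_left integrable_power_exp) auto
    show "integrable \<mu> (\<lambda>t. norm ((c t - t ^ k * exp (- (x + h) * t)) - (c t - t ^ k * exp (- x * t)) - (t ^ Suc k * exp (- x * t)) * h))"
      by (rule integrable_norm[OF Bochner_Integration.integrable_diff[OF i12 i3]])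
    fix t assume "t \<in> space \<mu>"
    then have t: "t > 0" by (simp add: space_eq)
    have e: "(c t - t ^ k * exp (- (x + h) * t)) - (c t - t ^ k * exp (- x * t)) - (t ^ Suc k * exp (- x * t)) * h
      = - (t ^ k * (exp (- (x + h) * t) - exp (- x * t) + h * t * exp (- x * t)))"
      by (simp add: algebra_simps)
    show "norm ((c t - t ^ k * exp (- (x + h) * t)) - (c t - t ^ k * exp (- x * t)) - (t ^ Suc k * exp (- x * t)) * h)
      \<le> (t ^ Suc (Suc k) * exp (- (x / 2) * t)) * (norm h)\<^sup>2"
    proof -
      define E R where "E = exp (- (x / 2) * t)" and "R = exp (- (x + h) * t) - exp (- x * t) + h * t * exp (- x * t)"
      have R: "\<bar>R\<bar> \<le> h\<^sup>2 * (t\<^sup>2 * E)"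
        unfolding E_def R_def using h by (intro laplace_remainder[OF x _ t]) simp
      have "norm ((c t - t ^ k * exp (- (x + h) * t)) - (c t - t ^ k * exp (- x * t)) - (t ^ Suc k * exp (- x * t)) * h) = norm (- (t ^ k * R))"
        by (rule arg_cong[where f=norm]) (simp only: e R_def)
      also have "\<dots> = t ^ k * \<bar>R\<bar>" using t by (simp add: abs_mult)
      also have "\<dots> \<le> t ^ k * (h\<^sup>2 * (t\<^sup>2 * E))" by (rule mult_left_mono[OF R]) (use t in simp)
      also have "\<dots> = (t ^ Suc (Suc k) * E) * (norm h)\<^sup>2"
        by (simp only: power_Suc power2_eq_square real_norm_def abs_mult_self_eq mult_ac)
      finally show ?thesis unfolding E_def .
    qed
  qed
  have e3: "(\<integral>t. (t ^ Suc (Suc k) * exp (- (x / 2) * t)) * (norm h)\<^sup>2 \<partial>\<mu>) = (\<integral>t. t ^ Suc (Suc k) * exp (- (x / 2) * t) \<partial>\<mu>) * (norm h)\<^sup>2"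
    by (rule integral_mult_left_zero)
  show "norm ((\<integral>t. c t - t ^ k * exp (- (x + h) * t) \<partial>\<mu>) - (\<integral>t. c t - t ^ k * exp (- x * t) \<partial>\<mu>) - (\<integral>t. t ^ Suc k * exp (- x * t) \<partial>\<mu>) * h)
    \<le> (\<integral>t. t ^ Suc (Suc k) * exp (- (x / 2) * t) \<partial>\<mu>) * (norm h)\<^sup>2"
    unfolding e1 using e2 unfolding e3 .
qed

text \<open>The family to which \<open>smooth_on_radial\<close> is applied. The constant c holds the
  drift b of the first derivative, and d the alternating signs.\<close>

definition derivs :: "(real \<Rightarrow> real) set" where
  "derivs = insert f {\<lambda>x. c + d * (\<integral>t. t ^ k * exp (- x * t) \<partial>\<mu>) | c d k. k \<ge> 1}"

lemma derivs_laplace: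
  assumes "k \<ge> 1" shows "(\<lambda>x. c + d * (\<integral>t. t ^ k * exp (- x * t) \<partial>\<mu>)) \<in> derivs"
  unfolding derivs_def by (rule insertI2, rule CollectI, rule exI[of _ c], rule exI[of _ d], rule exI[of _ k]) (use assms in simp)

lemma derivs_closed:
  assumes "F \<in> derivs" shows "\<exists>G\<in>derivs. \<forall>x\<in>{0<..}. (F has_real_derivative G x) (at x)"
proof -
  have "F = f \<or> (\<exists>c d k. F = (\<lambda>x. c + d * (\<integral>t. t ^ k * exp (- x * t) \<partial>\<mu>)) \<and> k \<ge> 1)"
    using assms unfolding derivs_def insert_iff mem_Collect_eq .
  then show ?thesis
  proof (elim disjE exE conjE)
    assume 1: "F = f"
    let ?G = "\<lambda>x. b + 1 * (\<integral>t. t ^ 1 * exp (- x * t) \<partial>\<mu>)"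
    have "(F has_real_derivative ?G x) (at x)" if "x > 0" for x
    proof -
      have "((\<lambda>y. \<integral>t. 1 - t ^ 0 * exp (- y * t) \<partial>\<mu>) has_real_derivative (\<integral>t. t ^ Suc 0 * exp (- x * t) \<partial>\<mu>)) (at x)"
        using integrable_one_minus_exp by (intro laplace_derivative[OF that]) simp
      then have "((\<lambda>y. a + b * y + (\<integral>t. 1 - exp (- y * t) \<partial>\<mu>)) has_real_derivative ?G x) (at x)"
        by (auto intro!: derivative_eq_intros)
      then show ?thesis
        by (rule has_field_derivative_transform_within_open[where S="{0<..}"]) (use that f_eq 1 in auto)
    qed
    moreover have "?G \<in> derivs" by (rule derivs_laplace) simp
    ultimately show ?thesis by (intro bexI[of _ ?G] ballI) (simp_all only: greaterThan_iff)
  next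
    fix c d k assume 2: "F = (\<lambda>x. c + d * (\<integral>t. t ^ k * exp (- x * t) \<partial>\<mu>))" "k \<ge> 1"
    let ?G = "\<lambda>x. 0 + (- d) * (\<integral>t. t ^ Suc k * exp (- x * t) \<partial>\<mu>)"
    have "(F has_real_derivative ?G x) (at x)" if "x > 0" for x
    proof -
      have "((\<lambda>y. \<integral>t. 0 - t ^ k * exp (- y * t) \<partial>\<mu>) has_real_derivative (\<integral>t. t ^ Suc k * exp (- x * t) \<partial>\<mu>)) (at x)"
        using integrable_power_exp[OF _ 2(2)] by (intro laplace_derivative[OF that]) simp
      then have "((\<lambda>y. - (\<integral>t. 0 - t ^ k * exp (- y * t) \<partial>\<mu>)) has_real_derivative - (\<integral>t. t ^ Suc k * exp (- x * t) \<partial>\<mu>)) (at x)"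
        by (rule DERIV_minus)
      then show ?thesis unfolding 2(1) by (auto intro!: derivative_eq_intros)
    qed
    moreover have "?G \<in> derivs" by (rule derivs_laplace) simp
    ultimately show ?thesis by (intro bexI[of _ ?G] ballI) (simp_all only: greaterThan_iff)
  qed
qed

text \<open>The difference f y - f x is the drift part plus the integral of a positive function. If
  it is not positive, then b = 0 and \<mu> is null, which makes f constant.\<close>

lemma strictly_increasing:
  assumes nc: "\<not> f constant_on {0<..}" and xy: "0 < x" "x < y"
  shows "f x < f y"
proof (rule ccontr)
  assume le: "\<not> f x < f y"
  let ?g = "\<lambda>t. exp (- x * t) - exp (- y * t)"
  have g: "?g t > 0" if "t > 0" for t using xy that by simp
  have b: "b \<ge> 0" using triple by (simp add: bernstein_triple_def)
  have i: "integrable \<mu> (\<lambda>t. 1 - exp (- x * t))" "integrable \<mu> (\<lambda>t. 1 - exp (- y * t))"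
    using integrable_one_minus_exp xy by auto
  have gi: "integrable \<mu> ?g" using Bochner_Integration.integrable_diff[OF i(2,1)] by simp
  have "(\<integral>t. ?g t \<partial>\<mu>) = (\<integral>t. 1 - exp (- y * t) \<partial>\<mu>) - (\<integral>t. 1 - exp (- x * t) \<partial>\<mu>)"
    using Bochner_Integration.integral_diff[OF i(2,1)] by simp
  then have fe: "f y - f x = b * (y - x) + (\<integral>t. ?g t \<partial>\<mu>)"
    using f_eq[of x] f_eq[of y] xy by (simp add: algebra_simps)
  have g0: "AE t in \<mu>. 0 \<le> ?g t" using g by (intro AE_I2) (auto simp: space_eq less_imp_le)
  have "(\<integral>t. ?g t \<partial>\<mu>) \<ge> 0" using g0 by (rule integral_nonneg_AE)
  moreover have "b * (y - x) \<ge> 0" using b xy by simp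
  ultimately have 1: "(\<integral>t. ?g t \<partial>\<mu>) = 0" and 2: "b * (y - x) = 0" using fe le by linarith+
  then have "b = 0" using xy by simp
  from 1 have "AE t in \<mu>. ?g t = 0" using integral_nonneg_eq_0_iff_AE[OF gi g0] by simp
  moreover have "AE t in \<mu>. t > 0" using AE_space by (auto simp: space_eq)
  ultimately have ae: "AE t in \<mu>. False"
    by eventually_elim (use g in fastforce)
  have "f z = a" if "z > 0" for z
  proof -
    have "(\<integral>t. 1 - exp (- z * t) \<partial>\<mu>) = (\<integral>t. 0 \<partial>\<mu>)"
    proof (rule integral_cong_AE)
      show "AE t in \<mu>. 1 - exp (- z * t) = 0" using ae by eventually_elim simp
    qed (auto intro!: borel_\<mu>)
    then show ?thesis using f_eq[OF that] \<open>b = 0\<close> by simp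
  qed
  then have "f constant_on {0<..}" unfolding constant_on_def by auto
  with nc show False ..
qed

end

section \<open>Test functions and Schwartz functions\<close>

lemma smooth_continuous: "smooth \<phi> \<Longrightarrow> continuous_on UNIV \<phi>"
  using smooth_on_differentiable differentiable_imp_continuous_within
  by (fastforce simp: smooth_iff_smooth_on continuous_on_eq_continuous_within)

lemma test_functions_iff:
  "\<phi> \<in> test_functions \<longleftrightarrow> smooth \<phi> \<and> (\<exists>R. \<forall>x. norm x > R \<longrightarrow> \<phi> x = 0)"
proof -
  have "compact (closure {x. \<phi> x \<noteq> 0}) \<longleftrightarrow> (\<exists>R. \<forall>x. norm x > R \<longrightarrow> \<phi> x = 0)"
    unfolding compact_closure bounded_iff by (auto simp: not_le[symmetric])
  then show ?thesis by (simp add: test_functions_def)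
qed

lemma test_functions_smooth: "\<phi> \<in> test_functions \<Longrightarrow> smooth \<phi>"
  by (simp add: test_functions_iff)

lemma smooth_differentiable: "smooth \<phi> \<Longrightarrow> \<phi> differentiable (at x)"
  using smooth_on_differentiable[of UNIV \<phi> x] by (simp add: smooth_iff_smooth_on)

lemma smooth_partial: "smooth \<phi> \<Longrightarrow> b \<in> Basis \<Longrightarrow> smooth (partials [b] \<phi>)"
  unfolding smooth_iff_smooth_on by (rule smooth_on_partial)

lemma smooth_mult: "smooth \<phi> \<Longrightarrow> smooth \<psi> \<Longrightarrow> smooth (\<lambda>x. \<phi> x * \<psi> x)"
  unfolding smooth_iff_smooth_on by (rule smooth_on_mult[OF open_UNIV])

lemma smooth_cmult: "smooth \<phi> \<Longrightarrow> smooth (\<lambda>x. c * \<phi> x)"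
  unfolding smooth_iff_smooth_on by (rule smooth_on_cmult[OF open_UNIV])

lemma smooth_add: "smooth \<phi> \<Longrightarrow> smooth \<psi> \<Longrightarrow> smooth (\<lambda>x. \<phi> x + \<psi> x)"
  unfolding smooth_iff_smooth_on by (rule smooth_on_add[OF open_UNIV])

lemma partials_eq_0:
  assumes "open S" "\<And>x. x \<in> S \<Longrightarrow> \<phi> x = 0" "x \<in> S"
  shows "partials bs \<phi> x = 0"
  using partials_cong_open[OF assms(1) _ assms(3), of \<phi> "\<lambda>x. 0"] assms(2) partials_zero[of bs] by metis

lemma test_functions_partial:
  assumes "\<phi> \<in> test_functions" "b \<in> Basis" shows "partials [b] \<phi> \<in> test_functions"
proof -
  obtain R where R: "\<And>x. norm x > R \<Longrightarrow> \<phi> x = 0" using assms(1) by (auto simp: test_functions_iff)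
  have "open {x::'a. norm x > R}" by (intro open_Collect_less continuous_intros)
  then have "\<forall>x. norm x > R \<longrightarrow> partials [b] \<phi> x = 0"
    using partials_eq_0[of "{x::'a. norm x > R}" \<phi>] R by blast
  with assms show ?thesis unfolding test_functions_iff by (auto intro: smooth_partial simp del: partials.simps)
qed

lemma test_functions_mult: "smooth \<eta> \<Longrightarrow> \<phi> \<in> test_functions \<Longrightarrow> (\<lambda>x. \<eta> x * \<phi> x) \<in> test_functions"
  unfolding test_functions_iff by (auto intro: smooth_mult)

lemma test_functions_cmult: "\<phi> \<in> test_functions \<Longrightarrow> (\<lambda>x. c * \<phi> x) \<in> test_functions"
  unfolding test_functions_iff by (auto intro: smooth_cmult)

lemma test_functions_affine:
  assumes "\<phi> \<in> test_functions" "a \<noteq> 0" shows "(\<lambda>x. \<phi> (a *\<^sub>R x + c)) \<in> test_functions"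
proof -
  obtain R where R: "\<And>x. norm x > R \<Longrightarrow> \<phi> x = 0" using assms(1) by (auto simp: test_functions_iff)
  have "\<phi> (a *\<^sub>R x + c) = 0" if "norm x > (R + norm c) / \<bar>a\<bar>" for x
  proof (rule R)
    have "R + norm c < norm (a *\<^sub>R x)" using that assms(2) by (simp add: field_simps)
    then show "R < norm (a *\<^sub>R x + c)" using norm_diff_ineq[of "a *\<^sub>R x" c] by linarith
  qed
  then show ?thesis using assms smooth_affine(1) by (auto simp: test_functions_iff)
qed

lemma test_functions_continuous: "\<phi> \<in> test_functions \<Longrightarrow> continuous_on UNIV \<phi>"
  by (simp add: smooth_continuous test_functions_smooth)

lemma test_functions_integrable: "\<phi> \<in> test_functions \<Longrightarrow> integrable lborel \<phi>"
proof -
  assume \<phi>: "\<phi> \<in> test_functions"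
  then obtain R where R: "\<And>x. norm x > R \<Longrightarrow> \<phi> x = 0" by (auto simp: test_functions_iff)
  have "set_integrable lborel (cball 0 R) \<phi>"
    unfolding set_integrable_def using test_functions_continuous[OF \<phi>] by (intro borel_integrable_compact) (auto intro: continuous_on_subset)
  moreover have "(\<lambda>x. indicator (cball 0 R) x *\<^sub>R \<phi> x) = \<phi>"
    using R by (auto simp: indicator_def fun_eq_iff not_le)
  ultimately show ?thesis by (simp add: set_integrable_def)
qed

lemma test_functions_bounded:
  assumes "\<phi> \<in> test_functions" obtains B where "B \<ge> 0" "\<And>x. norm (\<phi> x) \<le> B"
proof -
  obtain R where R: "\<And>x. norm x > R \<Longrightarrow> \<phi> x = 0" using assms by (auto simp: test_functions_iff)
  have "compact (\<phi> ` cball 0 R)"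
    using test_functions_continuous[OF assms] by (intro compact_continuous_image) (auto intro: continuous_on_subset)
  then obtain B where B: "\<And>x. x \<in> cball 0 R \<Longrightarrow> norm (\<phi> x) \<le> B"
    by (metis bounded_iff compact_imp_bounded imageI)
  show ?thesis
  proof (rule that[of "max B 0"])
    show "norm (\<phi> x) \<le> max B 0" for x using R[of x] B[of x] by (cases "norm x \<le> R") auto
  qed simp
qed

section \<open>Lipschitz bounds and integration by parts\<close>

lemma smooth_lipschitz:
  fixes \<phi> :: "'a::euclidean_space \<Rightarrow> complex"
  assumes sm: "smooth \<phi>" and bounded: "\<And>b. b \<in> Basis \<Longrightarrow> \<exists>B. \<forall>x. norm (partials [b] \<phi> x) \<le> B"
  obtains L where "L \<ge> 0" "\<And>x y. norm (\<phi> x - \<phi> y) \<le> L * norm (x - y)"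
proof -
  obtain B where B: "\<And>b x. b \<in> Basis \<Longrightarrow> norm (partials [b] \<phi> x) \<le> B b" using bounded by metis
  have "norm (\<phi> x - \<phi> y) \<le> (\<Sum>b\<in>Basis. B b) * norm (x - y)" for x y
  proof (rule differentiable_bound[of UNIV \<phi> "\<lambda>x. frechet_derivative \<phi> (at x)"])
    fix x :: 'a
    have d: "\<phi> differentiable (at x)" by (rule smooth_differentiable[OF sm])
    then show "(\<phi> has_derivative frechet_derivative \<phi> (at x)) (at x within UNIV)"
      by (simp add: frechet_derivative_works)
    have "onorm (frechet_derivative \<phi> (at x)) \<le> (\<Sum>b\<in>Basis. norm (frechet_derivative \<phi> (at x) b))"
      using d by (intro onorm_componentwise) (simp add: linear_frechet_derivative linear_conv_bounded_linear[symmetric])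
    also have "\<dots> \<le> (\<Sum>b\<in>Basis. B b)" using B by (intro sum_mono) simp
    finally show "onorm (frechet_derivative \<phi> (at x)) \<le> (\<Sum>b\<in>Basis. B b)" .
  qed auto
  moreover have "0 \<le> (\<Sum>b\<in>Basis. B b)" by (intro sum_nonneg order_trans[OF norm_ge_zero B])
  ultimately show ?thesis by (rule that[rotated])
qed

lemma test_functions_lipschitz:
  fixes \<phi> :: "'a::euclidean_space \<Rightarrow> complex"
  assumes "\<phi> \<in> test_functions" obtains L where "L \<ge> 0" "\<And>x y. norm (\<phi> x - \<phi> y) \<le> L * norm (x - y)"
proof (rule smooth_lipschitz[OF test_functions_smooth[OF assms]])
  show "\<exists>B. \<forall>x. norm (partials [b] \<phi> x) \<le> B" if "b \<in> Basis" for b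
    using test_functions_bounded[OF test_functions_partial[OF assms that]] by metis
qed (rule that)

text \<open>By translation invariance the difference quotients have integral 0. The Lipschitz
  constant dominates them on a ball enlarged by the largest step 1, so the value passes to the limit
  without iterated integrals or boundary terms.\<close>

lemma integral_partial_eq_0:
  fixes \<phi> :: "'a::euclidean_space \<Rightarrow> complex"
  assumes \<phi>: "\<phi> \<in> test_functions" and b: "b \<in> Basis"
  shows "(\<integral>x. partials [b] \<phi> x \<partial>lborel) = 0"
proof -
  obtain L where L: "L \<ge> 0" "\<And>x y. norm (\<phi> x - \<phi> y) \<le> L * norm (x - y)"
    using test_functions_lipschitz[OF \<phi>] by metis
  obtain R where R: "\<And>x. norm x > R \<Longrightarrow> \<phi> x = 0" using \<phi> by (auto simp: test_functions_iff)
  define t where "t n = inverse (real (Suc n))" for n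
  have t0: "t n > 0" "t n \<le> 1" for n by (auto simp: t_def field_simps)
  have tl: "t \<longlonglongrightarrow> 0" using LIMSEQ_inverse_real_of_nat by (simp add: t_def[abs_def] del: of_nat_Suc)
  define q where "q n x = (\<phi> (x + t n *\<^sub>R b) - \<phi> x) /\<^sub>R t n" for n x
  note i = test_functions_integrable[OF \<phi>]
  have i': "integrable lborel (\<lambda>x. \<phi> (x + c))" and i'': "(\<integral>x. \<phi> (x + c) \<partial>lborel) = (\<integral>x. \<phi> x \<partial>lborel)" for c
    using lborel_integrable_affine[OF i, of 1 c] lborel_integral_affine[OF i, of 1 c] by (auto simp: add.commute)
  have q0: "(\<integral>x. q n x \<partial>lborel) = 0" for n
    unfolding q_def using i i'[of "t n *\<^sub>R b"] i''[of "t n *\<^sub>R b"] by simp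
  have "(\<lambda>n. \<integral>x. q n x \<partial>lborel) \<longlonglongrightarrow> (\<integral>x. partials [b] \<phi> x \<partial>lborel)"
  proof (rule integral_dominated_convergence[where w="\<lambda>x. L * indicator (cball 0 (R + 1)) x"])
    show "partials [b] \<phi> \<in> borel_measurable lborel"
      using test_functions_integrable[OF test_functions_partial[OF \<phi> b]] by simp
    show "q n \<in> borel_measurable lborel" for n
      unfolding q_def[abs_def] using i i' by (auto intro!: borel_measurable_integrable)
    show "integrable lborel (\<lambda>x::'a. L * indicator (cball 0 (R + 1)) x)"
      using emeasure_bounded_finite[of "cball 0 (R + 1) :: 'a set"] by simp
    show "AE x in lborel. (\<lambda>n. q n x) \<longlonglongrightarrow> partials [b] \<phi> x"
    proof (rule AE_I2)
      fix x
      let ?D = "frechet_derivative \<phi> (at x)"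
      have "(\<phi> has_derivative ?D) (at x)"
        using smooth_differentiable[OF test_functions_smooth[OF \<phi>]] by (simp add: frechet_derivative_works)
      then have D: "((\<lambda>h. norm (\<phi> (x + h) - \<phi> x - ?D h) / norm h) \<longlongrightarrow> 0) (at 0)" and lin: "linear ?D"
        by (simp_all add: has_derivative_at bounded_linear.linear)
      have "(\<lambda>n. t n *\<^sub>R b) \<longlonglongrightarrow> 0 *\<^sub>R b" by (intro tendsto_intros tl)
      then have "filterlim (\<lambda>n. t n *\<^sub>R b) (at 0) sequentially"
        using t0(1) b by (auto simp: filterlim_at less_imp_neq[symmetric] nonzero_Basis)
      from filterlim_compose[OF D this]
      have "(\<lambda>n. norm (\<phi> (x + t n *\<^sub>R b) - \<phi> x - ?D (t n *\<^sub>R b)) / norm (t n *\<^sub>R b)) \<longlonglongrightarrow> 0" .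
      moreover have "norm (\<phi> (x + t n *\<^sub>R b) - \<phi> x - ?D (t n *\<^sub>R b)) / norm (t n *\<^sub>R b) = norm (q n x - partials [b] \<phi> x)" for n
      proof -
        have e: "q n x - partials [b] \<phi> x = (\<phi> (x + t n *\<^sub>R b) - \<phi> x - ?D (t n *\<^sub>R b)) /\<^sub>R t n"
          using t0(1)[of n] by (simp add: q_def linear_scale[OF lin] scaleR_diff_right)
        show ?thesis unfolding e norm_scaleR using t0(1)[of n] b by (simp add: divide_inverse mult.commute)
      qed
      ultimately have "(\<lambda>n. norm (q n x - partials [b] \<phi> x)) \<longlonglongrightarrow> 0" by (simp only:)
      then show "(\<lambda>n. q n x) \<longlonglongrightarrow> partials [b] \<phi> x"
        using Lim_null tendsto_norm_zero_iff by blast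
    qed
    show "AE x in lborel. norm (q n x) \<le> L * indicator (cball 0 (R + 1)) x" for n
    proof (rule AE_I2)
      fix x
      show "norm (q n x) \<le> L * indicator (cball 0 (R + 1)) x"
      proof (cases "norm x \<le> R + 1")
        case True
        have "norm (\<phi> (x + t n *\<^sub>R b) - \<phi> x) \<le> L * t n"
          using L(2)[of "x + t n *\<^sub>R b" x] t0[of n] b by simp
        moreover have "norm (q n x) = norm (\<phi> (x + t n *\<^sub>R b) - \<phi> x) / t n"
          using t0[of n] unfolding q_def norm_scaleR by (simp add: divide_inverse mult.commute)
        ultimately show ?thesis using True t0[of n] by (simp add: pos_divide_le_eq)
      next
        case False
        have "norm (t n *\<^sub>R b) \<le> 1" using t0[of n] b by simp
        then have "norm (x + t n *\<^sub>R b) > R" using False norm_diff_ineq[of x "t n *\<^sub>R b"] by linarith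
        then show ?thesis using False R by (simp add: q_def)
      qed
    qed
  qed
  then show ?thesis unfolding q0 using LIMSEQ_unique tendsto_const by blast
qed

section \<open>The Fourier transform of test functions\<close>

lemma partial_exp_inner:
  "partials [b] (\<lambda>x. exp (\<i> * of_real (x \<bullet> \<xi>))) x = \<i> * of_real (b \<bullet> \<xi>) * exp (\<i> * of_real (x \<bullet> \<xi>))"
proof -
  have "((\<lambda>x. \<i> * complex_of_real (x \<bullet> \<xi>)) has_derivative (\<lambda>h. \<i> * of_real (h \<bullet> \<xi>))) (at x)"
    by (auto intro!: derivative_eq_intros)
  from has_derivative_compose[OF this DERIV_exp[unfolded has_field_derivative_def]]
  show ?thesis by (subst partial_eqI) (auto simp: mult.commute)
qed

lemma fourier_integrand_integrable:
  "integrable lborel \<phi> \<Longrightarrow> integrable lborel (\<lambda>x. \<phi> x * exp (- \<i> * of_real (x \<bullet> \<xi>)))"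
  by (rule Bochner_Integration.integrable_bound[where f=\<phi>]) (auto simp: norm_mult)

text \<open>The product of \<phi> with the exponential is again a test function;
  \<open>integral_partial_eq_0\<close> for this product, expanded by the product rule, is the
  claim.\<close>

lemma fourier_partial:
  assumes \<phi>: "\<phi> \<in> test_functions" and b: "b \<in> Basis"
  shows "fourier (partials [b] \<phi>) \<xi> = \<i> * of_real (\<xi> \<bullet> b) * fourier \<phi> \<xi>"
proof -
  define e where "e x = exp (\<i> * of_real (x \<bullet> - \<xi>))" for x :: 'a
  have e: "smooth e" unfolding smooth_iff_smooth_on e_def[abs_def] by (rule smooth_on_exp_inner)
  have e': "exp (- \<i> * of_real (x \<bullet> \<xi>)) = e x" for x by (simp add: e_def)
  have "partials [b] (\<lambda>x. e x * \<phi> x) x = e x * partials [b] \<phi> x + (- \<i> * of_real (\<xi> \<bullet> b)) * (\<phi> x * e x)" for x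
    using smooth_differentiable[OF e] smooth_differentiable[OF test_functions_smooth[OF \<phi>]]
      partial_exp_inner[of b "- \<xi>" x]
    by (subst partial_mult) (simp_all add: e_def[abs_def] inner_commute)
  moreover have "(\<integral>x. partials [b] (\<lambda>x. e x * \<phi> x) x \<partial>lborel) = 0"
    by (rule integral_partial_eq_0[OF test_functions_mult[OF e \<phi>] b])
  ultimately have "0 = (\<integral>x. e x * partials [b] \<phi> x + (- \<i> * of_real (\<xi> \<bullet> b)) * (\<phi> x * e x) \<partial>lborel)" by simp
  also have "\<dots> = (\<integral>x. partials [b] \<phi> x * e x \<partial>lborel) + (- \<i> * of_real (\<xi> \<bullet> b)) * (\<integral>x. \<phi> x * e x \<partial>lborel)"
    using fourier_integrand_integrable[OF test_functions_integrable[OF test_functions_partial[OF \<phi> b]], of \<xi>]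
      fourier_integrand_integrable[OF test_functions_integrable[OF \<phi>], of \<xi>] unfolding e'
    by (subst Bochner_Integration.integral_add) (simp_all add: mult.commute del: partials.simps)
  finally show ?thesis unfolding fourier_def e' by (simp add: algebra_simps del: partials.simps)
qed

lemma smooth_inner: "smooth (\<lambda>x. of_real (x \<bullet> b))"
  unfolding smooth_iff_smooth_on by (rule smooth_on_inner)

text \<open>The exponential differs from its linear part by at most |x|^2 |h|^2, which is integrable
  against \<phi>. The radius \<open>\<delta>=1\<close> is arbitrary, since the estimate holds for
  every h.\<close>

lemma fourier_has_derivative:
  fixes \<phi> :: "'a::euclidean_space \<Rightarrow> complex"
  assumes \<phi>: "\<phi> \<in> test_functions"
  shows "(fourier \<phi> has_derivative (\<lambda>h. fourier (\<lambda>x. (- \<i> * of_real (x \<bullet> h)) * \<phi> x) \<xi>)) (at \<xi>)"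
proof (rule has_derivative_quadraticI[where \<delta>=1 and C="\<integral>x. norm (of_real (x \<bullet> x) * \<phi> x) \<partial>lborel"])
  have test: "(\<lambda>x. (- \<i> * of_real (x \<bullet> h)) * \<phi> x) \<in> test_functions" for h
    by (intro test_functions_mult \<phi> smooth_cmult smooth_inner)
  note i = fourier_integrand_integrable[OF test_functions_integrable[OF test]]
  note i0 = fourier_integrand_integrable[OF test_functions_integrable[OF \<phi>]]
  have "linear (\<lambda>h. fourier (\<lambda>x. (- \<i> * of_real (x \<bullet> h)) * \<phi> x) \<xi>)"
  proof (rule linearI)
    fix h k :: 'a and r :: real
    have "(- \<i> * of_real (x \<bullet> (h + k))) * \<phi> x * exp (- \<i> * of_real (x \<bullet> \<xi>))
       = (- \<i> * of_real (x \<bullet> h)) * \<phi> x * exp (- \<i> * of_real (x \<bullet> \<xi>)) + (- \<i> * of_real (x \<bullet> k)) * \<phi> x * exp (- \<i> * of_real (x \<bullet> \<xi>))" for x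
      by (simp add: inner_add_right ring_distribs)
    then show "fourier (\<lambda>x. (- \<i> * of_real (x \<bullet> (h + k))) * \<phi> x) \<xi> =
        fourier (\<lambda>x. (- \<i> * of_real (x \<bullet> h)) * \<phi> x) \<xi> + fourier (\<lambda>x. (- \<i> * of_real (x \<bullet> k)) * \<phi> x) \<xi>"
      unfolding fourier_def using i[of h \<xi>] i[of k \<xi>] by (simp only: Bochner_Integration.integral_add)
    have "(- \<i> * of_real (x \<bullet> (r *\<^sub>R h))) * \<phi> x * exp (- \<i> * of_real (x \<bullet> \<xi>))
       = r *\<^sub>R ((- \<i> * of_real (x \<bullet> h)) * \<phi> x * exp (- \<i> * of_real (x \<bullet> \<xi>)))" for x
      by (simp add: scaleR_conv_of_real)
    then show "fourier (\<lambda>x. (- \<i> * of_real (x \<bullet> (r *\<^sub>R h))) * \<phi> x) \<xi> = r *\<^sub>R fourier (\<lambda>x. (- \<i> * of_real (x \<bullet> h)) * \<phi> x) \<xi>"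
      unfolding fourier_def by (simp only: integral_scaleR_right)
  qed
  then show "bounded_linear (\<lambda>h. fourier (\<lambda>x. (- \<i> * of_real (x \<bullet> h)) * \<phi> x) \<xi>)"
    by (simp add: linear_conv_bounded_linear)
  fix h :: 'a
  have pt: "norm (\<phi> x * exp (- \<i> * of_real (x \<bullet> (\<xi> + h))) - \<phi> x * exp (- \<i> * of_real (x \<bullet> \<xi>))
      - (- \<i> * of_real (x \<bullet> h)) * \<phi> x * exp (- \<i> * of_real (x \<bullet> \<xi>))) \<le> norm (of_real (x \<bullet> x) * \<phi> x) * (norm h)\<^sup>2" for x
  proof -
    have p1: "\<phi> x * exp (- \<i> * of_real (x \<bullet> (\<xi> + h))) - \<phi> x * exp (- \<i> * of_real (x \<bullet> \<xi>))
      - (- \<i> * of_real (x \<bullet> h)) * \<phi> x * exp (- \<i> * of_real (x \<bullet> \<xi>))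
      = \<phi> x * exp (- \<i> * of_real (x \<bullet> \<xi>)) * (exp (\<i> * of_real (- (x \<bullet> h))) - (1 + \<i> * of_real (- (x \<bullet> h))))"
      by (simp add: inner_add_right ring_distribs exp_add exp_diff) (simp add: exp_minus divide_inverse)
    have p2: "norm (exp (\<i> * of_real (- (x \<bullet> h))) - (1 + \<i> * of_real (- (x \<bullet> h)))) \<le> (x \<bullet> h)\<^sup>2"
    proof -
      have "2 * norm (exp (\<i> * of_real (- (x \<bullet> h))) - (1 + \<i> * of_real (- (x \<bullet> h)))) \<le> (x \<bullet> h)\<^sup>2"
        using iexp_approx1[of "- (x \<bullet> h)" 1] by (simp add: power2_eq_square)
      then show ?thesis using zero_le_power2[of "x \<bullet> h"] by linarith
    qed
    have p3: "(x \<bullet> h)\<^sup>2 \<le> (x \<bullet> x) * (norm h)\<^sup>2"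
      using Cauchy_Schwarz_ineq[of x h] by (simp add: power2_norm_eq_inner)
    show ?thesis unfolding p1
      using mult_left_mono[OF order_trans[OF p2 p3] norm_ge_zero[of "\<phi> x"]] by (simp add: norm_mult mult_ac)
  qed
  have e1: "fourier \<phi> (\<xi> + h) - fourier \<phi> \<xi> - fourier (\<lambda>x. (- \<i> * of_real (x \<bullet> h)) * \<phi> x) \<xi>
     = (\<integral>x. \<phi> x * exp (- \<i> * of_real (x \<bullet> (\<xi> + h))) - \<phi> x * exp (- \<i> * of_real (x \<bullet> \<xi>))
      - (- \<i> * of_real (x \<bullet> h)) * \<phi> x * exp (- \<i> * of_real (x \<bullet> \<xi>)) \<partial>lborel)"
    unfolding fourier_def using i i0 by (simp only: Bochner_Integration.integral_diff Bochner_Integration.integrable_diff)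
  have e2: "norm (\<integral>x. \<phi> x * exp (- \<i> * of_real (x \<bullet> (\<xi> + h))) - \<phi> x * exp (- \<i> * of_real (x \<bullet> \<xi>))
      - (- \<i> * of_real (x \<bullet> h)) * \<phi> x * exp (- \<i> * of_real (x \<bullet> \<xi>)) \<partial>lborel)
      \<le> (\<integral>x. norm (of_real (x \<bullet> x) * \<phi> x) * (norm h)\<^sup>2 \<partial>lborel)"
  proof (rule order_trans[OF integral_norm_bound integral_mono])
    show "integrable lborel (\<lambda>x. norm (of_real (x \<bullet> x) * \<phi> x) * (norm h)\<^sup>2)"
    proof (intro integrable_mult_left integrable_norm test_functions_integrable test_functions_mult \<phi>)
      have "smooth_on UNIV (\<lambda>x. complex_of_real ((\<lambda>t. t) ((norm (x::'a))\<^sup>2)))"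
        by (rule smooth_on_radial[where T=UNIV and \<F>="{\<lambda>t. t, \<lambda>t. 1, \<lambda>t. 0}"]) (auto intro!: derivative_eq_intros)
      then show "smooth (\<lambda>x::'a. complex_of_real (x \<bullet> x))" by (simp add: smooth_iff_smooth_on power2_norm_eq_inner)
    qed
    show "integrable lborel (\<lambda>x. norm (\<phi> x * exp (- \<i> * of_real (x \<bullet> (\<xi> + h))) - \<phi> x * exp (- \<i> * of_real (x \<bullet> \<xi>))
      - (- \<i> * of_real (x \<bullet> h)) * \<phi> x * exp (- \<i> * of_real (x \<bullet> \<xi>))))"
      using i i0 by (intro integrable_norm Bochner_Integration.integrable_diff)
  qed (rule pt)
  have e3: "(\<integral>x. norm (of_real (x \<bullet> x) * \<phi> x) * (norm h)\<^sup>2 \<partial>lborel) = (\<integral>x. norm (of_real (x \<bullet> x) * \<phi> x) \<partial>lborel) * (norm h)\<^sup>2"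
    by (rule integral_mult_left_zero)
  show "norm (fourier \<phi> (\<xi> + h) - fourier \<phi> \<xi> - fourier (\<lambda>x. (- \<i> * of_real (x \<bullet> h)) * \<phi> x) \<xi>)
     \<le> (\<integral>x. norm (of_real (x \<bullet> x) * \<phi> x) \<partial>lborel) * (norm h)\<^sup>2"
    unfolding e1 using e2 unfolding e3 .
qed simp

lemma partial_fourier:
  assumes "\<phi> \<in> test_functions"
  shows "partials [b] (fourier \<phi>) = fourier (\<lambda>x. (- \<i> * of_real (x \<bullet> b)) * \<phi> x)"
  using partial_eqI[OF fourier_has_derivative[OF assms]] by (intro ext)

lemma smooth_fourier:
  assumes "\<phi> \<in> test_functions" shows "smooth (fourier \<phi>)"
proof -
  have "Ck UNIV n (fourier \<phi>)" for n
    using assms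
  proof (induction n arbitrary: \<phi>)
    case (Suc n)
    have "(\<lambda>x. (- \<i> * of_real (x \<bullet> b)) * \<phi> x) \<in> test_functions" for b
      by (intro test_functions_mult Suc.prems smooth_cmult smooth_inner)
    moreover have "fourier \<phi> differentiable (at x)" for x
      using fourier_has_derivative[OF Suc.prems] by (rule differentiableI)
    ultimately show ?case using Suc.IH partial_fourier[OF Suc.prems] by (simp del: partials.simps)
  qed simp
  then show ?thesis by (simp add: smooth_iff_smooth_on smooth_on_def)
qed

text \<open>Reduces the Schwartz bounds for all derivatives of a transform to the decay of
  transforms of test functions.\<close>

lemma partials_fourier:
  assumes "\<phi> \<in> test_functions" "bs \<in> lists Basis"
  shows "\<exists>\<psi>\<in>test_functions. partials bs (fourier \<phi>) = fourier \<psi>"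
  using assms(2)
proof (induction bs)
  case (Cons b bs)
  then obtain \<psi> where \<psi>: "\<psi> \<in> test_functions" "partials bs (fourier \<phi>) = fourier \<psi>" by auto
  have "partials (b # bs) (fourier \<phi>) = partials [b] (fourier \<psi>)" using \<psi> by simp
  also have "\<dots> = fourier (\<lambda>x. (- \<i> * of_real (x \<bullet> b)) * \<psi> x)" by (rule partial_fourier[OF \<psi>(1)])
  finally show ?case
    by (intro bexI[of _ "\<lambda>x. (- \<i> * of_real (x \<bullet> b)) * \<psi> x"] test_functions_mult \<psi> smooth_cmult smooth_inner)
qed (use assms in auto)

lemma norm_fourier_le: "norm (fourier \<phi> \<xi>) \<le> (\<integral>x. norm (\<phi> x) \<partial>lborel)"
  unfolding fourier_def by (rule order_trans[OF integral_norm_bound]) (simp add: norm_mult)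

text \<open>One more factor 1 + |\<xi>| is at most 1 plus the sum of the |\<xi> \<bullet> b|, and
  \<open>fourier_partial\<close> trades each |\<xi> \<bullet> b| for a derivative of \<phi>.\<close>

lemma fourier_decay:
  fixes \<phi> :: "'a::euclidean_space \<Rightarrow> complex"
  assumes "\<phi> \<in> test_functions"
  shows "\<exists>C. \<forall>\<xi>. (1 + norm \<xi>) ^ k * norm (fourier \<phi> \<xi>) \<le> C"
  using assms
proof (induction k arbitrary: \<phi>)
  case 0
  then show ?case using norm_fourier_le by auto
next
  case (Suc k)
  obtain C where C: "\<And>\<xi>. (1 + norm \<xi>) ^ k * norm (fourier \<phi> \<xi>) \<le> C" using Suc by metis
  have "\<forall>b\<in>Basis. \<exists>C. \<forall>\<xi>. (1 + norm \<xi>) ^ k * norm (fourier (partials [b] \<phi>) \<xi>) \<le> C"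
    using Suc test_functions_partial by metis
  then obtain D where D: "\<And>b \<xi>. b \<in> Basis \<Longrightarrow> (1 + norm \<xi>) ^ k * norm (fourier (partials [b] \<phi>) \<xi>) \<le> D b" by metis
  have "(1 + norm \<xi>) ^ Suc k * norm (fourier \<phi> \<xi>) \<le> C + (\<Sum>b\<in>Basis. D b)" for \<xi> :: 'a
  proof -
    let ?X = "(1 + norm \<xi>) ^ k * norm (fourier \<phi> \<xi>)"
    have "(1 + norm \<xi>) ^ Suc k * norm (fourier \<phi> \<xi>) = ?X + norm \<xi> * ?X" by (simp add: algebra_simps)
    also have "norm \<xi> * ?X \<le> (\<Sum>b\<in>Basis. \<bar>\<xi> \<bullet> b\<bar>) * ?X" by (intro mult_right_mono norm_le_l1) auto
    also have "\<dots> = (\<Sum>b\<in>Basis. (1 + norm \<xi>) ^ k * norm (fourier (partials [b] \<phi>) \<xi>))"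
      unfolding sum_distrib_right
      by (intro sum.cong refl) (simp add: fourier_partial[OF Suc.prems] norm_mult del: partials.simps)
    also have "\<dots> \<le> (\<Sum>b\<in>Basis. D b)" by (intro sum_mono D)
    finally show ?thesis using C[of \<xi>] by simp
  qed
  then show ?case by blast
qed

lemma fourier_schwartz:
  assumes "\<phi> \<in> test_functions" shows "fourier \<phi> \<in> schwartz"
proof -
  have "bdd_above (range (\<lambda>x. (1 + norm x) ^ k * norm (partials bs (fourier \<phi>) x)))" if "bs \<in> lists Basis" for k bs
    using partials_fourier[OF assms that] fourier_decay[of _ k] unfolding bdd_above_def by fastforce
  then show ?thesis using smooth_fourier[OF assms] by (simp add: schwartz_def)
qed

section \<open>Dyadic sums and integrability at infinity\<close>

lemma dyadic_pointwise:
  assumes e: "0 < \<epsilon>"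
  shows "ennreal (1 / (1 + \<epsilon> * norm x) ^ Suc p) \<le> (\<Sum>j. ennreal (2 ^ Suc p / (2 ^ j) ^ Suc p) * indicator (ball 0 (2 ^ j / \<epsilon>)) x)"
proof -
  have "\<exists>j. \<epsilon> * norm x < 2 ^ j" using real_arch_pow[of 2] by simp
  then obtain j where j: "\<epsilon> * norm x < 2 ^ j" and min: "\<And>i. i < j \<Longrightarrow> \<not> \<epsilon> * norm x < 2 ^ i"
    using exists_least_iff[of "\<lambda>j. \<epsilon> * norm x < 2 ^ j"] by blast
  \<comment> \<open>By minimality of j, either j = 0 or
    \<open>2 ^ (j - 1) \<le> \<epsilon> * norm x\<close>.\<close>
  have "2 ^ j \<le> 2 * (1 + \<epsilon> * norm x)"
  proof (cases j)
    case (Suc i)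
    then show ?thesis using min[of i] by simp
  qed (use e in simp)
  then have "(2 ^ j) ^ Suc p \<le> (2 * (1 + \<epsilon> * norm x)) ^ Suc p" by (intro power_mono) auto
  then have le: "(2 ^ j) ^ Suc p \<le> 2 ^ Suc p * (1 + \<epsilon> * norm x) ^ Suc p" by (simp only: power_mult_distrib)
  have pos: "0 < (1 + \<epsilon> * norm x) ^ Suc p" using e by (intro zero_less_power) (simp add: add_pos_nonneg)
  have "1 / (1 + \<epsilon> * norm x) ^ Suc p \<le> 2 ^ Suc p / (2 ^ j) ^ Suc p"
    using le pos by (simp only: divide_le_eq le_divide_eq) (simp add: field_simps del: power_Suc)
  define f where "f j = ennreal (2 ^ Suc p / (2 ^ j) ^ Suc p) * indicator (ball 0 (2 ^ j / \<epsilon>)) x" for j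
  have "ennreal (1 / (1 + \<epsilon> * norm x) ^ Suc p) \<le> f j"
    using j e \<open>1 / _ \<le> _\<close> by (simp add: f_def indicator_def field_simps ennreal_leI del: power_Suc)
  also have "\<dots> \<le> suminf f"
    using sum_le_suminf[OF summableI, of "{j}" f] by simp
  also have "\<dots> = (\<Sum>j. ennreal (2 ^ Suc p / (2 ^ j) ^ Suc p) * indicator (ball 0 (2 ^ j / \<epsilon>)) x)"
    by (simp only: f_def[abs_def])
  finally show ?thesis .
qed

text \<open>Growth like \<open>R ^ p\<close> on balls against a weight of order p + 1 leaves the
  series of \<open>(1/2) ^ j\<close>. It is used with p = 1 for a function in the class
  \<open>B_star\<close> and with p = \<open>DIM('a)\<close> for Lebesgue measure.\<close>

lemma dyadic_bound:
  fixes F :: "'a::euclidean_space \<Rightarrow> ennreal"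
  assumes [measurable]: "F \<in> borel_measurable borel" and e: "0 < \<epsilon>" "\<epsilon> < 1" and C: "C \<ge> 0"
    and F: "\<And>R. R > 1 \<Longrightarrow> (\<integral>\<^sup>+x\<in>ball 0 R. F x \<partial>lborel) \<le> ennreal (C * R ^ p)"
  shows "(\<integral>\<^sup>+x. F x * ennreal (1 / (1 + \<epsilon> * norm x) ^ Suc p) \<partial>lborel) \<le> ennreal (C * 2 ^ (p + 2) / \<epsilon> ^ p)"
proof -
  let ?c = "\<lambda>j. ennreal (2 ^ Suc p / (2 ^ j) ^ Suc p)"
  have "(\<integral>\<^sup>+x. F x * ennreal (1 / (1 + \<epsilon> * norm x) ^ Suc p) \<partial>lborel)
    \<le> (\<integral>\<^sup>+x. (\<Sum>j. ?c j * (F x * indicator (ball 0 (2 ^ j / \<epsilon>)) x)) \<partial>lborel)"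
  proof (rule nn_integral_mono)
    fix x :: 'a
    have "F x * ennreal (1 / (1 + \<epsilon> * norm x) ^ Suc p) \<le> F x * (\<Sum>j. ?c j * indicator (ball 0 (2 ^ j / \<epsilon>)) x)"
      by (intro mult_left_mono dyadic_pointwise e) simp
    also have "\<dots> = (\<Sum>j. ?c j * (F x * indicator (ball 0 (2 ^ j / \<epsilon>)) x))"
      unfolding ennreal_suminf_cmult[symmetric] by (simp only: mult.left_commute)
    finally show "F x * ennreal (1 / (1 + \<epsilon> * norm x) ^ Suc p) \<le> (\<Sum>j. ?c j * (F x * indicator (ball 0 (2 ^ j / \<epsilon>)) x))" .
  qed
  also have "\<dots> = (\<Sum>j. ?c j * (\<integral>\<^sup>+x\<in>ball 0 (2 ^ j / \<epsilon>). F x \<partial>lborel))"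
  proof -
    have [measurable]: "ball (0::'a) r \<in> sets borel" for r by simp
    have "(\<integral>\<^sup>+x. (\<Sum>j. ?c j * (F x * indicator (ball 0 (2 ^ j / \<epsilon>)) x)) \<partial>lborel)
        = (\<Sum>j. \<integral>\<^sup>+x. ?c j * (F x * indicator (ball 0 (2 ^ j / \<epsilon>)) x) \<partial>lborel)"
      by (rule nn_integral_suminf) measurable
    also have "\<dots> = (\<Sum>j. ?c j * (\<integral>\<^sup>+x\<in>ball 0 (2 ^ j / \<epsilon>). F x \<partial>lborel))"
      by (intro suminf_cong nn_integral_cmult) measurable
    finally show ?thesis .
  qed
  also have "\<dots> \<le> (\<Sum>j. ennreal (2 ^ Suc p * C / \<epsilon> ^ p * (1/2) ^ j))"
  proof (rule suminf_le)
    fix j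
    \<comment> \<open>The growth hypothesis covers only radii above 1; \<open>\<epsilon> < 1\<close>
      brings even the smallest radius \<open>1 / \<epsilon>\<close> into its range.\<close>
    have "1 * \<epsilon> < 2 ^ j" using e one_le_power[of "2::real" j] by linarith
    then have "1 < 2 ^ j / \<epsilon>" using e by (simp add: field_simps)
    then have "?c j * (\<integral>\<^sup>+x\<in>ball 0 (2 ^ j / \<epsilon>). F x \<partial>lborel) \<le> ?c j * ennreal (C * (2 ^ j / \<epsilon>) ^ p)"
      by (intro mult_left_mono F) auto
    also have "\<dots> = ennreal (2 ^ Suc p / (2 ^ j) ^ Suc p * (C * (2 ^ j / \<epsilon>) ^ p))"
      using C e by (subst ennreal_mult) auto
    also have "2 ^ Suc p / (2 ^ j) ^ Suc p * (C * (2 ^ j / \<epsilon>) ^ p) = 2 ^ Suc p * C / \<epsilon> ^ p * (1/2) ^ j"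
      using e by (simp add: power_divide field_simps)
    finally show "?c j * (\<integral>\<^sup>+x\<in>ball 0 (2 ^ j / \<epsilon>). F x \<partial>lborel) \<le> ennreal (2 ^ Suc p * C / \<epsilon> ^ p * (1/2) ^ j)" .
  qed auto
  also have "\<dots> = ennreal (2 ^ Suc p * C / \<epsilon> ^ p * 2)"
  proof (rule suminf_ennreal_eq)
    have "(\<lambda>j. (1/2::real) ^ j) sums 2" using geometric_sums[of "1/2::real"] by simp
    then show "(\<lambda>j. 2 ^ Suc p * C / \<epsilon> ^ p * (1/2) ^ j) sums (2 ^ Suc p * C / \<epsilon> ^ p * 2)" by (rule sums_mult)
  qed (use C e in auto)
  finally show ?thesis by (simp add: mult_ac)
qed

lemma integrable_inverse_power:
  "integrable lborel (\<lambda>x::'a::euclidean_space. 1 / (1 + norm x) ^ Suc DIM('a))"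
proof (rule Bochner_Integration.integrable_bound)
  \<comment> \<open>The factor 1/2 meets the requirement \<open>\<epsilon> < 1\<close> of
    \<open>dyadic_bound\<close>.\<close>
  show "integrable lborel (\<lambda>x::'a. 1 / (1 + 1/2 * norm x) ^ Suc DIM('a))"
  proof (rule integrableI_bounded)
    have "(\<integral>\<^sup>+x. 1 * ennreal (1 / (1 + 1/2 * norm (x::'a)) ^ Suc DIM('a)) \<partial>lborel) \<le> ennreal (unit_ball_vol DIM('a) * 2 ^ (DIM('a) + 2) / (1/2) ^ DIM('a))"
    proof (rule dyadic_bound)
      fix R :: real assume "R > 1"
      then have "emeasure lborel (ball (0::'a) R) = ennreal (unit_ball_vol DIM('a) * R ^ DIM('a))" by (intro emeasure_ball) simp
      then show "(\<integral>\<^sup>+x\<in>ball (0::'a) R. 1 \<partial>lborel) \<le> ennreal (unit_ball_vol DIM('a) * R ^ DIM('a))" by simp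
    qed auto
    moreover have "norm (1 / (1 + 1/2 * norm (x::'a)) ^ Suc DIM('a)) = 1 / (1 + 1/2 * norm x) ^ Suc DIM('a)" for x
      unfolding real_norm_def by (intro abs_of_nonneg divide_nonneg_nonneg zero_le_power add_nonneg_nonneg) auto
    ultimately show "(\<integral>\<^sup>+x. ennreal (norm (1 / (1 + 1/2 * norm (x::'a)) ^ Suc DIM('a))) \<partial>lborel) < \<infinity>"
      by (simp only: mult_1) (rule le_less_trans, auto)
  qed measurable
  show "AE x in lborel. norm (1 / (1 + norm (x::'a)) ^ Suc DIM('a)) \<le> norm (1 / (1 + 1/2 * norm x) ^ Suc DIM('a))"
  proof (rule AE_I2)
    fix x :: 'a
    have "(1 + 1/2 * norm x) ^ Suc DIM('a) \<le> (1 + norm x) ^ Suc DIM('a)" by (intro power_mono) auto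
    moreover have "0 < (1 + 1/2 * norm x) ^ Suc DIM('a)" by (intro zero_less_power add_pos_nonneg) auto
    ultimately have "1 / (1 + norm x) ^ Suc DIM('a) \<le> 1 / (1 + 1/2 * norm x) ^ Suc DIM('a)" by (intro divide_left_mono mult_pos_pos) auto
    moreover have "0 \<le> 1 / (1 + norm x) ^ Suc DIM('a)" by (intro divide_nonneg_nonneg zero_le_power) auto
    ultimately show "norm (1 / (1 + norm x) ^ Suc DIM('a)) \<le> norm (1 / (1 + 1/2 * norm x) ^ Suc DIM('a))"
      unfolding real_norm_def by linarith
  qed
qed measurable

section \<open>The Schwartz space\<close>

lemma schwartz_bound:
  assumes "\<phi> \<in> schwartz" "bs \<in> lists Basis"
  obtains C where "C \<ge> 0" "\<And>x. (1 + norm x) ^ k * norm (partials bs \<phi> x) \<le> C"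
proof -
  obtain C where C: "\<And>x. (1 + norm x) ^ k * norm (partials bs \<phi> x) \<le> C"
    using assms by (force simp: schwartz_def bdd_above_def)
  moreover have "0 \<le> C" using C[of 0] by (rule order_trans[rotated]) simp
  ultimately show ?thesis by (rule that[rotated])
qed

lemma schwartzI:
  assumes "smooth \<phi>"
    and "\<And>k bs. bs \<in> lists Basis \<Longrightarrow> bdd_above (range (\<lambda>x. (1 + norm x) ^ k * norm (partials bs \<phi> x)))"
  shows "\<phi> \<in> schwartz"
  using assms by (simp add: schwartz_def)

lemma schwartz_smooth: "\<phi> \<in> schwartz \<Longrightarrow> smooth \<phi>"
  by (simp add: schwartz_def)

lemma schwartz_integrable:
  fixes \<phi> :: "'a::euclidean_space \<Rightarrow> complex"
  assumes "\<phi> \<in> schwartz" shows "integrable lborel \<phi>"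
proof -
  obtain C where C: "\<And>x. (1 + norm x) ^ Suc DIM('a) * norm (\<phi> x) \<le> C"
    using schwartz_bound[OF assms, of "[]" "Suc DIM('a)"] by auto
  show ?thesis
  proof (rule Bochner_Integration.integrable_bound)
    show "integrable lborel (\<lambda>x::'a. C * (1 / (1 + norm x) ^ Suc DIM('a)))"
      by (intro integrable_mult_right integrable_inverse_power)
    show "\<phi> \<in> borel_measurable lborel"
      using smooth_continuous[OF schwartz_smooth[OF assms]] by (simp add: borel_measurable_continuous_onI)
    show "AE x in lborel. norm (\<phi> x) \<le> norm (C * (1 / (1 + norm x) ^ Suc DIM('a)))"
    proof (rule AE_I2)
      fix x :: 'a
      have "0 < (1 + norm x) ^ Suc DIM('a)" by (intro zero_less_power add_pos_nonneg) auto
      then have "norm (\<phi> x) \<le> C * (1 / (1 + norm x) ^ Suc DIM('a))"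
        using C[of x] by (simp add: pos_le_divide_eq mult.commute del: power_Suc)
      then show "norm (\<phi> x) \<le> norm (C * (1 / (1 + norm x) ^ Suc DIM('a)))"
        by (rule order_trans) (simp only: real_norm_def abs_ge_self)
    qed
  qed
qed

lemma schwartz_partial:
  assumes "\<phi> \<in> schwartz" "b \<in> Basis" shows "partials [b] \<phi> \<in> schwartz"
proof -
  have bdd: "bdd_above (range (\<lambda>x. (1 + norm x) ^ k * norm (partials bs (partials [b] \<phi>) x)))" if "bs \<in> lists Basis" for k bs
    using assms that unfolding partials_append[symmetric] schwartz_def by auto
  show ?thesis by (rule schwartzI[OF smooth_partial[OF schwartz_smooth[OF assms(1)] assms(2)] bdd])
qed

lemma schwartz_cmult:
  assumes "\<phi> \<in> schwartz" shows "(\<lambda>x. c * \<phi> x) \<in> schwartz"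
proof -
  have bdd: "bdd_above (range (\<lambda>x. (1 + norm x) ^ k * norm (partials bs (\<lambda>x. c * \<phi> x) x)))" if bs: "bs \<in> lists Basis" for k bs
  proof -
    obtain C where C: "\<And>x. (1 + norm x) ^ k * norm (partials bs \<phi> x) \<le> C" using schwartz_bound[OF assms bs, of k] by metis
    have "(1 + norm x) ^ k * norm (partials bs (\<lambda>x. c * \<phi> x) x) \<le> norm c * C" for x
      using mult_left_mono[OF C[of x] norm_ge_zero[of c]]
      by (simp add: partials_cmult[OF schwartz_smooth[OF assms] bs] norm_mult mult_ac)
    then show ?thesis by (intro bdd_aboveI2)
  qed
  show ?thesis by (rule schwartzI[OF smooth_cmult[OF schwartz_smooth[OF assms]] bdd])
qed

lemma schwartz_add:
  assumes "\<phi> \<in> schwartz" "\<psi> \<in> schwartz" shows "(\<lambda>x. \<phi> x + \<psi> x) \<in> schwartz"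
proof -
  have bdd: "bdd_above (range (\<lambda>x. (1 + norm x) ^ k * norm (partials bs (\<lambda>x. \<phi> x + \<psi> x) x)))" if bs: "bs \<in> lists Basis" for k bs
  proof -
    obtain C D where C: "\<And>x. (1 + norm x) ^ k * norm (partials bs \<phi> x) \<le> C" and D: "\<And>x. (1 + norm x) ^ k * norm (partials bs \<psi> x) \<le> D"
      using schwartz_bound[OF assms(1) bs, of k] schwartz_bound[OF assms(2) bs, of k] by metis
    have "(1 + norm x) ^ k * norm (partials bs (\<lambda>x. \<phi> x + \<psi> x) x) \<le> C + D" for x
    proof -
      have "(1 + norm x) ^ k * norm (partials bs (\<lambda>x. \<phi> x + \<psi> x) x) \<le> (1 + norm x) ^ k * (norm (partials bs \<phi> x) + norm (partials bs \<psi> x))"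
        unfolding partials_add[OF assms[THEN schwartz_smooth] bs] by (intro mult_left_mono norm_triangle_ineq) auto
      also have "\<dots> \<le> C + D" using C[of x] D[of x] by (simp add: ring_distribs)
      finally show ?thesis .
    qed
    then show ?thesis by (intro bdd_aboveI2)
  qed
  show ?thesis by (rule schwartzI[OF smooth_add[OF assms[THEN schwartz_smooth]] bdd])
qed

lemma schwartz_diff:
  assumes "\<phi> \<in> schwartz" "\<psi> \<in> schwartz" shows "(\<lambda>x. \<phi> x - \<psi> x) \<in> schwartz"
  using schwartz_add[OF assms(1) schwartz_cmult[OF assms(2), of "- 1"]] by simp

lemma test_functions_schwartz:
  assumes "\<phi> \<in> test_functions" shows "\<phi> \<in> schwartz"
proof -
  have t: "partials bs \<phi> \<in> test_functions" if "bs \<in> lists Basis" for bs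
    using that
  proof (induction bs)
    case (Cons b bs)
    then show ?case using test_functions_partial[of "partials bs \<phi>" b] by simp
  qed (use assms in simp)
  have bdd: "bdd_above (range (\<lambda>x. (1 + norm x) ^ k * norm (partials bs \<phi> x)))" if bs: "bs \<in> lists Basis" for k bs
  proof -
    obtain R where R: "\<And>x. norm x > R \<Longrightarrow> partials bs \<phi> x = 0" using t[OF bs] by (auto simp: test_functions_iff)
    obtain B where B: "B \<ge> 0" "\<And>x. norm (partials bs \<phi> x) \<le> B" using test_functions_bounded[OF t[OF bs]] by metis
    have "(1 + norm x) ^ k * norm (partials bs \<phi> x) \<le> (1 + \<bar>R\<bar>) ^ k * B" for x
    proof (cases "norm x > R")
      case False
      then show ?thesis using B by (intro mult_mono power_mono) auto
    qed (use R B in auto)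
    then show ?thesis by (intro bdd_aboveI2)
  qed
  show ?thesis by (rule schwartzI[OF test_functions_smooth[OF assms] bdd])
qed

section \<open>Approximation of Schwartz functions by cutoffs\<close>

lemma partial_dilation_mult:
  assumes "smooth \<eta>" "smooth \<phi>"
  shows "partials [b] (\<lambda>x. \<eta> (s *\<^sub>R x) * \<phi> x) = (\<lambda>x. \<eta> (s *\<^sub>R x) * partials [b] \<phi> x + of_real s * (partials [b] \<eta> (s *\<^sub>R x) * \<phi> x))"
proof
  fix x
  have "smooth (\<lambda>x. \<eta> (s *\<^sub>R x))" using smooth_affine(1)[OF assms(1), of s 0] by simp
  from partial_mult[OF smooth_differentiable[OF this] smooth_differentiable[OF assms(2)], of b x]
  show "partials [b] (\<lambda>x. \<eta> (s *\<^sub>R x) * \<phi> x) x = \<eta> (s *\<^sub>R x) * partials [b] \<phi> x + of_real s * (partials [b] \<eta> (s *\<^sub>R x) * \<phi> x)"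
    using smooth_affine(2)[OF assms(1), of b s 0 x] by (simp add: mult.assoc del: partials.simps)
qed

lemma smooth_dilation: "smooth \<eta> \<Longrightarrow> smooth (\<lambda>x. \<eta> (s *\<^sub>R x))"
  using smooth_affine(1)[of \<eta> s 0] by simp

text \<open>The inductive step shared by the two cutoff lemmas: a derivative of
  \<open>\<eta> (s *\<^sub>R x) * \<phi> x\<close> splits into a product of the same kind and s
  times another one.\<close>

lemma norm_partials_add_scaled_le:
  assumes F: "smooth F" "(1 + norm x) ^ k * norm (partials bs F x) \<le> A"
    and G: "smooth G" "(1 + norm x) ^ k * norm (partials bs G x) \<le> B"
    and s: "0 \<le> s" and bs: "bs \<in> lists Basis"
  shows "(1 + norm x) ^ k * norm (partials bs (\<lambda>x. F x + of_real s * G x) x) \<le> A + s * B"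
proof -
  have "partials bs (\<lambda>x. F x + of_real s * G x) x = partials bs F x + of_real s * partials bs G x"
    by (simp add: partials_add[OF F(1) smooth_cmult[OF G(1)] bs] partials_cmult[OF G(1) bs])
  also have "norm \<dots> \<le> norm (partials bs F x) + s * norm (partials bs G x)"
    using norm_triangle_ineq[of "partials bs F x" "of_real s * partials bs G x"] s by (simp add: norm_mult)
  finally have "(1 + norm x) ^ k * norm (partials bs (\<lambda>x. F x + of_real s * G x) x)
     \<le> (1 + norm x) ^ k * (norm (partials bs F x) + s * norm (partials bs G x))" by (intro mult_left_mono) auto
  also have "\<dots> = (1 + norm x) ^ k * norm (partials bs F x) + s * ((1 + norm x) ^ k * norm (partials bs G x))"
    by (simp add: algebra_simps)
  also have "\<dots> \<le> A + s * B" by (intro add_mono F G mult_left_mono s)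
  finally show ?thesis .
qed

text \<open>A derivative that falls on the dilated factor brings a factor s \<le> 1, so the bounds
  are uniform in s. The induction peels off the innermost derivative, with \<eta> and \<phi> free to
  be replaced by their partial derivatives.\<close>

lemma cutoff_bounded:
  assumes "\<eta> \<in> test_functions" "\<phi> \<in> schwartz" "bs \<in> lists Basis"
  shows "\<exists>C. \<forall>s x. 0 < s \<longrightarrow> s \<le> 1 \<longrightarrow> (1 + norm x) ^ k * norm (partials bs (\<lambda>x. \<eta> (s *\<^sub>R x) * \<phi> x) x) \<le> C"
  using assms
proof (induction bs arbitrary: \<eta> \<phi> rule: rev_induct)
  case Nil
  obtain B where B: "B \<ge> 0" "\<And>x. norm (\<eta> x) \<le> B" using test_functions_bounded[OF Nil(1)] by metis
  obtain C where C: "C \<ge> 0" "\<And>x. (1 + norm x) ^ k * norm (\<phi> x) \<le> C" using schwartz_bound[OF Nil(2), of "[]" k] by auto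
  have "(1 + norm x) ^ k * norm (\<eta> (s *\<^sub>R x) * \<phi> x) \<le> B * C" for s x
  proof -
    have "(1 + norm x) ^ k * norm (\<eta> (s *\<^sub>R x) * \<phi> x) = norm (\<eta> (s *\<^sub>R x)) * ((1 + norm x) ^ k * norm (\<phi> x))" by (simp add: norm_mult)
    also have "\<dots> \<le> B * C" using B C by (intro mult_mono) auto
    finally show ?thesis .
  qed
  then show ?case by auto
next
  case (snoc b bs)
  then have b: "b \<in> Basis" and bs: "bs \<in> lists Basis" by auto
  from snoc.IH[OF snoc.prems(1) schwartz_partial[OF snoc.prems(2) b] bs]
  obtain C where "\<forall>s x. 0 < s \<longrightarrow> s \<le> 1 \<longrightarrow> (1 + norm x) ^ k * norm (partials bs (\<lambda>x. \<eta> (s *\<^sub>R x) * partials [b] \<phi> x) x) \<le> C" by (elim exE)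
  then have C: "\<And>s x. 0 < s \<Longrightarrow> s \<le> 1 \<Longrightarrow> (1 + norm x) ^ k * norm (partials bs (\<lambda>x. \<eta> (s *\<^sub>R x) * partials [b] \<phi> x) x) \<le> C" by (simp only: simp_thms)
  from snoc.IH[OF test_functions_partial[OF snoc.prems(1) b] snoc.prems(2) bs]
  obtain D where "\<forall>s x. 0 < s \<longrightarrow> s \<le> 1 \<longrightarrow> (1 + norm x) ^ k * norm (partials bs (\<lambda>x. partials [b] \<eta> (s *\<^sub>R x) * \<phi> x) x) \<le> D" by (elim exE)
  then have D: "\<And>s x. 0 < s \<Longrightarrow> s \<le> 1 \<Longrightarrow> (1 + norm x) ^ k * norm (partials bs (\<lambda>x. partials [b] \<eta> (s *\<^sub>R x) * \<phi> x) x) \<le> D" by (simp only: simp_thms)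
  note sm = test_functions_smooth[OF snoc.prems(1)] schwartz_smooth[OF snoc.prems(2)]
  have "(1 + norm x) ^ k * norm (partials (bs @ [b]) (\<lambda>x. \<eta> (s *\<^sub>R x) * \<phi> x) x) \<le> C + \<bar>D\<bar>" if s: "0 < s" "s \<le> 1" for s x
  proof -
    have "(1 + norm x) ^ k * norm (partials (bs @ [b]) (\<lambda>x. \<eta> (s *\<^sub>R x) * \<phi> x) x) \<le> C + s * D"
      unfolding partials_append partial_dilation_mult[OF sm]
      by (intro norm_partials_add_scaled_le C D smooth_mult smooth_dilation smooth_partial sm b bs) (use s in auto)
    also have "s * D \<le> s * \<bar>D\<bar>" using s by (intro mult_left_mono) auto
    also have "\<dots> \<le> 1 * \<bar>D\<bar>" using s by (intro mult_right_mono) auto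
    finally show ?thesis by simp
  qed
  then show ?case by blast
qed

text \<open>The rate s has two sources. Without derivatives it is the Lipschitz bound for \<eta>, at
  the cost of one more power of 1 + |x|; a derivative that falls on the dilated \<eta> brings a
  factor s in front of a term controlled by \<open>cutoff_bounded\<close>.\<close>

lemma cutoff_converges:
  assumes "\<eta> \<in> test_functions" "\<phi> \<in> schwartz" "bs \<in> lists Basis"
  shows "\<exists>C. \<forall>s x. 0 < s \<longrightarrow> s \<le> 1 \<longrightarrow> (1 + norm x) ^ k * norm (partials bs (\<lambda>x. \<eta> (s *\<^sub>R x) * \<phi> x - \<eta> 0 * \<phi> x) x) \<le> C * s"
  using assms
proof (induction bs arbitrary: \<eta> \<phi> rule: rev_induct)
  case Nil
  obtain L where L: "L \<ge> 0" "\<And>x y. norm (\<eta> x - \<eta> y) \<le> L * norm (x - y)" using test_functions_lipschitz[OF Nil(1)] by metis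
  obtain C where C: "C \<ge> 0" "\<And>x. (1 + norm x) ^ Suc k * norm (\<phi> x) \<le> C" using schwartz_bound[OF Nil(2), of "[]" "Suc k"] by auto
  have "(1 + norm x) ^ k * norm (\<eta> (s *\<^sub>R x) * \<phi> x - \<eta> 0 * \<phi> x) \<le> L * C * s" if "0 < s" for s x
  proof -
    have "norm (\<eta> (s *\<^sub>R x) * \<phi> x - \<eta> 0 * \<phi> x) = norm (\<eta> (s *\<^sub>R x) - \<eta> 0) * norm (\<phi> x)"
      by (simp add: norm_mult left_diff_distrib[symmetric])
    also have "\<dots> \<le> (L * norm (s *\<^sub>R x - 0)) * norm (\<phi> x)" by (intro mult_right_mono L) auto
    also have "\<dots> \<le> (L * (s * (1 + norm x))) * norm (\<phi> x)" using that L by (intro mult_right_mono mult_left_mono) auto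
    finally have "(1 + norm x) ^ k * norm (\<eta> (s *\<^sub>R x) * \<phi> x - \<eta> 0 * \<phi> x) \<le> (1 + norm x) ^ k * ((L * (s * (1 + norm x))) * norm (\<phi> x))"
      by (intro mult_left_mono) auto
    also have "\<dots> = L * s * ((1 + norm x) ^ Suc k * norm (\<phi> x))" by simp
    also have "\<dots> \<le> L * s * C" using that L by (intro mult_left_mono C) auto
    finally show ?thesis by (simp only: mult_ac)
  qed
  then show ?case by auto
next
  case (snoc b bs)
  then have b: "b \<in> Basis" and bs: "bs \<in> lists Basis" by auto
  from snoc.IH[OF snoc.prems(1) schwartz_partial[OF snoc.prems(2) b] bs]
  obtain C where "\<forall>s x. 0 < s \<longrightarrow> s \<le> 1 \<longrightarrow> (1 + norm x) ^ k * norm (partials bs (\<lambda>x. \<eta> (s *\<^sub>R x) * partials [b] \<phi> x - \<eta> 0 * partials [b] \<phi> x) x) \<le> C * s" by (elim exE)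
  then have C: "\<And>s x. 0 < s \<Longrightarrow> s \<le> 1 \<Longrightarrow> (1 + norm x) ^ k * norm (partials bs (\<lambda>x. \<eta> (s *\<^sub>R x) * partials [b] \<phi> x - \<eta> 0 * partials [b] \<phi> x) x) \<le> C * s" by (simp only: simp_thms)
  from cutoff_bounded[OF test_functions_partial[OF snoc.prems(1) b] snoc.prems(2) bs, of k]
  obtain D where "\<forall>s x. 0 < s \<longrightarrow> s \<le> 1 \<longrightarrow> (1 + norm x) ^ k * norm (partials bs (\<lambda>x. partials [b] \<eta> (s *\<^sub>R x) * \<phi> x) x) \<le> D" by (elim exE)
  then have D: "\<And>s x. 0 < s \<Longrightarrow> s \<le> 1 \<Longrightarrow> (1 + norm x) ^ k * norm (partials bs (\<lambda>x. partials [b] \<eta> (s *\<^sub>R x) * \<phi> x) x) \<le> D" by (simp only: simp_thms)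
  note sm = test_functions_smooth[OF snoc.prems(1)] schwartz_smooth[OF snoc.prems(2)]
  have d: "partials [b] (\<lambda>x. \<eta> (s *\<^sub>R x) * \<phi> x - \<eta> 0 * \<phi> x)
    = (\<lambda>x. (\<eta> (s *\<^sub>R x) * partials [b] \<phi> x - \<eta> 0 * partials [b] \<phi> x) + of_real s * (partials [b] \<eta> (s *\<^sub>R x) * \<phi> x))" for s
  proof -
    have "partials [b] (\<lambda>x. \<eta> (s *\<^sub>R x) * \<phi> x + (- \<eta> 0) * \<phi> x) = (\<lambda>x. partials [b] (\<lambda>x. \<eta> (s *\<^sub>R x) * \<phi> x) x + (- \<eta> 0) * partials [b] \<phi> x)"
    proof -
      have b': "[b] \<in> lists Basis" using b by simp
      show ?thesis
        unfolding partials_add[OF smooth_mult[OF smooth_dilation[OF sm(1)] sm(2)] smooth_cmult[OF sm(2)] b']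
          partials_cmult[OF sm(2) b'] ..
    qed
    then show ?thesis unfolding partial_dilation_mult[OF sm] by (simp add: algebra_simps del: partials.simps)
  qed
  have sm': "smooth (\<lambda>x. \<eta> (s *\<^sub>R x) * partials [b] \<phi> x - \<eta> 0 * partials [b] \<phi> x)" for s
    using smooth_add[OF smooth_mult[OF smooth_dilation[OF sm(1)] smooth_partial[OF sm(2) b]] smooth_cmult[OF smooth_partial[OF sm(2) b], of "- \<eta> 0"], of s]
    by (simp del: partials.simps)
  have "(1 + norm x) ^ k * norm (partials (bs @ [b]) (\<lambda>x. \<eta> (s *\<^sub>R x) * \<phi> x - \<eta> 0 * \<phi> x) x) \<le> (C + D) * s" if s: "0 < s" "s \<le> 1" for s x
  proof -
    have "(1 + norm x) ^ k * norm (partials (bs @ [b]) (\<lambda>x. \<eta> (s *\<^sub>R x) * \<phi> x - \<eta> 0 * \<phi> x) x) \<le> C * s + s * D"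
      unfolding partials_append d
      by (intro norm_partials_add_scaled_le C D sm' smooth_mult smooth_dilation smooth_partial sm b bs) (use s in auto)
    then show ?thesis by (simp add: algebra_simps)
  qed
  then show ?case by blast
qed

section \<open>Seminorm convergence and tempered distributions\<close>

lemma schwartz_seminorm_upper:
  assumes "\<phi> \<in> schwartz" "bs \<in> lists Basis"
  shows "(1 + norm x) ^ k * norm (partials bs \<phi> x) \<le> schwartz_seminorm k bs \<phi>"
  unfolding schwartz_seminorm_def using assms by (intro cSUP_upper) (auto simp: schwartz_def)

lemma schwartz_seminorm_least:
  assumes "\<And>x. (1 + norm x) ^ k * norm (partials bs \<phi> x) \<le> C" shows "schwartz_seminorm k bs \<phi> \<le> C"
  unfolding schwartz_seminorm_def using assms by (intro cSUP_least) auto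

lemma schwartz_seminorm_add:
  assumes "\<phi> \<in> schwartz" "\<psi> \<in> schwartz" "bs \<in> lists Basis"
  shows "schwartz_seminorm k bs (\<lambda>x. \<phi> x + \<psi> x) \<le> schwartz_seminorm k bs \<phi> + schwartz_seminorm k bs \<psi>"
proof (rule schwartz_seminorm_least)
  fix x
  have "(1 + norm x) ^ k * norm (partials bs (\<lambda>x. \<phi> x + \<psi> x) x) \<le> (1 + norm x) ^ k * (norm (partials bs \<phi> x) + norm (partials bs \<psi> x))"
    unfolding partials_add[OF assms(1,2)[THEN schwartz_smooth] assms(3)] by (intro mult_left_mono norm_triangle_ineq) auto
  also have "\<dots> \<le> schwartz_seminorm k bs \<phi> + schwartz_seminorm k bs \<psi>"
    using schwartz_seminorm_upper[OF assms(1,3), of x k] schwartz_seminorm_upper[OF assms(2,3), of x k] by (simp add: ring_distribs)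
  finally show "(1 + norm x) ^ k * norm (partials bs (\<lambda>x. \<phi> x + \<psi> x) x) \<le> schwartz_seminorm k bs \<phi> + schwartz_seminorm k bs \<psi>" .
qed

text \<open>The subbasic sets are centred at arbitrary Schwartz functions, and the triangle
  inequality for the seminorm leaves room around \<phi> in each of them. Induction over the
  generation of the topology does the rest.\<close>

lemma schwartz_topology_eventually:
  assumes f: "\<And>n. f n \<in> schwartz" and \<phi>: "\<phi> \<in> schwartz"
    and lim: "\<And>k bs. bs \<in> lists Basis \<Longrightarrow> (\<lambda>n. schwartz_seminorm k bs (\<lambda>x. f n x - \<phi> x)) \<longlonglongrightarrow> 0"
    and V: "openin schwartz_topology V" "\<phi> \<in> V"
  shows "\<forall>\<^sub>F n in sequentially. f n \<in> V"
proof -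
  have "generate_topology_on {{\<psi> \<in> schwartz. schwartz_seminorm k bs (\<lambda>x. \<psi> x - \<phi> x) < \<epsilon>} |k bs \<phi> \<epsilon>.
        bs \<in> lists Basis \<and> \<phi> \<in> schwartz \<and> \<epsilon> > 0} V"
    using V(1) unfolding schwartz_topology_def openin_topology_generated_by_iff .
  then show ?thesis using V(2)
  proof induction
    case (Int a b)
    then show ?case by (auto simp: eventually_conj_iff)
  next
    case (UN K)
    then obtain X where X: "X \<in> K" "\<phi> \<in> X" by blast
    from UN.IH[OF X] show ?case by (rule eventually_mono) (use X in blast)
  next
    case (Basis S)
    then obtain k bs \<phi>' \<epsilon> where S: "S = {\<psi> \<in> schwartz. schwartz_seminorm k bs (\<lambda>x. \<psi> x - \<phi>' x) < \<epsilon>}"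
      and bs: "bs \<in> lists Basis" and \<phi>': "\<phi>' \<in> schwartz" by blast
    have "schwartz_seminorm k bs (\<lambda>x. \<phi> x - \<phi>' x) < \<epsilon>" using Basis.prems S by simp
    then have "0 < \<epsilon> - schwartz_seminorm k bs (\<lambda>x. \<phi> x - \<phi>' x)" by simp
    from order_tendstoD(2)[OF lim[OF bs, of k] this]
    show ?case
    proof eventually_elim
      fix n assume "schwartz_seminorm k bs (\<lambda>x. f n x - \<phi> x) < \<epsilon> - schwartz_seminorm k bs (\<lambda>x. \<phi> x - \<phi>' x)"
      moreover have "schwartz_seminorm k bs (\<lambda>x. f n x - \<phi>' x) \<le> schwartz_seminorm k bs (\<lambda>x. f n x - \<phi> x) + schwartz_seminorm k bs (\<lambda>x. \<phi> x - \<phi>' x)"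
        using schwartz_seminorm_add[OF schwartz_diff[OF f \<phi>] schwartz_diff[OF \<phi> \<phi>'] bs, of k n] by simp
      ultimately show "f n \<in> S" using f by (simp add: S)
    qed
  qed auto
qed

lemma tempered_tendsto:
  assumes U: "U \<in> tempered_distributions" and f: "\<And>n. f n \<in> schwartz" and \<phi>: "\<phi> \<in> schwartz"
    and lim: "\<And>k bs. bs \<in> lists Basis \<Longrightarrow> (\<lambda>n. schwartz_seminorm k bs (\<lambda>x. f n x - \<phi> x)) \<longlonglongrightarrow> 0"
  shows "(\<lambda>n. U (f n)) \<longlonglongrightarrow> U \<phi>"
proof (rule topological_tendstoI)
  fix S assume S: "open S" "U \<phi> \<in> S"
  have "openin schwartz_topology {x \<in> topspace schwartz_topology. U x \<in> S}"
    using U S(1) unfolding tempered_distributions_def by (auto intro: openin_continuous_map_preimage)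
  then have "\<forall>\<^sub>F n in sequentially. f n \<in> {x \<in> topspace schwartz_topology. U x \<in> S}"
    using S(2) \<phi> by (intro schwartz_topology_eventually[OF f \<phi> lim]) (auto simp: topspace_schwartz_topology)
  then show "\<forall>\<^sub>F n in sequentially. U (f n) \<in> S" by (rule eventually_mono) simp
qed

text \<open>\<open>is_function\<close> speaks of test functions only, while the transforms of
  mollifiers are merely Schwartz functions. Cutoffs bridge the gap: continuity of U on one side,
  dominated convergence on the other.\<close>

lemma tempered_function_schwartz:
  fixes g \<eta> :: "'a::euclidean_space \<Rightarrow> complex"
  assumes U: "U \<in> tempered_distributions" and g: "is_function U g" and \<phi>: "\<phi> \<in> schwartz"
    and i: "integrable lborel (\<lambda>x. g x * \<phi> x)" and \<eta>: "\<eta> \<in> test_functions" "\<eta> 0 = 1"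
  shows "U \<phi> = (\<integral>x. g x * \<phi> x \<partial>lborel)"
proof -
  define s where "s n = inverse (real (Suc n))" for n
  have s0: "s n > 0" "s n \<le> 1" for n by (auto simp: s_def field_simps)
  have sl: "s \<longlonglongrightarrow> 0" using LIMSEQ_inverse_real_of_nat by (simp add: s_def[abs_def] del: of_nat_Suc)
  obtain B where B: "\<And>x. norm (\<eta> x) \<le> B" using test_functions_bounded[OF \<eta>(1)] by metis
  have t: "(\<lambda>x. \<phi> x * \<eta> (s n *\<^sub>R x)) \<in> test_functions" for n
    using s0[of n] test_functions_affine[OF \<eta>(1), of "s n" 0] by (intro test_functions_mult schwartz_smooth \<phi>) simp
  have L1: "(\<lambda>n. U (\<lambda>x. \<phi> x * \<eta> (s n *\<^sub>R x))) \<longlonglongrightarrow> U \<phi>"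
  proof (rule tempered_tendsto[OF U test_functions_schwartz[OF t] \<phi>])
    fix k and bs :: "'a list" assume bs: "bs \<in> lists Basis"
    from cutoff_converges[OF \<eta>(1) \<phi> bs, of k]
  obtain C where "\<forall>s x. 0 < s \<longrightarrow> s \<le> 1 \<longrightarrow> (1 + norm x) ^ k * norm (partials bs (\<lambda>x. \<eta> (s *\<^sub>R x) * \<phi> x - \<eta> 0 * \<phi> x) x) \<le> C * s" by (elim exE)
  then have C: "\<And>s x. 0 < s \<Longrightarrow> s \<le> 1 \<Longrightarrow> (1 + norm x) ^ k * norm (partials bs (\<lambda>x. \<eta> (s *\<^sub>R x) * \<phi> x - \<eta> 0 * \<phi> x) x) \<le> C * s" by (simp only: simp_thms)
    have a: "norm (schwartz_seminorm k bs (\<lambda>x. \<phi> x * \<eta> (s n *\<^sub>R x) - \<phi> x)) \<le> C * s n" for n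
    proof -
      have "schwartz_seminorm k bs (\<lambda>x. \<phi> x * \<eta> (s n *\<^sub>R x) - \<phi> x) \<le> C * s n"
        using C[OF s0, of _ n] \<eta>(2) by (intro schwartz_seminorm_least) (simp add: mult.commute)
      moreover have "0 \<le> schwartz_seminorm k bs (\<lambda>x. \<phi> x * \<eta> (s n *\<^sub>R x) - \<phi> x)"
        using schwartz_seminorm_upper[OF schwartz_diff[OF test_functions_schwartz[OF t] \<phi>] bs, of 0 k n]
        by (rule order_trans[rotated]) simp
      ultimately show ?thesis by simp
    qed
    have b: "(\<lambda>n. C * s n) \<longlonglongrightarrow> 0" using tendsto_mult_left[OF sl, of C] by simp
    show "(\<lambda>n. schwartz_seminorm k bs (\<lambda>x. \<phi> x * \<eta> (s n *\<^sub>R x) - \<phi> x)) \<longlonglongrightarrow> 0"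
      by (rule Lim_null_comparison[OF _ b], rule always_eventually, rule allI, rule a)
  qed
  have L2: "U (\<lambda>x. \<phi> x * \<eta> (s n *\<^sub>R x)) = (\<integral>x. g x * \<phi> x * \<eta> (s n *\<^sub>R x) \<partial>lborel)" for n
    using g t[of n] by (simp add: is_function_def mult.assoc)
  have L3: "(\<lambda>n. \<integral>x. g x * \<phi> x * \<eta> (s n *\<^sub>R x) \<partial>lborel) \<longlonglongrightarrow> (\<integral>x. g x * \<phi> x * \<eta> (0 *\<^sub>R x) \<partial>lborel)"
  proof (rule integral_dominated_convergence[where w="\<lambda>x. norm (g x * \<phi> x) * B"])
    have c: "isCont \<eta> x" for x using test_functions_continuous[OF \<eta>(1)] by (simp add: continuous_on_eq_continuous_at)
    have [measurable]: "\<eta> \<in> borel_measurable borel"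
      using test_functions_continuous[OF \<eta>(1)] by (rule borel_measurable_continuous_onI)
    note [measurable] = borel_measurable_integrable[OF i]
    show "(\<lambda>x. g x * \<phi> x * \<eta> (0 *\<^sub>R x)) \<in> borel_measurable lborel" "(\<lambda>x. g x * \<phi> x * \<eta> (s n *\<^sub>R x)) \<in> borel_measurable lborel" for n
      by measurable
    show "integrable lborel (\<lambda>x. norm (g x * \<phi> x) * B)" using i by (intro integrable_mult_left integrable_norm)
    show "AE x in lborel. (\<lambda>n. g x * \<phi> x * \<eta> (s n *\<^sub>R x)) \<longlonglongrightarrow> g x * \<phi> x * \<eta> (0 *\<^sub>R x)"
      by (intro AE_I2 tendsto_mult tendsto_const isCont_tendsto_compose[OF c] tendsto_scaleR sl)
    show "AE x in lborel. norm (g x * \<phi> x * \<eta> (s n *\<^sub>R x)) \<le> norm (g x * \<phi> x) * B" for n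
      using B by (intro AE_I2) (auto simp: norm_mult intro!: mult_left_mono)
  qed
  show ?thesis using LIMSEQ_unique[OF L1[unfolded L2] L3] by (simp add: \<eta>(2))
qed

section \<open>Smooth bump functions\<close>

definition flat_exp :: "real poly \<Rightarrow> real \<Rightarrow> real" where
  "flat_exp p t = (if t > 0 then poly p (1 / t) * exp (- (1 / t)) else 0)"

lemma poly_times_exp_tendsto_0: "((\<lambda>x::real. poly p x * exp (- x)) \<longlongrightarrow> 0) at_top"
proof -
  have "((\<lambda>x. \<Sum>i\<le>degree p. coeff p i * (x ^ i / exp x)) \<longlongrightarrow> (\<Sum>i\<le>degree p. coeff p i * 0)) at_top"
    by (intro tendsto_intros tendsto_power_div_exp_0)
  then show ?thesis by (simp add: poly_altdef sum_distrib_right exp_minus divide_inverse mult.assoc)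
qed

text \<open>In s = 1/t the t-derivative of p(s) exp (-s) is s^2 (p - p')(s) exp (-s). The polynomial
  factor thus makes the family closed under differentiation, as \<open>smooth_on_radial\<close>
  requires.\<close>

lemma flat_exp_derivative:
  "(flat_exp p has_real_derivative flat_exp ([:0, 0, 1:] * (p - pderiv p)) t) (at t)"
proof -
  consider "t > 0" | "t < 0" | "t = 0" by linarith
  then show ?thesis
  proof cases
    case 1
    have "((\<lambda>t. poly p (1 / t) * exp (- (1 / t))) has_real_derivative flat_exp ([:0, 0, 1:] * (p - pderiv p)) t) (at t)"
      using 1 by (auto intro!: derivative_eq_intros poly_DERIV[THEN DERIV_chain2] simp: flat_exp_def field_simps power2_eq_square)
    then show ?thesis
      by (rule has_field_derivative_transform_within_open[where S="{0<..}"]) (use 1 in \<open>auto simp: flat_exp_def\<close>)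
  next
    case 2
    have "((\<lambda>t. 0) has_real_derivative flat_exp ([:0, 0, 1:] * (p - pderiv p)) t) (at t)"
      using 2 by (auto simp: flat_exp_def)
    then show ?thesis
      by (rule has_field_derivative_transform_within_open[where S="{..<0}"]) (use 2 in \<open>auto simp: flat_exp_def\<close>)
  next
    case 3
    \<comment> \<open>At 0 the difference quotient divides by h, which raises the polynomial in 1/h
      by one power.\<close>
    have "((\<lambda>h. poly ([:0, 1:] * p) (inverse h) * exp (- inverse h)) \<longlongrightarrow> 0) (at_right (0::real))"
      by (rule filterlim_compose[OF poly_times_exp_tendsto_0 filterlim_inverse_at_top_right])
    then have "((\<lambda>h. (flat_exp p (0 + h) - flat_exp p 0) / h) \<longlongrightarrow> 0) (at_right 0)"
      by (rule Lim_transform_eventually)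
        (auto simp: flat_exp_def field_simps intro!: eventually_at_rightI[of 0 1])
    moreover have "((\<lambda>h. (flat_exp p (0 + h) - flat_exp p 0) / h) \<longlongrightarrow> 0) (at_left 0)"
      by (rule Lim_transform_eventually[OF tendsto_const])
        (auto simp: flat_exp_def intro!: eventually_at_leftI[of "- 1" 0])
    ultimately have "((\<lambda>h. (flat_exp p (0 + h) - flat_exp p 0) / h) \<longlongrightarrow> 0) (at 0)"
      by (simp add: filterlim_at_split)
    then show ?thesis unfolding 3 DERIV_def by (simp add: flat_exp_def)
  qed
qed

definition bump :: "'a::euclidean_space \<Rightarrow> complex" where
  "bump x = of_real (flat_exp 1 (1 - (norm x)\<^sup>2))"

lemma smooth_bump: "smooth (bump :: 'a::euclidean_space \<Rightarrow> complex)"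
proof -
  \<comment> \<open>The constant c takes up the sign that the inner function 1 - t produces at each
    differentiation.\<close>
  let ?\<F> = "{\<lambda>t. c * flat_exp p (1 - t) | c p. True}"
  have "smooth_on UNIV (\<lambda>x::'a. complex_of_real ((\<lambda>t. 1 * flat_exp 1 (1 - t)) ((norm x)\<^sup>2)))"
  proof (rule smooth_on_radial[where T=UNIV and \<F>="?\<F>"])
    fix F assume "F \<in> ?\<F>"
    then obtain c p where F: "F = (\<lambda>t. c * flat_exp p (1 - t))" by auto
    have "(F has_real_derivative (- c) * flat_exp ([:0, 0, 1:] * (p - pderiv p)) (1 - t)) (at t)" for t
      unfolding F by (auto intro!: derivative_eq_intros flat_exp_derivative[THEN DERIV_chain2] simp del: mult_pCons_left)
    then show "\<exists>G\<in>?\<F>. \<forall>t\<in>UNIV. (F has_real_derivative G t) (at t)"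
      by (intro bexI[of _ "\<lambda>t. (- c) * flat_exp ([:0, 0, 1:] * (p - pderiv p)) (1 - t)"] CollectI
          exI[of _ "- c"] exI[of _ "[:0, 0, 1:] * (p - pderiv p)"] conjI refl TrueI ballI)
  next
    show "(\<lambda>t. 1 * flat_exp 1 (1 - t)) \<in> ?\<F>" by (intro CollectI exI[of _ "1::real"] exI[of _ "1::real poly"] conjI refl TrueI)
  qed simp_all
  then show ?thesis by (simp add: smooth_iff_smooth_on bump_def[abs_def])
qed

lemma bump_eq_0: "norm x \<ge> 1 \<Longrightarrow> bump x = 0"
  by (simp add: bump_def flat_exp_def power2_eq_square mult_le_one not_less)
     (metis abs_norm_cancel abs_square_less_1 linorder_not_less power2_eq_square)

lemma bump_test_function: "bump \<in> test_functions"
  unfolding test_functions_iff by (intro conjI exI[of _ 1] allI impI bump_eq_0 smooth_bump) simp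

lemma bump_pos: "norm x < 1 \<Longrightarrow> \<exists>r>0. bump x = of_real r"
  unfolding bump_def flat_exp_def by (auto simp: abs_square_less_1)

lemma integral_bump_nonzero: "(\<integral>x. bump (x::'a::euclidean_space) \<partial>lborel) \<noteq> 0"
proof
  let ?b = "\<lambda>x::'a. flat_exp 1 (1 - (norm x)\<^sup>2)"
  assume "(\<integral>x. bump (x::'a) \<partial>lborel) = 0"
  then have "(\<integral>x. ?b x \<partial>lborel) = 0" unfolding bump_def integral_complex_of_real by simp
  moreover have i: "integrable lborel ?b"
    using test_functions_integrable[OF bump_test_function] unfolding bump_def[abs_def] complex_of_real_integrable_eq .
  moreover have "AE x in lborel. 0 \<le> ?b x" by (simp add: flat_exp_def)
  ultimately have "AE x in lborel. ?b x = 0" using integral_nonneg_eq_0_iff_AE by blast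
  then have "AE x in lborel. x \<notin> ball (0::'a) 1"
    by eventually_elim (auto simp: flat_exp_def abs_square_less_1 split: if_splits)
  then have "emeasure lborel (ball (0::'a) 1) = 0" by (subst (asm) AE_iff_measurable[where N="ball 0 1"]) auto
  then have "measure lborel (ball (0::'a) 1) = 0" by (simp add: measure_def)
  then show False using content_ball_pos[of 1 "0::'a"] by simp
qed

lemma mollifier_exists:
  obtains \<rho> :: "'a::euclidean_space \<Rightarrow> complex"
  where "\<rho> \<in> test_functions" "(\<integral>x. \<rho> x \<partial>lborel) = 1" "\<And>x. norm x \<ge> 1 \<Longrightarrow> \<rho> x = 0"
proof (rule that)
  let ?c = "inverse (\<integral>x. bump (x::'a) \<partial>lborel)"
  show "(\<lambda>x::'a. ?c * bump x) \<in> test_functions" by (intro test_functions_cmult bump_test_function)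
  show "(\<integral>x. ?c * bump (x::'a) \<partial>lborel) = 1" using integral_bump_nonzero[where 'a='a] by simp
qed (simp add: bump_eq_0)

lemma cutoff_exists:
  obtains \<eta> :: "'a::euclidean_space \<Rightarrow> complex" where "\<eta> \<in> test_functions" "\<eta> 0 = 1"
proof (rule that)
  show "(\<lambda>x::'a. inverse (bump (0::'a)) * bump x) \<in> test_functions" by (intro test_functions_cmult bump_test_function)
  show "inverse (bump (0::'a)) * bump (0::'a) = 1" using bump_pos[of "0::'a"] by auto
qed

section \<open>Herglotz waves belong to \<open>B\<^sup>*\<close>\<close>

definition radial_measure :: "nat \<Rightarrow> real measure" where
  "radial_measure d = density lborel (\<lambda>r. ennreal (r ^ (d - 1)) * indicator {0<..} r)"

lemma sets_radial_measure [measurable_cong]: "sets (radial_measure d) = sets borel"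
  by (simp add: radial_measure_def)

lemma nn_integral_radial:
  assumes "F \<in> borel_measurable borel"
  shows "(\<integral>\<^sup>+r. F r \<partial>radial_measure d) = (\<integral>\<^sup>+r. F r * ennreal (r ^ (d - 1)) * indicator {0<..} r \<partial>lborel)"
  unfolding radial_measure_def using assms by (subst nn_integral_density) (auto simp: mult_ac)

lemma AE_radial_pos: "AE r in radial_measure d. r > 0"
  unfolding radial_measure_def by (subst AE_density) (auto simp: indicator_def)

text \<open>On the shell r \<le> 2, so the density is at most \<open>2 ^ (d - 1)\<close>, and the
  interval has length 2\<epsilon>.\<close>

lemma nn_integral_radial_shell_le:
  assumes e: "0 \<le> \<epsilon>" "\<epsilon> \<le> 1" and d: "d > 0"
  shows "(\<integral>\<^sup>+r. indicator {1 - \<epsilon>..1 + \<epsilon>} r \<partial>radial_measure d) \<le> ennreal (2 ^ d * \<epsilon>)"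
proof -
  have "(\<integral>\<^sup>+r. indicator {1 - \<epsilon>..1 + \<epsilon>} r \<partial>radial_measure d) = (\<integral>\<^sup>+r. indicator {1 - \<epsilon>..1 + \<epsilon>} r * ennreal (r ^ (d - 1)) * indicator {0<..} r \<partial>lborel)"
    by (rule nn_integral_radial) simp
  also have "\<dots> \<le> (\<integral>\<^sup>+r. ennreal (2 ^ (d - 1)) * indicator {1 - \<epsilon>..1 + \<epsilon>} r \<partial>lborel)"
    using e by (intro nn_integral_mono) (auto simp: indicator_def intro!: ennreal_leI power_mono)
  also have "\<dots> = ennreal (2 ^ (d - 1)) * ennreal (2 * \<epsilon>)"
    using e by (simp add: nn_integral_cmult_indicator)
  also have "\<dots> = ennreal (2 ^ d * \<epsilon>)"
    using e d by (cases d) (auto simp: ennreal_mult[symmetric] mult_ac)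
  finally show ?thesis .
qed

lemma sigma_finite_radial: "sigma_finite_measure (radial_measure d)"
  unfolding radial_measure_def
  by (subst sigma_finite_measure.sigma_finite_iff_density_finite[OF sigma_finite_lborel]) (auto simp: indicator_def)

lemma sigma_finite_sphere: "sigma_finite_measure (sphere_measure :: 'a::euclidean_space measure)"
  by (rule finite_measure.axioms(1)[OF finite_measure_sphere])

lemma pair_sigma_finite_polar: "pair_sigma_finite (sphere_measure :: 'a::euclidean_space measure) (radial_measure d)"
  using sigma_finite_sphere sigma_finite_radial by (rule pair_sigma_finite.intro)

lemma measurable_id_sphere: "(\<lambda>\<omega>. \<omega>) \<in> borel_measurable (sphere_measure :: 'a::euclidean_space measure)"
  by (rule borel_measurable_sphere) simp

lemma measurable_polar_map:
  "(\<lambda>(\<omega>::'a::euclidean_space, r). r *\<^sub>R \<omega>) \<in> borel_measurable (sphere_measure \<Otimes>\<^sub>M radial_measure DIM('a))"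
proof -
  note [measurable] = measurable_id_sphere
  have "(\<lambda>x::'a \<times> real. snd x *\<^sub>R (\<lambda>\<omega>. \<omega>) (fst x)) \<in> borel_measurable (sphere_measure \<Otimes>\<^sub>M radial_measure DIM('a))"
    by measurable
  then show ?thesis by (simp add: case_prod_beta)
qed

lemma lborel_polar:
  "distr (sphere_measure \<Otimes>\<^sub>M radial_measure DIM('a)) borel (\<lambda>(\<omega>::'a::euclidean_space, r). r *\<^sub>R \<omega>) = lborel"
  (is "distr ?P borel ?T = _")
proof (rule measure_eqI)
  interpret R: sigma_finite_measure "radial_measure DIM('a)" by (rule sigma_finite_radial)
  note [measurable] = measurable_polar_map
  fix A :: "'a set" assume "A \<in> sets (distr ?P borel ?T)"
  then have A[measurable]: "A \<in> sets borel" by simp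
  have "emeasure (distr ?P borel ?T) A = (\<integral>\<^sup>+z. indicator A z \<partial>distr ?P borel ?T)" by simp
  also have "\<dots> = (\<integral>\<^sup>+z. indicator A (?T z) \<partial>?P)" by (rule nn_integral_distr) measurable
  also have "\<dots> = (\<integral>\<^sup>+\<omega>. \<integral>\<^sup>+r. indicator A (r *\<^sub>R \<omega>) \<partial>radial_measure DIM('a) \<partial>sphere_measure)"
    by (subst R.nn_integral_fst[symmetric]) (auto intro!: nn_integral_cong)
  also have "\<dots> = (\<integral>\<^sup>+\<omega>. (\<integral>\<^sup>+r. indicator A (r *\<^sub>R \<omega>) * ennreal (r ^ (DIM('a) - 1)) * indicator {0<..} r \<partial>lborel) \<partial>sphere_measure)"
    by (intro nn_integral_cong nn_integral_radial) measurable
  also have "\<dots> = (\<integral>\<^sup>+x. indicator A x \<partial>lborel)"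
    by (rule nn_integral_polar) measurable
  finally show "emeasure (distr ?P borel ?T) A = emeasure lborel A" by simp
qed simp

lemma integral_polar:
  fixes F :: "'a::euclidean_space \<Rightarrow> complex"
  assumes F: "integrable lborel F"
  shows "(\<integral>x. F x \<partial>lborel) = (\<integral>\<omega>. (\<integral>r. F (r *\<^sub>R \<omega>) \<partial>radial_measure DIM('a)) \<partial>sphere_measure)"
proof -
  interpret pair_sigma_finite "sphere_measure :: 'a measure" "radial_measure DIM('a)" by (rule pair_sigma_finite_polar)
  let ?P = "sphere_measure \<Otimes>\<^sub>M radial_measure DIM('a)" and ?T = "\<lambda>(\<omega>::'a, r). r *\<^sub>R \<omega>"
  have m: "F \<in> borel_measurable borel" using F by simp
  have "integrable (distr ?P borel ?T) F" unfolding lborel_polar by (rule F)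
  then have i: "integrable ?P (\<lambda>z. F (?T z))" by (rule integrable_distr[OF measurable_polar_map])
  have "(\<integral>x. F x \<partial>lborel) = (\<integral>x. F x \<partial>distr ?P borel ?T)" unfolding lborel_polar ..
  also have "\<dots> = (\<integral>z. F (?T z) \<partial>?P)" by (rule integral_distr[OF measurable_polar_map m])
  also have "\<dots> = (\<integral>\<omega>. (\<integral>r. F (?T (\<omega>, r)) \<partial>radial_measure DIM('a)) \<partial>sphere_measure)"
    by (rule integral_fst'[OF i, symmetric])
  finally show ?thesis by simp
qed

lemma nn_integral_polar_radial:
  fixes F :: "'a::euclidean_space \<Rightarrow> ennreal"
  assumes F[measurable]: "F \<in> borel_measurable borel"
  shows "(\<integral>\<^sup>+\<omega>. \<integral>\<^sup>+r. F (r *\<^sub>R \<omega>) \<partial>radial_measure DIM('a) \<partial>sphere_measure) = (\<integral>\<^sup>+x. F x \<partial>lborel)"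
  unfolding nn_integral_polar[OF F, symmetric] by (intro nn_integral_cong nn_integral_radial) measurable

text \<open>The surface integral is compared with a volume integral by thickening: for 1 \<le> r
  \<le> 1 + s the Gaussian of width \<open>sqrt 2 * s\<close> at \<open>r *\<^sub>R \<omega>\<close>
  dominates exp (-1/2) times the one of width s at \<omega>. The volume integral is of order
  \<open>s ^ DIM('a)\<close>, and division by the thickness s gives the order of the surface
  integral.\<close>

lemma sphere_gaussian_bound:
  fixes y :: "'a::euclidean_space"
  assumes y: "norm y = 1" and s: "0 < s" "s \<le> 1"
  shows "(\<integral>\<^sup>+z. ennreal (exp (- (norm (y - z) / s)\<^sup>2 / 2)) \<partial>sphere_measure)
    \<le> ennreal ((sqrt (2 * pi) * (sqrt 2 * s)) ^ DIM('a) * exp (1/2) / s)"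
proof -
  define G where "G z = ennreal (exp (- (norm (y - z) / s)\<^sup>2 / 2))" for z :: 'a
  define F where "F x = ennreal (exp (- (1 / (sqrt 2 * s) * norm (x - y))\<^sup>2 / 2))" for x :: 'a
  have [measurable]: "G \<in> borel_measurable borel" "F \<in> borel_measurable borel"
    unfolding G_def[abs_def] F_def[abs_def] by measurable
  let ?K = "(sqrt (2 * pi) * (sqrt 2 * s)) ^ DIM('a)"
  have pt: "ennreal (s * exp (- (1/2))) * G \<omega> \<le> (\<integral>\<^sup>+r. F (r *\<^sub>R \<omega>) \<partial>radial_measure DIM('a))" if \<omega>: "norm \<omega> = 1" for \<omega>
  proof -
    have le: "ennreal (exp (- (1/2))) * G \<omega> \<le> F (r *\<^sub>R \<omega>)" if r: "1 \<le> r" "r \<le> 1 + s" for r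
    proof -
      have "norm (r *\<^sub>R \<omega> - y) \<le> norm (y - \<omega>) + norm ((r - 1) *\<^sub>R \<omega>)"
        using norm_triangle_ineq[of "\<omega> - y" "(r - 1) *\<^sub>R \<omega>"] by (simp add: algebra_simps norm_minus_commute)
      also have "norm ((r - 1) *\<^sub>R \<omega>) \<le> s" using r \<omega> by simp
      finally have "(norm (r *\<^sub>R \<omega> - y))\<^sup>2 \<le> (norm (y - \<omega>) + s)\<^sup>2" by (intro power_mono) auto
      \<comment> \<open>The enlarged width in \<open>F\<close> compensates for this factor
        2.\<close>
      also have "\<dots> \<le> 2 * (norm (y - \<omega>))\<^sup>2 + 2 * s\<^sup>2"
        using sum_squares_bound[of "norm (y - \<omega>)" s] by (simp add: power2_sum)
      finally have "(norm (r *\<^sub>R \<omega> - y))\<^sup>2 / (4 * s\<^sup>2) \<le> (2 * (norm (y - \<omega>))\<^sup>2 + 2 * s\<^sup>2) / (4 * s\<^sup>2)"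
        by (intro divide_right_mono) auto
      then have "(1 / (sqrt 2 * s) * norm (r *\<^sub>R \<omega> - y))\<^sup>2 / 2 \<le> (norm (y - \<omega>) / s)\<^sup>2 / 2 + 1/2"
        using s by (simp add: power_divide power_mult_distrib add_divide_distrib)
      then have "exp (- (1/2)) * exp (- (norm (y - \<omega>) / s)\<^sup>2 / 2) \<le> exp (- (1 / (sqrt 2 * s) * norm (r *\<^sub>R \<omega> - y))\<^sup>2 / 2)"
        unfolding exp_add[symmetric] by simp
      then show ?thesis unfolding F_def G_def by (subst ennreal_mult[symmetric]) (auto intro!: ennreal_leI)
    qed
    have "ennreal (s * exp (- (1/2))) * G \<omega> = (ennreal (exp (- (1/2))) * G \<omega>) * ennreal s"
      using s by (simp add: ennreal_mult mult_ac)
    also have "\<dots> = (\<integral>\<^sup>+r. (ennreal (exp (- (1/2))) * G \<omega>) * indicator {1..1 + s} r \<partial>lborel)"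
      using s by (subst nn_integral_cmult_indicator) auto
    also have "\<dots> \<le> (\<integral>\<^sup>+r. F (r *\<^sub>R \<omega>) * ennreal (r ^ (DIM('a) - 1)) * indicator {0<..} r \<partial>lborel)"
    proof (rule nn_integral_mono)
      fix r :: real
      show "(ennreal (exp (- (1/2))) * G \<omega>) * indicator {1..1 + s} r \<le> F (r *\<^sub>R \<omega>) * ennreal (r ^ (DIM('a) - 1)) * indicator {0<..} r"
      proof (cases "r \<in> {1..1 + s}")
        case True
        then have "1 \<le> ennreal (r ^ (DIM('a) - 1))" by (simp add: one_le_power)
        then have "ennreal (exp (- (1/2))) * G \<omega> * 1 \<le> F (r *\<^sub>R \<omega>) * ennreal (r ^ (DIM('a) - 1))"
          using True by (intro mult_mono le) auto
        then show ?thesis using True by simp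
      qed simp
    qed
    also have "\<dots> = (\<integral>\<^sup>+r. F (r *\<^sub>R \<omega>) \<partial>radial_measure DIM('a))"
      by (rule nn_integral_radial[symmetric]) measurable
    finally show ?thesis .
  qed
  have "ennreal (s * exp (- (1/2))) * (\<integral>\<^sup>+z. G z \<partial>sphere_measure) = (\<integral>\<^sup>+z. ennreal (s * exp (- (1/2))) * G z \<partial>sphere_measure)"
    by (rule nn_integral_cmult[symmetric]) (rule borel_measurable_sphere, measurable)
  also have "\<dots> \<le> (\<integral>\<^sup>+\<omega>. \<integral>\<^sup>+r. F (r *\<^sub>R \<omega>) \<partial>radial_measure DIM('a) \<partial>sphere_measure)"
    by (intro nn_integral_mono pt) (simp add: space_sphere_measure)
  also have "\<dots> = (\<integral>\<^sup>+x. F x \<partial>lborel)" by (rule nn_integral_polar_radial) measurable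
  also have "\<dots> = ennreal ?K"
    unfolding F_def using s by (subst gaussian_nn_integral(1)) auto
  finally have "ennreal (exp (1/2) / s) * (ennreal (s * exp (- (1/2))) * (\<integral>\<^sup>+z. G z \<partial>sphere_measure)) \<le> ennreal (exp (1/2) / s) * ennreal ?K"
    by (rule mult_left_mono) simp
  moreover have "ennreal (exp (1/2) / s) * ennreal (s * exp (- (1/2))) = 1"
    using s by (subst ennreal_mult[symmetric]) (auto simp: exp_minus)
  ultimately have "(\<integral>\<^sup>+z. G z \<partial>sphere_measure) \<le> ennreal (exp (1/2) / s) * ennreal ?K"
    by (simp only: mult.assoc[symmetric] mult_1)
  also have "\<dots> = ennreal (?K * exp (1/2) / s)"
    using s by (subst ennreal_mult[symmetric]) (auto simp: mult.commute)
  finally show ?thesis unfolding G_def .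
qed

lemma L2_sphere_iff: "\<Phi> \<in> L2_sphere \<longleftrightarrow> \<Phi> \<in> L2 sphere_measure"
  by (simp add: L2_sphere_def L2_def)

lemma L2_finite_integrable:
  assumes "finite_measure M" "\<Phi> \<in> L2 M" shows "integrable M \<Phi>"
proof -
  interpret finite_measure M by fact
  have "(\<lambda>x. 1) \<in> L2 M" by (simp add: L2_def)
  from L2_mult_integrable[OF assms(2) this] show ?thesis by simp
qed

text \<open>General in M, since it is applied both to the surface measure and to Lebesgue
  measure.\<close>

lemma continuous_fourier_measure:
  fixes \<Phi> :: "'a::euclidean_space \<Rightarrow> complex"
  assumes i: "integrable M \<Phi>" and id: "(\<lambda>\<xi>. \<xi>) \<in> borel_measurable M"
  shows "continuous_on UNIV (\<lambda>x. \<integral>\<xi>. \<Phi> \<xi> * exp (- \<i> * of_real (x \<bullet> \<xi>)) \<partial>M)"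
  unfolding continuous_on_sequentially
proof (intro allI ballI impI, elim conjE)
  note [measurable] = id borel_measurable_integrable[OF i]
  have m: "(\<lambda>\<xi>. x \<bullet> \<xi>) \<in> borel_measurable M" for x
    by (intro borel_measurable_inner borel_measurable_const id)
  fix X :: "nat \<Rightarrow> 'a" and x assume X: "X \<longlonglongrightarrow> x"
  show "((\<lambda>x. \<integral>\<xi>. \<Phi> \<xi> * exp (- \<i> * of_real (x \<bullet> \<xi>)) \<partial>M) \<circ> X) \<longlonglongrightarrow> (\<integral>\<xi>. \<Phi> \<xi> * exp (- \<i> * of_real (x \<bullet> \<xi>)) \<partial>M)"
    unfolding comp_def
  proof (rule integral_dominated_convergence[where w="\<lambda>\<xi>. norm (\<Phi> \<xi>)"])
    show "AE \<xi> in M. (\<lambda>n. \<Phi> \<xi> * exp (- \<i> * of_real (X n \<bullet> \<xi>))) \<longlonglongrightarrow> \<Phi> \<xi> * exp (- \<i> * of_real (x \<bullet> \<xi>))"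
      by (intro AE_I2 tendsto_intros X)
    show "(\<lambda>\<xi>. \<Phi> \<xi> * exp (- \<i> * of_real (x \<bullet> \<xi>))) \<in> borel_measurable M"
      "(\<lambda>\<xi>. \<Phi> \<xi> * exp (- \<i> * of_real (X n \<bullet> \<xi>))) \<in> borel_measurable M" for n
      using m[measurable] by measurable
  qed (use i in \<open>auto simp: norm_mult\<close>)
qed

text \<open>With s = 1/R the Gaussian weight is at least exp (-1/2) on the ball. In
  \<open>gaussian_schur\<close> the factor \<open>(1 / s) ^ DIM('a)\<close> meets a row bound of
  order \<open>s ^ (DIM('a) - 1)\<close>, which leaves 1/s = R. Of the constant exp 1, one factor
  exp (1/2) comes from the weight and one from \<open>sphere_gaussian_bound\<close>.\<close>

lemma herglotz_growth:
  fixes \<Phi> :: "'a::euclidean_space \<Rightarrow> complex"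
  assumes \<Phi>: "\<Phi> \<in> L2 sphere_measure" and R: "R > 1"
  defines "w \<equiv> \<lambda>x. \<integral>\<xi>. \<Phi> \<xi> * exp (- \<i> * of_real (x \<bullet> \<xi>)) \<partial>sphere_measure"
  shows "(\<integral>\<^sup>+x\<in>ball 0 R. ennreal ((norm (w x))\<^sup>2) \<partial>lborel)
    \<le> ennreal (exp 1 * (sqrt (2 * pi) * (sqrt (2 * pi) * sqrt 2)) ^ DIM('a) * sq_norm sphere_measure \<Phi> * R)"
proof -
  define s where "s = 1 / R"
  have s: "0 < s" "s \<le> 1" using R by (auto simp: s_def)
  note i = L2_finite_integrable[OF finite_measure_sphere \<Phi>]
  define C where "C = (sqrt (2 * pi) * (sqrt 2 * s)) ^ DIM('a) * exp (1/2) / s"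
  have C0: "C \<ge> 0" using s by (simp add: C_def)
  have wm[measurable]: "w \<in> borel_measurable borel"
    unfolding w_def by (intro borel_measurable_continuous_onI continuous_fourier_measure i measurable_id_sphere)
  have "(\<integral>\<^sup>+x\<in>ball 0 R. ennreal ((norm (w x))\<^sup>2) \<partial>lborel)
      \<le> (\<integral>\<^sup>+x. ennreal (exp (1/2)) * ennreal (exp (- (s * norm x)\<^sup>2 / 2) * (norm (w x))\<^sup>2) \<partial>lborel)"
  proof (rule nn_integral_mono)
    fix x :: 'a
    show "ennreal ((norm (w x))\<^sup>2) * indicator (ball 0 R) x \<le> ennreal (exp (1/2)) * ennreal (exp (- (s * norm x)\<^sup>2 / 2) * (norm (w x))\<^sup>2)"
    proof (cases "x \<in> ball 0 R")
      case True
      then have "s * norm x \<le> 1" using R by (simp add: s_def)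
      then have "(s * norm x)\<^sup>2 \<le> 1" using s by (simp add: power_le_one)
      then have "1 \<le> exp (1/2) * exp (- (s * norm x)\<^sup>2 / 2)" unfolding exp_add[symmetric] by simp
      then have "1 * (norm (w x))\<^sup>2 \<le> exp (1/2) * exp (- (s * norm x)\<^sup>2 / 2) * (norm (w x))\<^sup>2" by (rule mult_right_mono) simp
      then have "ennreal ((norm (w x))\<^sup>2) \<le> ennreal (exp (1/2) * (exp (- (s * norm x)\<^sup>2 / 2) * (norm (w x))\<^sup>2))"
        by (intro ennreal_leI) (simp only: mult_1 mult.assoc)
      then show ?thesis using True by (simp only: ennreal_mult' exp_ge_zero) simp
    qed simp
  qed
  also have "\<dots> = ennreal (exp (1/2)) * (\<integral>\<^sup>+x. ennreal (exp (- (s * norm x)\<^sup>2 / 2) * (norm (w x))\<^sup>2) \<partial>lborel)"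
    by (rule nn_integral_cmult) measurable
  also have "\<dots> \<le> ennreal (exp (1/2)) * ennreal ((sqrt (2 * pi) / s) ^ DIM('a) * C * sq_norm sphere_measure \<Phi>)"
    unfolding w_def sq_norm_def
  proof (intro mult_left_mono gaussian_schur[where p="\<lambda>y. y"] sigma_finite_sphere measurable_id_sphere i s C0)
    show "integrable sphere_measure (\<lambda>y. (norm (\<Phi> y))\<^sup>2)" using \<Phi> by (simp add: L2_def)
    fix y :: 'a assume "y \<in> space sphere_measure"
    then show "(\<integral>\<^sup>+z. ennreal (exp (- (norm (y - z) / s)\<^sup>2 / 2)) \<partial>sphere_measure) \<le> ennreal C"
      unfolding C_def by (intro sphere_gaussian_bound s) (simp add: space_sphere_measure)
  qed simp
  also have "\<dots> = ennreal (exp (1/2) * ((sqrt (2 * pi) / s) ^ DIM('a) * C * sq_norm sphere_measure \<Phi>))"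
    using s C0 by (intro ennreal_mult[symmetric] mult_nonneg_nonneg zero_le_power sq_norm_nonneg) auto
  also have "exp (1/2) * ((sqrt (2 * pi) / s) ^ DIM('a) * C * sq_norm sphere_measure \<Phi>)
    = exp 1 * (sqrt (2 * pi) * (sqrt (2 * pi) * sqrt 2)) ^ DIM('a) * sq_norm sphere_measure \<Phi> * R"
  proof -
    have "(sqrt (2 * pi) / s) ^ DIM('a) * (sqrt (2 * pi) * (sqrt 2 * s)) ^ DIM('a) = (sqrt (2 * pi) * (sqrt (2 * pi) * sqrt 2)) ^ DIM('a)"
      unfolding power_mult_distrib[symmetric]
      by (rule arg_cong[where f="\<lambda>x. x ^ DIM('a)"]) (use s in simp)
    moreover have "exp (1/2) * exp (1/2) = exp (1::real)" unfolding exp_add[symmetric] by simp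
    moreover have "exp (1/2) * ((sqrt (2 * pi) / s) ^ DIM('a) * C * sq_norm sphere_measure \<Phi>)
      = (exp (1/2) * exp (1/2)) * ((sqrt (2 * pi) / s) ^ DIM('a) * (sqrt (2 * pi) * (sqrt 2 * s)) ^ DIM('a)) * sq_norm sphere_measure \<Phi> * (1 / s)"
      unfolding C_def by (simp only: times_divide_eq_right times_divide_eq_left mult_ac mult_1)
    ultimately show ?thesis by (simp only:) (simp add: s_def)
  qed
  finally show ?thesis .
qed

lemma herglotz_B_star:
  fixes w :: "'a::euclidean_space \<Rightarrow> complex"
  assumes U: "U \<in> tempered_distributions" and \<Phi>: "\<Phi> \<in> L2 sphere_measure" and c: "continuous_on UNIV w"
    and w: "is_function U w" "\<And>x. w x = (\<integral>\<xi>. \<Phi> \<xi> * exp (- \<i> * of_real (x \<bullet> \<xi>)) \<partial>sphere_measure)"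
  shows "U \<in> B_star"
proof -
  let ?C = "exp 1 * (sqrt (2 * pi) * (sqrt (2 * pi) * sqrt 2)) ^ DIM('a) * sq_norm sphere_measure \<Phi>"
  have C0: "0 \<le> ?C" by (intro mult_nonneg_nonneg zero_le_power sq_norm_nonneg) auto
  have "B_star_norm_sq w \<le> ennreal ?C"
    unfolding B_star_norm_sq_def
  proof (rule SUP_least)
    fix R :: real assume "R \<in> {1<..}"
    then have R: "R > 1" by simp
    have "ennreal (1 / R) * (\<integral>\<^sup>+x\<in>ball 0 R. ennreal ((norm (w x))\<^sup>2) \<partial>lborel) \<le> ennreal (1 / R) * ennreal (?C * R)"
      unfolding w(2) by (intro mult_left_mono herglotz_growth \<Phi> R) simp
    also have "\<dots> = ennreal ?C"
      using R C0 by (subst ennreal_mult[symmetric]) auto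
    finally show "ennreal (1 / R) * (\<integral>\<^sup>+x\<in>ball 0 R. ennreal ((norm (w x))\<^sup>2) \<partial>lborel) \<le> ennreal ?C" .
  qed
  then have "B_star_norm_sq w < \<infinity>" by (rule le_less_trans) simp
  moreover have "set_integrable lborel K (\<lambda>x. (norm (w x))\<^sup>2)" if "compact K" for K
    unfolding set_integrable_def using that
    by (intro borel_integrable_compact continuous_intros continuous_on_subset[OF c]) auto
  moreover have "w \<in> borel_measurable lborel" using c by (simp add: borel_measurable_continuous_onI)
  ultimately show ?thesis unfolding B_star_def using U w(1) by blast
qed

section \<open>Solutions have Fourier transform supported on the unit sphere\<close>

text \<open>Lets smoothness, decay and inversion be proved for \<open>fourier\<close> only.\<close>

lemma inverse_fourier_test:
  fixes \<psi> :: "'a::euclidean_space \<Rightarrow> complex"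
  assumes \<psi>: "\<psi> \<in> test_functions"
  shows "inverse_fourier \<psi> = fourier (\<lambda>y. inverse (of_real ((2 * pi) ^ DIM('a))) * \<psi> (- y))"
proof
  fix x :: 'a
  let ?c = "inverse (complex_of_real ((2 * pi) ^ DIM('a)))"
  have i: "integrable lborel (\<lambda>\<xi>. \<psi> \<xi> * exp (\<i> * of_real (x \<bullet> \<xi>)))"
    using fourier_integrand_integrable[OF test_functions_integrable[OF \<psi>], of "- x"] by (simp add: inner_commute)
  have "(\<integral>\<xi>. \<psi> \<xi> * exp (\<i> * of_real (x \<bullet> \<xi>)) \<partial>lborel) = (\<integral>y. \<psi> (- y) * exp (- \<i> * of_real (y \<bullet> x)) \<partial>lborel)"
    using lborel_integral_affine[OF i, of "- 1" 0] by (simp add: inner_commute)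
  then have "inverse_fourier \<psi> x = ?c * (\<integral>y. \<psi> (- y) * exp (- \<i> * of_real (y \<bullet> x)) \<partial>lborel)"
    unfolding inverse_fourier_def by (simp add: divide_inverse mult.commute)
  also have "\<dots> = fourier (\<lambda>y. ?c * \<psi> (- y)) x"
    unfolding fourier_def mult.assoc by (rule integral_mult_right_zero[symmetric])
  finally show "inverse_fourier \<psi> x = fourier (\<lambda>y. ?c * \<psi> (- y)) x" .
qed

lemma test_functions_reflect:
  assumes "\<psi> \<in> test_functions" shows "(\<lambda>y. c * \<psi> (- y)) \<in> test_functions"
  using test_functions_cmult[OF test_functions_affine[OF assms, of "- 1" 0]] by simp

lemma fourier_inversion_test:
  fixes \<phi> :: "'a::euclidean_space \<Rightarrow> complex"
  assumes \<phi>: "\<phi> \<in> test_functions"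
  shows "(\<integral>\<xi>. fourier \<phi> \<xi> * exp (\<i> * of_real (x \<bullet> \<xi>)) \<partial>lborel) = of_real ((2 * pi) ^ DIM('a)) * \<phi> x"
proof -
  obtain B where "\<And>x. norm (\<phi> x) \<le> B" using test_functions_bounded[OF \<phi>] by metis
  then show ?thesis
    by (intro fourier_inversion[of \<phi> B] test_functions_continuous test_functions_integrable \<phi>
        schwartz_integrable fourier_schwartz)
qed

lemma two_pi_power_nonzero: "complex_of_real ((2 * pi) ^ n) \<noteq> 0"
  by simp

lemma fourier_inverse_fourier:
  fixes \<psi> :: "'a::euclidean_space \<Rightarrow> complex"
  assumes \<psi>: "\<psi> \<in> test_functions" shows "fourier (inverse_fourier \<psi>) = \<psi>"
proof
  fix \<xi> :: 'a
  let ?c = "inverse (complex_of_real ((2 * pi) ^ DIM('a)))"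
  let ?\<psi> = "\<lambda>y. ?c * \<psi> (- y)"
  have "fourier (inverse_fourier \<psi>) \<xi> = (\<integral>x. fourier ?\<psi> x * exp (\<i> * of_real ((- \<xi>) \<bullet> x)) \<partial>lborel)"
    unfolding inverse_fourier_test[OF \<psi>] by (subst fourier_def) (simp add: inner_commute)
  also have "\<dots> = of_real ((2 * pi) ^ DIM('a)) * ?\<psi> (- \<xi>)"
    by (rule fourier_inversion_test[OF test_functions_reflect[OF \<psi>]])
  finally show "fourier (inverse_fourier \<psi>) \<xi> = \<psi> \<xi>"
    by (simp only: mult.assoc[symmetric] right_inverse[OF two_pi_power_nonzero] mult_1 minus_minus)
qed

lemma inverse_fourier_Z_space:
  assumes \<psi>: "\<psi> \<in> test_functions" and S: "open S" "0 \<in> S" "\<And>x. x \<in> S \<Longrightarrow> \<psi> x = 0"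
  shows "inverse_fourier \<psi> \<in> Z_space"
proof -
  have "inverse_fourier \<psi> \<in> schwartz"
    unfolding inverse_fourier_test[OF \<psi>] by (rule fourier_schwartz[OF test_functions_reflect[OF \<psi>]])
  moreover have "\<forall>bs\<in>lists Basis. partials bs (fourier (inverse_fourier \<psi>)) 0 = 0"
    unfolding fourier_inverse_fourier[OF \<psi>] by (intro ballI partials_eq_0[OF S(1) _ S(2)] S(3))
  ultimately show ?thesis unfolding Z_space_def by (intro CollectI conjI)
qed

lemma inverse_fourier_add:
  assumes "\<phi> \<in> test_functions" "\<psi> \<in> test_functions"
  shows "inverse_fourier (\<lambda>x. \<phi> x + c * \<psi> x) = (\<lambda>x. inverse_fourier \<phi> x + c * inverse_fourier \<psi> x)"
proof
  fix x
  have i: "integrable lborel (\<lambda>\<xi>. \<phi> \<xi> * exp (\<i> * of_real (x \<bullet> \<xi>)))" if "\<phi> \<in> test_functions" for \<phi> :: "'a \<Rightarrow> complex"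
    using fourier_integrand_integrable[OF test_functions_integrable[OF that], of "- x"] by (simp add: inner_commute)
  have "(\<integral>\<xi>. (\<phi> \<xi> + c * \<psi> \<xi>) * exp (\<i> * of_real (x \<bullet> \<xi>)) \<partial>lborel)
      = (\<integral>\<xi>. \<phi> \<xi> * exp (\<i> * of_real (x \<bullet> \<xi>)) + c * (\<psi> \<xi> * exp (\<i> * of_real (x \<bullet> \<xi>))) \<partial>lborel)"
    by (simp add: ring_distribs mult.assoc)
  also have "\<dots> = (\<integral>\<xi>. \<phi> \<xi> * exp (\<i> * of_real (x \<bullet> \<xi>)) \<partial>lborel) + c * (\<integral>\<xi>. \<psi> \<xi> * exp (\<i> * of_real (x \<bullet> \<xi>)) \<partial>lborel)"
    using i[OF assms(1)] i[OF assms(2)] by simp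
  finally show "inverse_fourier (\<lambda>x. \<phi> x + c * \<psi> x) x = inverse_fourier \<phi> x + c * inverse_fourier \<psi> x"
    unfolding inverse_fourier_def by (simp add: add_divide_distrib)
qed

text \<open>The equation applied to the inverse transform of the quotient is the claim. The set K
  must avoid the sphere, where the divisor vanishes, and the origin, where f(|\<xi>|^2) need not be
  smooth and where membership in \<open>Z_space\<close> demands flatness.\<close>

lemma solution_inverse_fourier_eq_0:
  fixes u U :: "('a::euclidean_space \<Rightarrow> complex) \<Rightarrow> complex"
  assumes f: "bernstein f" "\<not> f constant_on {0<..}" and u: "u \<in> solution_space f" "identified_with u U"
    and \<phi>: "\<phi> \<in> test_functions" and K: "closed K" "\<And>x. x \<notin> K \<Longrightarrow> \<phi> x = 0" "\<And>x. x \<in> K \<Longrightarrow> x \<noteq> 0 \<and> norm x \<noteq> 1"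
  shows "U (inverse_fourier \<phi>) = 0"
proof -
  obtain a b \<mu> where "bernstein_triple f a b \<mu>" using f(1) by (auto simp: bernstein_def)
  then interpret bernstein_rep f a b \<mu> by unfold_locales
  define q where "q \<xi> = complex_of_real (f ((norm \<xi>)\<^sup>2)) + (- of_real (f 1))" for \<xi> :: 'a
  define \<psi> where "\<psi> \<xi> = \<phi> \<xi> * inverse (q \<xi>)" for \<xi>
  let ?S = "{\<xi>::'a. \<xi> \<noteq> 0 \<and> norm \<xi> \<noteq> 1}"
  have S: "open ?S" by (intro open_Collect_conj open_Collect_neq continuous_intros)
  have q0: "q \<xi> \<noteq> 0" if "\<xi> \<in> ?S" for \<xi>
  proof -
    have "(norm \<xi>)\<^sup>2 \<noteq> 1" "0 < (norm \<xi>)\<^sup>2"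
      using that power2_eq_iff_nonneg[of "norm \<xi>" 1] by auto
    then have "f ((norm \<xi>)\<^sup>2) \<noteq> f 1"
      using strictly_increasing[OF f(2), of "(norm \<xi>)\<^sup>2" 1] strictly_increasing[OF f(2), of 1 "(norm \<xi>)\<^sup>2"]
      by (metis less_irrefl linorder_neqE zero_less_one)
    then show ?thesis by (simp add: q_def)
  qed
  have "smooth_on ?S (\<lambda>\<xi>. complex_of_real (f ((norm \<xi>)\<^sup>2)))"
    by (rule smooth_on_radial[where T="{0<..}" and \<F>=derivs, OF S _ _ derivs_closed]) (auto simp: derivs_def)
  then have "smooth_on ?S q" unfolding q_def[abs_def] by (intro smooth_on_add S smooth_on_const)
  then have "smooth_on ?S \<psi>"
    unfolding \<psi>_def[abs_def] using test_functions_smooth[OF \<phi>] q0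
    by (intro smooth_on_mult smooth_on_inverse S) (auto simp: smooth_iff_smooth_on intro: smooth_on_subset)
  \<comment> \<open>The quotient is smooth off the sphere and the origin, and it is zero off K;
    these two open sets cover the space.\<close>
  moreover have "smooth_on (- K) \<psi>"
    by (rule smooth_on_cong[OF _ _ smooth_on_const[of _ 0]]) (use K(1,2) in \<open>auto simp: \<psi>_def\<close>)
  ultimately have "smooth_on (?S \<union> - K) \<psi>" by (rule smooth_on_Un)
  moreover have "?S \<union> - K = UNIV" using K(3) by auto
  ultimately have "smooth \<psi>" by (simp add: smooth_iff_smooth_on)
  moreover obtain R where "\<And>x. norm x > R \<Longrightarrow> \<phi> x = 0" using \<phi> by (auto simp: test_functions_iff)
  ultimately have \<psi>: "\<psi> \<in> test_functions" unfolding test_functions_iff \<psi>_def by (auto intro!: exI[of _ R])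
  have "0 \<notin> K" using K(3) by blast
  have Z0: "inverse_fourier h \<in> Z_space" if "h \<in> test_functions" "\<And>x. x \<notin> K \<Longrightarrow> h x = 0" for h
    by (rule inverse_fourier_Z_space[OF that(1) open_Compl[OF K(1)]]) (use that(2) \<open>0 \<notin> K\<close> in auto)
  have \<psi>0: "\<psi> x = 0" if "x \<notin> K" for x using K(2)[OF that] by (simp add: \<psi>_def)
  have Z: "inverse_fourier \<phi> \<in> Z_space" "inverse_fourier \<psi> \<in> Z_space" "inverse_fourier (\<lambda>x. of_real (f 1) * \<psi> x) \<in> Z_space"
    by (rule Z0[OF \<phi> K(2)] Z0[OF \<psi> \<psi>0] Z0[OF test_functions_cmult[OF \<psi>]]; simp add: \<psi>0)+
  have split: "of_real (f ((norm \<xi>)\<^sup>2)) * \<psi> \<xi> = \<phi> \<xi> + of_real (f 1) * \<psi> \<xi>" for \<xi>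
  proof (cases "\<xi> \<in> K")
    case True
    then have "q \<xi> \<noteq> 0" using K(3) q0 by blast
    then have "q \<xi> * \<psi> \<xi> = \<phi> \<xi>" by (simp add: \<psi>_def)
    then show ?thesis by (simp add: q_def algebra_simps)
  qed (simp add: \<psi>_def K(2))
  define P Q where "P = inverse_fourier \<phi>" and "Q = (\<lambda>x. of_real (f 1) * inverse_fourier \<psi> x)"
  have "inverse_fourier (\<lambda>x::'a. 0) = (\<lambda>x. 0)" by (simp add: inverse_fourier_def fun_eq_iff)
  then have Q: "inverse_fourier (\<lambda>x. of_real (f 1) * \<psi> x) = Q"
    using inverse_fourier_add[OF test_functions_cmult[OF \<psi>, of 0] \<psi>, of "of_real (f 1)"]
    by (simp only: mult_zero_left add_0_left Q_def)
  have PQ: "P \<in> Z_space" "Q \<in> Z_space" using Z unfolding P_def Q by auto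
  have "f_minus_Laplacian f (inverse_fourier \<psi>) = inverse_fourier (\<lambda>\<xi>. \<phi> \<xi> + of_real (f 1) * \<psi> \<xi>)"
    unfolding f_minus_Laplacian_def fourier_inverse_fourier[OF \<psi>] split ..
  also have "\<dots> = (\<lambda>x. P x + Q x)"
    unfolding P_def Q_def by (rule inverse_fourier_add[OF \<phi> \<psi>])
  finally have fm: "f_minus_Laplacian f (inverse_fourier \<psi>) = (\<lambda>x. P x + Q x)" .
  have "u (f_minus_Laplacian f (inverse_fourier \<psi>)) = u (\<lambda>x. of_real (f 1) * inverse_fourier \<psi> x)"
    using u(1) Z(2) unfolding solution_space_def by blast
  then have "u (\<lambda>x. P x + Q x) = u Q" unfolding fm by (simp only: Q_def)
  moreover have "u (\<lambda>x. P x + Q x) = u P + u Q"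
    using u(1) PQ unfolding solution_space_def Z_dual_def linear_functional_on_def by blast
  ultimately have "u P = 0" by simp
  moreover have "U P = u P" using u(2) PQ(1) by (auto simp: identified_with_def)
  ultimately show ?thesis by (simp add: P_def)
qed

text \<open>A small closed ball that misses the sphere either contains the origin, and then lies in
  the set W given by the support condition, or avoids both, and then
  \<open>solution_inverse_fourier_eq_0\<close> applies.\<close>

lemma solution_fourier_eq_0:
  fixes u U :: "('a::euclidean_space \<Rightarrow> complex) \<Rightarrow> complex"
  assumes f: "bernstein f" "\<not> f constant_on {0<..}" and u: "u \<in> solution_space f" "identified_with u U"
  obtains \<delta> where "\<delta> > 0"
    "\<And>\<phi> c \<epsilon>. \<phi> \<in> test_functions \<Longrightarrow> 0 < \<epsilon> \<Longrightarrow> \<epsilon> < \<delta> \<Longrightarrow> (\<And>x. norm (x - c) > \<epsilon> \<Longrightarrow> \<phi> x = 0) \<Longrightarrow>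
      \<bar>norm c - 1\<bar> > \<epsilon> \<Longrightarrow> U (fourier \<phi>) = 0"
proof -
  have "0 \<notin> distribution_support (fourier_distribution U)" using u(2) by (simp add: identified_with_def)
  then obtain W where W: "open W" "0 \<in> W"
    "\<And>\<phi>. \<phi> \<in> test_functions \<Longrightarrow> closure {x. \<phi> x \<noteq> 0} \<subseteq> W \<Longrightarrow> U (fourier \<phi>) = 0"
    unfolding distribution_support_def fourier_distribution_def by auto
  obtain r where r: "r > 0" "ball 0 r \<subseteq> W" using W(1,2) openE by blast
  show ?thesis
  \<comment> \<open>Half of r, because a closed ball of radius \<epsilon> that contains the origin
    lies in \<open>cball 0 (2 * \<epsilon>)\<close>.\<close>
  proof (rule that[of "r / 2"])
    fix \<phi> :: "'a \<Rightarrow> complex" and c \<epsilon>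
    assume \<phi>: "\<phi> \<in> test_functions" and e: "0 < \<epsilon>" "\<epsilon> < r / 2" and sup: "\<And>x. norm (x - c) > \<epsilon> \<Longrightarrow> \<phi> x = 0"
      and c: "\<bar>norm c - 1\<bar> > \<epsilon>"
    show "U (fourier \<phi>) = 0"
    proof (cases "norm c \<le> \<epsilon>")
      case True
      have "{x. \<phi> x \<noteq> 0} \<subseteq> cball 0 (2 * \<epsilon>)"
      proof
        fix x assume "x \<in> {x. \<phi> x \<noteq> 0}"
        then have "norm (x - c) \<le> \<epsilon>" using sup[of x] by force
        then show "x \<in> cball 0 (2 * \<epsilon>)" using True norm_triangle_sub[of x c] by simp
      qed
      then have "closure {x. \<phi> x \<noteq> 0} \<subseteq> cball 0 (2 * \<epsilon>)" by (rule closure_minimal) simp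
      also have "\<dots> \<subseteq> ball 0 r" using e by auto
      also have "\<dots> \<subseteq> W" by (rule r)
      finally show ?thesis by (rule W(3)[OF \<phi>])
    next
      case False
      let ?k = "complex_of_real ((2 * pi) ^ DIM('a))"
      \<comment> \<open>Chosen so that its inverse transform is \<open>fourier \<phi>\<close>; the
        reflection moves the ball to -c, at the same distance from the origin and the
        sphere.\<close>
      let ?\<phi> = "\<lambda>y. ?k * \<phi> (- y)"
      have t: "?\<phi> \<in> test_functions" by (rule test_functions_reflect[OF \<phi>])
      have "U (inverse_fourier ?\<phi>) = 0"
      proof (rule solution_inverse_fourier_eq_0[OF f u t])
        show "closed (cball (- c) \<epsilon>)" by simp
        show "?\<phi> x = 0" if "x \<notin> cball (- c) \<epsilon>" for x
          using that sup[of "- x"] norm_minus_cancel[of "x + c"] by (simp add: dist_norm norm_minus_commute add.commute)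
        show "x \<noteq> 0 \<and> norm x \<noteq> 1" if "x \<in> cball (- c) \<epsilon>" for x
        proof -
          have "norm (x + c) \<le> \<epsilon>" using that by (simp add: dist_norm norm_minus_commute add.commute)
          moreover have "\<bar>norm x - norm c\<bar> \<le> norm (x + c)" using norm_triangle_ineq3[of x "- c"] by simp
          ultimately have "\<bar>norm x - norm c\<bar> \<le> \<epsilon>" by linarith
          then show ?thesis using False c by auto
        qed
      qed
      moreover have "inverse_fourier ?\<phi> = fourier \<phi>"
        unfolding inverse_fourier_test[OF t]
        by (simp only: mult.assoc[symmetric] left_inverse[OF two_pi_power_nonzero] mult_1 minus_minus)
      ultimately show ?thesis by simp
    qed
  qed (use r in simp)
qed

section \<open>Solutions in \<open>B\<^sup>*\<close> are Herglotz waves\<close>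

lemma schwartz_lipschitz:
  fixes \<phi> :: "'a::euclidean_space \<Rightarrow> complex"
  assumes "\<phi> \<in> schwartz" obtains L where "L \<ge> 0" "\<And>x y. norm (\<phi> x - \<phi> y) \<le> L * norm (x - y)"
proof (rule smooth_lipschitz[OF schwartz_smooth[OF assms]])
  fix b :: 'a assume "b \<in> Basis"
  then have "partials [b] \<phi> \<in> schwartz" by (rule schwartz_partial[OF assms])
  from schwartz_bound[OF this, of "[]" 0] show "\<exists>B. \<forall>x. norm (partials [b] \<phi> x) \<le> B" by auto
qed (rule that)

text \<open>The counterpart of \<open>weighted_growth\<close> at scale 1/2: with the weight moved
  from g to \<phi>, both factors of g \<phi> are square integrable.\<close>

lemma schwartz_weighted_L2:
  fixes \<phi> :: "'a::euclidean_space \<Rightarrow> complex"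
  assumes \<phi>: "\<phi> \<in> schwartz" shows "(\<lambda>x. of_real (1 + 1/2 * norm x) * \<phi> x) \<in> L2 lborel"
proof -
  have [measurable]: "\<phi> \<in> borel_measurable borel"
    using smooth_continuous[OF schwartz_smooth[OF \<phi>]] by (rule borel_measurable_continuous_onI)
  \<comment> \<open>Two powers cover the squared weight and \<open>Suc DIM('a)\<close> the
    integrability at infinity; the second factor |\<phi>| of the square need only be
    bounded.\<close>
  obtain C where C: "C \<ge> 0" "\<And>x. (1 + norm x) ^ (Suc DIM('a) + 2) * norm (\<phi> x) \<le> C"
    using schwartz_bound[OF \<phi>, of "[]" "Suc DIM('a) + 2"] by (metis lists.Nil partials.simps(1))
  obtain B where B: "B \<ge> 0" "\<And>x. norm (\<phi> x) \<le> B"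
    using schwartz_bound[OF \<phi>, of "[]" 0] by (metis lists.Nil mult_1 partials.simps(1) power_0)
  have "integrable lborel (\<lambda>x. (norm (of_real (1 + 1/2 * norm x) * \<phi> x))\<^sup>2)"
  proof (rule Bochner_Integration.integrable_bound)
    show "integrable lborel (\<lambda>x::'a. (C * B) * (1 / (1 + norm x) ^ Suc DIM('a)))"
      by (intro integrable_mult_right integrable_inverse_power)
    have le: "(norm (of_real (1 + 1/2 * norm x) * \<phi> x))\<^sup>2 \<le> (C * B) * (1 / (1 + norm x) ^ Suc DIM('a))" for x :: 'a
    proof -
      have p: "0 < (1 + norm x) ^ Suc DIM('a)" by (intro zero_less_power add_pos_nonneg) auto
      have "norm (of_real (1 + 1/2 * norm x) * \<phi> x) \<le> (1 + norm x) * norm (\<phi> x)"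
        unfolding norm_mult norm_of_real by (intro mult_right_mono) auto
      then have "(norm (of_real (1 + 1/2 * norm x) * \<phi> x))\<^sup>2 \<le> ((1 + norm x) * norm (\<phi> x))\<^sup>2"
        by (intro power_mono) auto
      then have "(1 + norm x) ^ Suc DIM('a) * (norm (of_real (1 + 1/2 * norm x) * \<phi> x))\<^sup>2
        \<le> (1 + norm x) ^ Suc DIM('a) * ((1 + norm x) * norm (\<phi> x))\<^sup>2" using p by (intro mult_left_mono) auto
      also have "\<dots> = ((1 + norm x) ^ (Suc DIM('a) + 2) * norm (\<phi> x)) * norm (\<phi> x)"
        unfolding power_add by (simp only: power2_eq_square mult_ac)
      also have "\<dots> \<le> C * B" by (intro mult_mono C B) auto
      finally show ?thesis using p by (simp add: pos_le_divide_eq mult.commute del: power_Suc)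
    qed
    show "AE x in lborel. norm ((norm (of_real (1 + 1/2 * norm x) * \<phi> x))\<^sup>2) \<le> norm ((C * B) * (1 / (1 + norm x) ^ Suc DIM('a)))"
      unfolding real_norm_def abs_power2 by (rule AE_I2) (rule order_trans[OF le abs_ge_self])
  qed measurable
  then show ?thesis by (simp add: L2_def)
qed

lemma L2_bounded_supportI:
  fixes F :: "'a::euclidean_space \<Rightarrow> complex"
  assumes [measurable]: "F \<in> borel_measurable borel" and B: "\<And>x. norm (F x) \<le> B" and R: "\<And>x. norm x > R \<Longrightarrow> F x = 0"
  shows "F \<in> L2 lborel" "integrable lborel F" "sq_norm lborel F \<le> B\<^sup>2 * measure lborel (cball (0::'a) R)"
proof -
  have i: "integrable lborel (\<lambda>x::'a. c * indicator (cball 0 R) x)" for c :: real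
    using emeasure_bounded_finite[of "cball 0 R :: 'a set"] by simp
  show "integrable lborel F"
    by (rule Bochner_Integration.integrable_bound[OF i[of B]])
      (use B R in \<open>auto simp: indicator_def not_le intro!: AE_I2 order_trans[OF B abs_ge_self]\<close>)
  have le: "(norm (F x))\<^sup>2 \<le> B\<^sup>2 * indicator (cball 0 R) x" for x
    using power_mono[OF B norm_ge_zero, of x 2] R[of x] by (auto simp: indicator_def not_le)
  have i2: "integrable lborel (\<lambda>x. (norm (F x))\<^sup>2)"
    by (rule Bochner_Integration.integrable_bound[OF i[of "B\<^sup>2"]]) (use le in \<open>auto intro!: AE_I2 order_trans[OF le abs_ge_self]\<close>)
  then show "F \<in> L2 lborel" by (simp add: L2_def)
  have "sq_norm lborel F \<le> (\<integral>x. B\<^sup>2 * indicator (cball (0::'a) R) x \<partial>lborel)"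
    unfolding sq_norm_def by (rule integral_mono[OF i2 i le])
  then show "sq_norm lborel F \<le> B\<^sup>2 * measure lborel (cball (0::'a) R)" by simp
qed

text \<open>The centre is -\<xi> so that translation becomes the phase exp (i \<xi> x), which makes
  \<open>k \<epsilon>\<close> an inverse transform of \<open>H \<epsilon>\<close> up to a
  constant.\<close>

lemma mollifier_fourier:
  fixes \<rho> :: "'a::euclidean_space \<Rightarrow> complex" and \<xi> :: 'a
  assumes \<rho>: "\<rho> \<in> test_functions" and e: "\<epsilon> > 0"
  defines "\<phi> \<equiv> \<lambda>\<eta>. of_real (inverse (\<epsilon> ^ DIM('a))) * \<rho> ((1 / \<epsilon>) *\<^sub>R \<eta> + (1 / \<epsilon>) *\<^sub>R \<xi>)"
  shows "\<phi> \<in> test_functions" "fourier \<phi> x = exp (\<i> * of_real (\<xi> \<bullet> x)) * fourier \<rho> (\<epsilon> *\<^sub>R x)"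
proof -
  show t: "\<phi> \<in> test_functions"
    unfolding \<phi>_def using e by (intro test_functions_cmult test_functions_affine \<rho>) simp
  have "fourier \<phi> x = (\<bar>\<epsilon>\<bar> ^ DIM('a)) *\<^sub>R (\<integral>z. \<phi> (- \<xi> + \<epsilon> *\<^sub>R z) * exp (- \<i> * of_real ((- \<xi> + \<epsilon> *\<^sub>R z) \<bullet> x)) \<partial>lborel)"
    unfolding fourier_def using e
    by (intro lborel_integral_affine fourier_integrand_integrable test_functions_integrable t) simp
  also have "(\<lambda>z. \<phi> (- \<xi> + \<epsilon> *\<^sub>R z) * exp (- \<i> * of_real ((- \<xi> + \<epsilon> *\<^sub>R z) \<bullet> x)))
    = (\<lambda>z. (of_real (inverse (\<epsilon> ^ DIM('a))) * exp (\<i> * of_real (\<xi> \<bullet> x))) * (\<rho> z * exp (- \<i> * of_real (z \<bullet> (\<epsilon> *\<^sub>R x)))))"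
  proof
    fix z
    have "(1 / \<epsilon>) *\<^sub>R (- \<xi> + \<epsilon> *\<^sub>R z) + (1 / \<epsilon>) *\<^sub>R \<xi> = z" using e by (simp add: algebra_simps)
    then have "\<phi> (- \<xi> + \<epsilon> *\<^sub>R z) = of_real (inverse (\<epsilon> ^ DIM('a))) * \<rho> z" by (simp only: \<phi>_def)
    moreover have "exp (- \<i> * of_real ((- \<xi> + \<epsilon> *\<^sub>R z) \<bullet> x)) = exp (\<i> * of_real (\<xi> \<bullet> x)) * exp (- \<i> * of_real (z \<bullet> (\<epsilon> *\<^sub>R x)))"
      by (simp add: inner_add_left inner_diff_left ring_distribs flip: exp_add)
    ultimately show "\<phi> (- \<xi> + \<epsilon> *\<^sub>R z) * exp (- \<i> * of_real ((- \<xi> + \<epsilon> *\<^sub>R z) \<bullet> x))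
      = (of_real (inverse (\<epsilon> ^ DIM('a))) * exp (\<i> * of_real (\<xi> \<bullet> x))) * (\<rho> z * exp (- \<i> * of_real (z \<bullet> (\<epsilon> *\<^sub>R x))))"
      by (simp only: mult_ac)
  qed
  also have "(\<integral>z. (of_real (inverse (\<epsilon> ^ DIM('a))) * exp (\<i> * of_real (\<xi> \<bullet> x))) * (\<rho> z * exp (- \<i> * of_real (z \<bullet> (\<epsilon> *\<^sub>R x)))) \<partial>lborel)
    = (of_real (inverse (\<epsilon> ^ DIM('a))) * exp (\<i> * of_real (\<xi> \<bullet> x))) * fourier \<rho> (\<epsilon> *\<^sub>R x)"
    unfolding fourier_def by (rule integral_mult_right_zero)
  finally show "fourier \<phi> x = exp (\<i> * of_real (\<xi> \<bullet> x)) * fourier \<rho> (\<epsilon> *\<^sub>R x)"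
    using e by (simp add: scaleR_conv_of_real)
qed

text \<open>What the converse keeps of its hypotheses: the growth of the density g on balls, which
  is the bound on \<open>B_star_norm_sq\<close> with R moved to the right, and the vanishing off the
  sphere at scales below \<delta>. The Bernstein function no longer occurs.\<close>

locale B_star_solution =
  fixes U :: "('a::euclidean_space \<Rightarrow> complex) \<Rightarrow> complex" and g \<rho> :: "'a \<Rightarrow> complex" and C \<delta> :: real
  assumes U: "U \<in> tempered_distributions" "is_function U g"
    and g[measurable]: "g \<in> borel_measurable borel"
    and C: "C \<ge> 0" "\<And>R. R > 1 \<Longrightarrow> (\<integral>\<^sup>+x\<in>ball 0 R. ennreal ((norm (g x))\<^sup>2) \<partial>lborel) \<le> ennreal (C * R)"
    and \<rho>: "\<rho> \<in> test_functions" "(\<integral>x. \<rho> x \<partial>lborel) = 1" "\<And>x. norm x \<ge> 1 \<Longrightarrow> \<rho> x = 0"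
    and \<delta>: "0 < \<delta>"
    and vanish: "\<And>\<phi> c \<epsilon>. \<phi> \<in> test_functions \<Longrightarrow> 0 < \<epsilon> \<Longrightarrow> \<epsilon> < \<delta> \<Longrightarrow> (\<And>x. norm (x - c) > \<epsilon> \<Longrightarrow> \<phi> x = 0) \<Longrightarrow>
      \<bar>norm c - 1\<bar> > \<epsilon> \<Longrightarrow> U (fourier \<phi>) = 0"
begin

lemma weighted_growth:
  assumes "0 < \<epsilon>" "\<epsilon> < 1"
  shows "(\<integral>\<^sup>+x. ennreal ((norm (g x))\<^sup>2) * ennreal (1 / (1 + \<epsilon> * norm x)\<^sup>2) \<partial>lborel) \<le> ennreal (C * 8 / \<epsilon>)"
  using dyadic_bound[of "\<lambda>x. ennreal ((norm (g x))\<^sup>2)" \<epsilon> C 1] assms C by (simp add: eval_nat_numeral)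

lemma integrable_schwartz:
  assumes \<phi>: "\<phi> \<in> schwartz" shows "integrable lborel (\<lambda>x. g x * \<phi> x)"
proof -
  \<comment> \<open>The scale 1/2 is a value below 1, as \<open>weighted_growth\<close>
    requires.\<close>
  define A where "A x = g x * of_real (1 / (1 + 1/2 * norm x))" for x
  have [measurable]: "A \<in> borel_measurable borel" unfolding A_def by measurable
  have "A \<in> L2 lborel"
  proof -
    have "(\<integral>\<^sup>+x. ennreal ((norm (A x))\<^sup>2) \<partial>lborel) = (\<integral>\<^sup>+x. ennreal ((norm (g x))\<^sup>2) * ennreal (1 / (1 + 1/2 * norm x)\<^sup>2) \<partial>lborel)"
      by (intro nn_integral_cong)
        (simp only: A_def norm_mult norm_of_real power_mult_distrib power2_abs power_divide power_one,
         rule ennreal_mult, auto)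
    also have "\<dots> \<le> ennreal (C * 8 / (1/2))" by (rule weighted_growth) auto
    also have "\<dots> < \<infinity>" by simp
    finally have "integrable lborel (\<lambda>x. (norm (A x))\<^sup>2)" by (intro integrableI_bounded) auto
    then show ?thesis by (simp add: L2_def)
  qed
  then have "integrable lborel (\<lambda>x. A x * (of_real (1 + 1/2 * norm x) * \<phi> x))"
    by (rule L2_mult_integrable[OF _ schwartz_weighted_L2[OF \<phi>]])
  moreover have eq: "A x * (of_real (1 + 1/2 * norm x) * \<phi> x) = g x * \<phi> x" for x
  proof -
    have "1 + 1/2 * norm x \<noteq> 0" using norm_ge_zero[of x] by linarith
    then have "complex_of_real (1 / (1 + 1/2 * norm x)) * of_real (1 + 1/2 * norm x) = 1"
      unfolding of_real_mult[symmetric] by simp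
    then show ?thesis unfolding A_def by (metis (no_types, lifting) mult.assoc mult.right_neutral)
  qed
  ultimately show ?thesis by (simp only: eq)
qed

lemma U_schwartz: "\<phi> \<in> schwartz \<Longrightarrow> U \<phi> = (\<integral>x. g x * \<phi> x \<partial>lborel)"
proof -
  assume \<phi>: "\<phi> \<in> schwartz"
  obtain \<eta> :: "'a \<Rightarrow> complex" where "\<eta> \<in> test_functions" "\<eta> 0 = 1" by (rule cutoff_exists)
  then show ?thesis by (rule tempered_function_schwartz[OF U \<phi> integrable_schwartz[OF \<phi>]])
qed

text \<open>In x, mollifying the Fourier transform of U at scale \<epsilon> is multiplication of g
  by this factor.\<close>

definition "H \<epsilon> x = g x * fourier \<rho> (\<epsilon> *\<^sub>R x)"

text \<open>\<open>k \<epsilon> \<xi>\<close> is the value of \<open>U\<close> at the Fourier transform of the mollifier of scale \<open>\<epsilon>\<close> centred at \<open>-\<xi>\<close>.\<close>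

definition "k \<epsilon> \<xi> = (\<integral>x. H \<epsilon> x * exp (- \<i> * of_real (\<xi> \<bullet> (- x))) \<partial>lborel)"

definition "M = (SOME M. M \<ge> 0 \<and> (\<forall>x. (1 + norm x) * norm (fourier \<rho> x) \<le> M))"

lemma M: "M \<ge> 0" "(1 + norm x) * norm (fourier \<rho> x) \<le> M"
proof -
  have "\<exists>M\<ge>0. \<forall>x. (1 + norm x) * norm (fourier \<rho> x) \<le> M"
    using schwartz_bound[OF fourier_schwartz[OF \<rho>(1)], of "[]" 1] by (metis lists.Nil partials.simps(1) power_one_right)
  then have "M \<ge> 0 \<and> (\<forall>x. (1 + norm x) * norm (fourier \<rho> x) \<le> M)" unfolding M_def by (rule someI_ex)
  then show "M \<ge> 0" "(1 + norm x) * norm (fourier \<rho> x) \<le> M" by auto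
qed

lemma continuous_m: "continuous_on UNIV (fourier \<rho>)"
  by (rule smooth_continuous[OF smooth_fourier[OF \<rho>(1)]])

lemma H_measurable [measurable]: "H \<epsilon> \<in> borel_measurable borel"
proof -
  have [measurable]: "fourier \<rho> \<in> borel_measurable borel" by (rule borel_measurable_continuous_onI[OF continuous_m])
  show ?thesis unfolding H_def[abs_def] by measurable
qed

text \<open>At \<xi> = 0 the phase disappears, and the factor multiplying g is the transform of a
  test function, hence a Schwartz function.\<close>

lemma H_integrable:
  assumes "\<epsilon> > 0" shows "integrable lborel (H \<epsilon>)"
  using integrable_schwartz[OF fourier_schwartz[OF mollifier_fourier(1)[OF \<rho>(1) assms, of 0]]]
  unfolding mollifier_fourier(2)[OF \<rho>(1) assms] by (simp add: H_def[abs_def])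

text \<open>One power of decay of the transform of \<rho>, squared, is the weight of
  \<open>weighted_growth\<close>, which supplies the order 1/\<epsilon>.\<close>

lemma H_L2:
  assumes e: "0 < \<epsilon>" "\<epsilon> < 1"
  shows "H \<epsilon> \<in> L2 lborel" "sq_norm lborel (H \<epsilon>) \<le> M\<^sup>2 * (C * 8 / \<epsilon>)"
proof -
  have "(\<integral>\<^sup>+x. ennreal ((norm (H \<epsilon> x))\<^sup>2) \<partial>lborel)
      \<le> (\<integral>\<^sup>+x. ennreal (M\<^sup>2) * (ennreal ((norm (g x))\<^sup>2) * ennreal (1 / (1 + \<epsilon> * norm x)\<^sup>2)) \<partial>lborel)"
  proof (rule nn_integral_mono)
    fix x :: 'a
    have p: "0 < 1 + \<epsilon> * norm x" using e by (intro add_pos_nonneg) auto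
    have "(1 + \<epsilon> * norm x) * norm (fourier \<rho> (\<epsilon> *\<^sub>R x)) \<le> M" using M(2)[of "\<epsilon> *\<^sub>R x"] e by simp
    then have "norm (fourier \<rho> (\<epsilon> *\<^sub>R x)) \<le> M * (1 / (1 + \<epsilon> * norm x))" using p by (simp add: pos_le_divide_eq mult.commute)
    then have "norm (H \<epsilon> x) \<le> norm (g x) * (M * (1 / (1 + \<epsilon> * norm x)))"
      unfolding H_def norm_mult by (intro mult_left_mono) auto
    then have "(norm (H \<epsilon> x))\<^sup>2 \<le> (norm (g x) * (M * (1 / (1 + \<epsilon> * norm x))))\<^sup>2" by (intro power_mono) auto
    also have "\<dots> = M\<^sup>2 * ((norm (g x))\<^sup>2 * (1 / (1 + \<epsilon> * norm x)\<^sup>2))" by (simp add: power_mult_distrib power_divide)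
    finally have "ennreal ((norm (H \<epsilon> x))\<^sup>2) \<le> ennreal (M\<^sup>2 * ((norm (g x))\<^sup>2 * (1 / (1 + \<epsilon> * norm x)\<^sup>2)))"
      by (rule ennreal_leI)
    also have "\<dots> = ennreal (M\<^sup>2) * (ennreal ((norm (g x))\<^sup>2) * ennreal (1 / (1 + \<epsilon> * norm x)\<^sup>2))"
      by (subst ennreal_mult, simp, simp, subst ennreal_mult, simp, simp, rule refl)
    finally show "ennreal ((norm (H \<epsilon> x))\<^sup>2) \<le> \<dots>" .
  qed
  also have "\<dots> = ennreal (M\<^sup>2) * (\<integral>\<^sup>+x. ennreal ((norm (g x))\<^sup>2) * ennreal (1 / (1 + \<epsilon> * norm x)\<^sup>2) \<partial>lborel)"
    by (rule nn_integral_cmult) measurable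
  also have "\<dots> \<le> ennreal (M\<^sup>2) * ennreal (C * 8 / \<epsilon>)" by (intro mult_left_mono weighted_growth e) simp
  also have "\<dots> = ennreal (M\<^sup>2 * (C * 8 / \<epsilon>))" using C e by (intro ennreal_mult[symmetric]) auto
  finally have le: "(\<integral>\<^sup>+x. ennreal ((norm (H \<epsilon> x))\<^sup>2) \<partial>lborel) \<le> ennreal (M\<^sup>2 * (C * 8 / \<epsilon>))" .
  then have i: "integrable lborel (\<lambda>x. (norm (H \<epsilon> x))\<^sup>2)"
    by (intro integrableI_bounded) (auto intro: le_less_trans)
  then show "H \<epsilon> \<in> L2 lborel" by (simp add: L2_def)
  have "ennreal (sq_norm lborel (H \<epsilon>)) \<le> ennreal (M\<^sup>2 * (C * 8 / \<epsilon>))"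
    using le nn_integral_eq_integral[OF i] by (simp add: sq_norm_def)
  then show "sq_norm lborel (H \<epsilon>) \<le> M\<^sup>2 * (C * 8 / \<epsilon>)" using C e by simp
qed

lemma k_eq_0:
  assumes e: "0 < \<epsilon>" "\<epsilon> < \<delta>" and \<xi>: "\<bar>norm \<xi> - 1\<bar> > \<epsilon>"
  shows "k \<epsilon> \<xi> = 0"
proof -
  let ?\<phi> = "\<lambda>\<eta>. of_real (inverse (\<epsilon> ^ DIM('a))) * \<rho> ((1 / \<epsilon>) *\<^sub>R \<eta> + (1 / \<epsilon>) *\<^sub>R \<xi>)"
  note t = mollifier_fourier[OF \<rho>(1) e(1), of \<xi>]
  have "U (fourier ?\<phi>) = 0"
  proof (rule vanish[OF t(1) e])
    fix x assume "norm (x - (- \<xi>)) > \<epsilon>"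
    then have "norm ((1 / \<epsilon>) *\<^sub>R (x + \<xi>)) \<ge> 1" using e by simp
    then show "?\<phi> x = 0" using \<rho>(3) by (simp add: scaleR_right_distrib)
  qed (use \<xi> in simp)
  moreover have "U (fourier ?\<phi>) = (\<integral>x. g x * fourier ?\<phi> x \<partial>lborel)" by (rule U_schwartz[OF fourier_schwartz[OF t(1)]])
  moreover have "g x * fourier ?\<phi> x = H \<epsilon> x * exp (- \<i> * of_real (\<xi> \<bullet> (- x)))" for x
    unfolding t(2) H_def by simp
  ultimately show ?thesis by (simp add: k_def)
qed

lemma k_continuous:
  assumes "\<epsilon> > 0" shows "continuous_on UNIV (k \<epsilon>)"
proof -
  have "continuous_on UNIV (\<lambda>\<xi>. \<integral>x. H \<epsilon> x * exp (- \<i> * of_real (\<xi> \<bullet> x)) \<partial>lborel)"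
    by (rule continuous_fourier_measure[OF H_integrable[OF assms]]) simp
  from continuous_on_compose2[OF this, of UNIV uminus]
  show ?thesis unfolding k_def[abs_def] by (simp add: continuous_on_minus)
qed

lemma k_measurable: "\<epsilon> > 0 \<Longrightarrow> k \<epsilon> \<in> borel_measurable borel"
  by (rule borel_measurable_continuous_onI[OF k_continuous])

definition "D = exp 2 * ((sqrt (2 * pi)) ^ DIM('a) * (sqrt (2 * pi)) ^ DIM('a) * (M\<^sup>2 * (C * 8)))"

lemma D_nonneg: "D \<ge> 0"
  unfolding D_def using C(1) M(1) by (intro mult_nonneg_nonneg zero_le_power) auto

text \<open>\<open>k \<epsilon>\<close> vanishes for |\<xi>| > 2, and on that ball the Gaussian of
  width 1 is at least exp (-2), so \<open>gaussian_schur\<close> bounds the unweighted norm. The two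
  powers of \<open>sqrt (2 * pi)\<close> in \<open>D\<close> come from the transform and from the
  mass of this Gaussian.\<close>

lemma k_L2:
  assumes e: "0 < \<epsilon>" "\<epsilon> < \<delta>" "\<epsilon> < 1"
  shows "k \<epsilon> \<in> L2 lborel" "integrable lborel (k \<epsilon>)" "sq_norm lborel (k \<epsilon>) \<le> D / \<epsilon>"
proof -
  note [measurable] = k_measurable[OF e(1)]
  have k0: "k \<epsilon> \<xi> = 0" if "norm \<xi> > 2" for \<xi> using that e by (intro k_eq_0) auto
  have kb: "norm (k \<epsilon> \<xi>) \<le> (\<integral>x. norm (H \<epsilon> x) \<partial>lborel)" for \<xi>
    unfolding k_def by (rule order_trans[OF integral_norm_bound]) (simp add: norm_mult)
  note L = L2_bounded_supportI[of "k \<epsilon>", OF _ kb k0]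
  show kL: "k \<epsilon> \<in> L2 lborel" and "integrable lborel (k \<epsilon>)" by (rule L; measurable)+
  have "(\<integral>\<^sup>+\<xi>. ennreal ((norm (k \<epsilon> \<xi>))\<^sup>2) \<partial>lborel) \<le> (\<integral>\<^sup>+\<xi>. ennreal (exp 2) * ennreal (exp (- (1 * norm \<xi>)\<^sup>2 / 2) * (norm (k \<epsilon> \<xi>))\<^sup>2) \<partial>lborel)"
  proof (rule nn_integral_mono)
    fix \<xi> :: 'a
    show "ennreal ((norm (k \<epsilon> \<xi>))\<^sup>2) \<le> ennreal (exp 2) * ennreal (exp (- (1 * norm \<xi>)\<^sup>2 / 2) * (norm (k \<epsilon> \<xi>))\<^sup>2)"
    proof (cases "norm \<xi> > 2")
      case False
      then have "(norm \<xi>)\<^sup>2 \<le> 2\<^sup>2" by (intro power_mono) auto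
      then have "1 \<le> exp 2 * exp (- (1 * norm \<xi>)\<^sup>2 / 2)" unfolding exp_add[symmetric] by simp
      then have "1 * (norm (k \<epsilon> \<xi>))\<^sup>2 \<le> exp 2 * exp (- (1 * norm \<xi>)\<^sup>2 / 2) * (norm (k \<epsilon> \<xi>))\<^sup>2" by (rule mult_right_mono) simp
      then show ?thesis by (subst ennreal_mult[symmetric]) (auto intro!: ennreal_leI simp: mult.assoc)
    qed (simp add: k0)
  qed
  also have "\<dots> = ennreal (exp 2) * (\<integral>\<^sup>+\<xi>. ennreal (exp (- (1 * norm \<xi>)\<^sup>2 / 2) * (norm (k \<epsilon> \<xi>))\<^sup>2) \<partial>lborel)"
    by (rule nn_integral_cmult) measurable
  also have "\<dots> \<le> ennreal (exp 2) * ennreal ((sqrt (2 * pi) / 1) ^ DIM('a) * (sqrt (2 * pi)) ^ DIM('a) * sq_norm lborel (H \<epsilon>))"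
    unfolding k_def sq_norm_def
  \<comment> \<open>The two minus signs in the definition of \<open>k\<close> give it the form
    required by \<open>gaussian_schur\<close> with p = \<open>uminus\<close>.\<close>
  proof (intro mult_left_mono gaussian_schur[where p=uminus] sigma_finite_lborel H_integrable e)
    show "integrable lborel (\<lambda>y. (norm (H \<epsilon> y))\<^sup>2)" using H_L2(1)[of \<epsilon>] e by (simp add: L2_def)
    show "(\<integral>\<^sup>+z. ennreal (exp (- (norm (- y - - z) / 1)\<^sup>2 / 2)) \<partial>lborel) \<le> ennreal (sqrt (2 * pi) ^ DIM('a))" for y :: 'a
      using gaussian_nn_integral(1)[of 1 y] by simp
  qed auto
  also have "\<dots> \<le> ennreal (exp 2) * ennreal ((sqrt (2 * pi) / 1) ^ DIM('a) * (sqrt (2 * pi)) ^ DIM('a) * (M\<^sup>2 * (C * 8 / \<epsilon>)))"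
    using H_L2(2)[of \<epsilon>] e by (intro mult_left_mono ennreal_leI) auto
  also have "\<dots> = ennreal (D / \<epsilon>)"
    using e C(1) by (subst ennreal_mult[symmetric]) (auto simp: D_def)
  finally have le: "(\<integral>\<^sup>+\<xi>. ennreal ((norm (k \<epsilon> \<xi>))\<^sup>2) \<partial>lborel) \<le> ennreal (D / \<epsilon>)" .
  have i: "integrable lborel (\<lambda>\<xi>. (norm (k \<epsilon> \<xi>))\<^sup>2)" using kL by (simp add: L2_def)
  have "ennreal (sq_norm lborel (k \<epsilon>)) \<le> ennreal (D / \<epsilon>)"
    using le nn_integral_eq_integral[OF i] by (simp add: sq_norm_def)
  then show "sq_norm lborel (k \<epsilon>) \<le> D / \<epsilon>" using D_nonneg e by simp
qed

section \<open>Radial integrals as densities on the sphere\<close>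

definition "\<Phi> \<epsilon> \<omega> = (\<integral>r. k \<epsilon> (r *\<^sub>R \<omega>) \<partial>radial_measure DIM('a))"

lemma \<Phi>_measurable:
  assumes "\<epsilon> > 0" shows "\<Phi> \<epsilon> \<in> borel_measurable sphere_measure"
proof -
  interpret R: sigma_finite_measure "radial_measure DIM('a)" by (rule sigma_finite_radial)
  have "(\<lambda>z. k \<epsilon> (case z of (\<omega>, r) \<Rightarrow> r *\<^sub>R \<omega>)) \<in> borel_measurable (sphere_measure \<Otimes>\<^sub>M radial_measure DIM('a))"
    by (rule measurable_compose[OF measurable_polar_map k_measurable[OF assms]])
  then have "(\<lambda>(\<omega>, r). k \<epsilon> (r *\<^sub>R \<omega>)) \<in> borel_measurable (sphere_measure \<Otimes>\<^sub>M radial_measure DIM('a))"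
    by (simp add: case_prod_beta)
  then show ?thesis unfolding \<Phi>_def[abs_def] by (rule R.borel_measurable_lebesgue_integral)
qed

text \<open>The Cauchy-Schwarz inequality in r over the shell, of radial measure at most
  \<open>2 ^ DIM('a) * \<epsilon>\<close>, cancels the 1/\<epsilon> in the bound for
  \<open>k \<epsilon>\<close>.\<close>

lemma \<Phi>_L2:
  assumes e: "0 < \<epsilon>" "\<epsilon> < \<delta>" "\<epsilon> < 1"
  shows "\<Phi> \<epsilon> \<in> L2 sphere_measure" "sq_norm sphere_measure (\<Phi> \<epsilon>) \<le> 2 ^ DIM('a) * D"
proof -
  let ?R = "radial_measure DIM('a)"
  note [measurable] = k_measurable[OF e(1)]
  have pt: "ennreal ((norm (\<Phi> \<epsilon> \<omega>))\<^sup>2) \<le> ennreal (2 ^ DIM('a) * \<epsilon>) * (\<integral>\<^sup>+r. ennreal ((norm (k \<epsilon> (r *\<^sub>R \<omega>)))\<^sup>2) \<partial>?R)"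
    if \<omega>: "norm \<omega> = 1" for \<omega>
  proof -
    have "ennreal (norm (\<Phi> \<epsilon> \<omega>)) \<le> (\<integral>\<^sup>+r. ennreal (norm (k \<epsilon> (r *\<^sub>R \<omega>))) \<partial>?R)"
    \<comment> \<open>Along a ray where the integrand is not integrable, the Bochner integral is 0
      by convention and the bound is trivial.\<close>
    proof (cases "integrable ?R (\<lambda>r. k \<epsilon> (r *\<^sub>R \<omega>))")
      case True
      then show ?thesis unfolding \<Phi>_def by (rule integral_norm_bound_ennreal)
    qed (simp add: \<Phi>_def not_integrable_integral_eq)
    also have "\<dots> = (\<integral>\<^sup>+r. ennreal (norm (k \<epsilon> (r *\<^sub>R \<omega>))) * indicator {1 - \<epsilon>..1 + \<epsilon>} r \<partial>?R)"
    proof (rule nn_integral_cong_AE)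
      show "AE r in ?R. ennreal (norm (k \<epsilon> (r *\<^sub>R \<omega>))) = ennreal (norm (k \<epsilon> (r *\<^sub>R \<omega>))) * indicator {1 - \<epsilon>..1 + \<epsilon>} r"
        using AE_radial_pos
      proof eventually_elim
        fix r :: real assume r: "r > 0"
        show "ennreal (norm (k \<epsilon> (r *\<^sub>R \<omega>))) = ennreal (norm (k \<epsilon> (r *\<^sub>R \<omega>))) * indicator {1 - \<epsilon>..1 + \<epsilon>} r"
        proof (cases "r \<in> {1 - \<epsilon>..1 + \<epsilon>}")
          case False
          then have "\<bar>norm (r *\<^sub>R \<omega>) - 1\<bar> > \<epsilon>" using r \<omega> by auto
          then show ?thesis using k_eq_0[OF e(1,2)] by simp
        qed simp
      qed
    qed
    finally have "(ennreal (norm (\<Phi> \<epsilon> \<omega>)))\<^sup>2 \<le> (\<integral>\<^sup>+r. ennreal (norm (k \<epsilon> (r *\<^sub>R \<omega>))) * indicator {1 - \<epsilon>..1 + \<epsilon>} r \<partial>?R)\<^sup>2"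
      by (rule power_mono) simp
    also have "\<dots> \<le> (\<integral>\<^sup>+r. (ennreal (norm (k \<epsilon> (r *\<^sub>R \<omega>))))\<^sup>2 \<partial>?R) * (\<integral>\<^sup>+r. (indicator {1 - \<epsilon>..1 + \<epsilon>} r)\<^sup>2 \<partial>?R)"
      by (rule Cauchy_Schwarz_nn_integral) measurable
    also have "(\<integral>\<^sup>+r. (indicator {1 - \<epsilon>..1 + \<epsilon>} r)\<^sup>2 \<partial>?R) = (\<integral>\<^sup>+r. indicator {1 - \<epsilon>..1 + \<epsilon>} r \<partial>?R)"
      by (intro nn_integral_cong) (simp add: indicator_def)
    also have "(\<integral>\<^sup>+r. (ennreal (norm (k \<epsilon> (r *\<^sub>R \<omega>))))\<^sup>2 \<partial>?R) * \<dots>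
        \<le> (\<integral>\<^sup>+r. (ennreal (norm (k \<epsilon> (r *\<^sub>R \<omega>))))\<^sup>2 \<partial>?R) * ennreal (2 ^ DIM('a) * \<epsilon>)"
      using e by (intro mult_left_mono nn_integral_radial_shell_le) auto
    finally show ?thesis by (simp add: ennreal_power mult.commute)
  qed
  have "(\<integral>\<^sup>+\<omega>. ennreal ((norm (\<Phi> \<epsilon> \<omega>))\<^sup>2) \<partial>sphere_measure)
      \<le> (\<integral>\<^sup>+\<omega>. ennreal (2 ^ DIM('a) * \<epsilon>) * (\<integral>\<^sup>+r. ennreal ((norm (k \<epsilon> (r *\<^sub>R \<omega>)))\<^sup>2) \<partial>?R) \<partial>sphere_measure)"
    by (intro nn_integral_mono pt) (simp add: space_sphere_measure)
  also have "\<dots> = ennreal (2 ^ DIM('a) * \<epsilon>) * (\<integral>\<^sup>+\<omega>. (\<integral>\<^sup>+r. ennreal ((norm (k \<epsilon> (r *\<^sub>R \<omega>)))\<^sup>2) \<partial>?R) \<partial>sphere_measure)"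
  proof (rule nn_integral_cmult)
    interpret R: sigma_finite_measure ?R by (rule sigma_finite_radial)
    have "(\<lambda>z. ennreal ((norm (k \<epsilon> (case z of (\<omega>, r) \<Rightarrow> r *\<^sub>R \<omega>)))\<^sup>2)) \<in> borel_measurable (sphere_measure \<Otimes>\<^sub>M ?R)"
      by (rule measurable_compose[OF measurable_polar_map]) measurable
    from R.borel_measurable_nn_integral_fst[OF this]
    show "(\<lambda>\<omega>. \<integral>\<^sup>+r. ennreal ((norm (k \<epsilon> (r *\<^sub>R \<omega>)))\<^sup>2) \<partial>?R) \<in> borel_measurable sphere_measure" by simp
  qed
  also have "(\<integral>\<^sup>+\<omega>. (\<integral>\<^sup>+r. ennreal ((norm (k \<epsilon> (r *\<^sub>R \<omega>)))\<^sup>2) \<partial>?R) \<partial>sphere_measure) = (\<integral>\<^sup>+\<xi>. ennreal ((norm (k \<epsilon> \<xi>))\<^sup>2) \<partial>lborel)"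
    by (rule nn_integral_polar_radial) measurable
  also have "\<dots> = ennreal (sq_norm lborel (k \<epsilon>))"
    unfolding sq_norm_def using k_L2(1)[OF e] by (intro nn_integral_eq_integral) (auto simp: L2_def)
  also have "ennreal (2 ^ DIM('a) * \<epsilon>) * \<dots> \<le> ennreal (2 ^ DIM('a) * \<epsilon>) * ennreal (D / \<epsilon>)"
    by (intro mult_left_mono ennreal_leI k_L2 e) simp
  also have "\<dots> = ennreal (2 ^ DIM('a) * D)"
    using e D_nonneg by (subst ennreal_mult[symmetric]) auto
  finally have le: "(\<integral>\<^sup>+\<omega>. ennreal ((norm (\<Phi> \<epsilon> \<omega>))\<^sup>2) \<partial>sphere_measure) \<le> ennreal (2 ^ DIM('a) * D)" .
  have i: "integrable sphere_measure (\<lambda>\<omega>. (norm (\<Phi> \<epsilon> \<omega>))\<^sup>2)"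
    by (rule integrableI_bounded) (use \<Phi>_measurable[OF e(1)] le_less_trans[OF le] in auto)
  then show "\<Phi> \<epsilon> \<in> L2 sphere_measure" using \<Phi>_measurable[OF e(1)] by (simp add: L2_def)
  have "ennreal (sq_norm sphere_measure (\<Phi> \<epsilon>)) \<le> ennreal (2 ^ DIM('a) * D)"
    using le nn_integral_eq_integral[OF i] by (simp add: sq_norm_def)
  then show "sq_norm sphere_measure (\<Phi> \<epsilon>) \<le> 2 ^ DIM('a) * D" using D_nonneg by simp
qed

text \<open>\<open>v (sgn \<xi>)\<close> is constant along rays, so it leaves the radial integral in
  polar coordinates.\<close>

lemma sphere_pairing:
  assumes e: "0 < \<epsilon>" "\<epsilon> < \<delta>" "\<epsilon> < 1" and v: "continuous_on UNIV v" "\<And>x. norm (v x) \<le> B"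
  shows "(\<integral>\<omega>. \<Phi> \<epsilon> \<omega> * v \<omega> \<partial>sphere_measure) = (\<integral>\<xi>. k \<epsilon> \<xi> * v (sgn \<xi>) \<partial>lborel)"
    "integrable lborel (\<lambda>\<xi>. k \<epsilon> \<xi> * v (sgn \<xi>))"
proof -
  note [measurable] = k_measurable[OF e(1)]
  have [measurable]: "v \<in> borel_measurable borel" using v(1) by (rule borel_measurable_continuous_onI)
  show i: "integrable lborel (\<lambda>\<xi>. k \<epsilon> \<xi> * v (sgn \<xi>))"
  proof (rule Bochner_Integration.integrable_bound)
    show "integrable lborel (\<lambda>\<xi>. k \<epsilon> \<xi> * of_real B)" using k_L2(2)[OF e] by (rule integrable_mult_left)
    show "(\<lambda>\<xi>. k \<epsilon> \<xi> * v (sgn \<xi>)) \<in> borel_measurable lborel" unfolding sgn_div_norm by measurable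
    show "AE \<xi> in lborel. norm (k \<epsilon> \<xi> * v (sgn \<xi>)) \<le> norm (k \<epsilon> \<xi> * of_real B)"
      by (intro AE_I2) (auto simp: norm_mult intro!: mult_left_mono order_trans[OF v(2) abs_ge_self])
  qed
  have "(\<integral>\<xi>. k \<epsilon> \<xi> * v (sgn \<xi>) \<partial>lborel) = (\<integral>\<omega>. (\<integral>r. k \<epsilon> (r *\<^sub>R \<omega>) * v (sgn (r *\<^sub>R \<omega>)) \<partial>radial_measure DIM('a)) \<partial>sphere_measure)"
    by (rule integral_polar[OF i])
  also have "\<dots> = (\<integral>\<omega>. \<Phi> \<epsilon> \<omega> * v \<omega> \<partial>sphere_measure)"
  proof (rule Bochner_Integration.integral_cong[OF refl])
    fix \<omega> :: 'a assume "\<omega> \<in> space sphere_measure"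
    then have \<omega>: "norm \<omega> = 1" by (simp add: space_sphere_measure)
    have "(\<integral>r. k \<epsilon> (r *\<^sub>R \<omega>) * v (sgn (r *\<^sub>R \<omega>)) \<partial>radial_measure DIM('a)) = (\<integral>r. k \<epsilon> (r *\<^sub>R \<omega>) * v \<omega> \<partial>radial_measure DIM('a))"
    proof (rule integral_cong_AE)
      show "AE r in radial_measure DIM('a). k \<epsilon> (r *\<^sub>R \<omega>) * v (sgn (r *\<^sub>R \<omega>)) = k \<epsilon> (r *\<^sub>R \<omega>) * v \<omega>"
        using AE_radial_pos by eventually_elim (simp add: sgn_div_norm \<omega>)
    qed (unfold sgn_div_norm, measurable)
    also have "\<dots> = \<Phi> \<epsilon> \<omega> * v \<omega>" unfolding \<Phi>_def by (rule integral_mult_left_zero)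
    finally show "(\<integral>r. k \<epsilon> (r *\<^sub>R \<omega>) * v (sgn (r *\<^sub>R \<omega>)) \<partial>radial_measure DIM('a)) = \<Phi> \<epsilon> \<omega> * v \<omega>" .
  qed
  finally show "(\<integral>\<omega>. \<Phi> \<epsilon> \<omega> * v \<omega> \<partial>sphere_measure) = (\<integral>\<xi>. k \<epsilon> \<xi> * v (sgn \<xi>) \<partial>lborel)" ..
qed

text \<open>Moving a point of the support of \<open>k \<epsilon>\<close> radially to the sphere costs at most \<open>\<epsilon>\<close>, which beats the growth
  \<open>1/sqrt \<epsilon>\<close> of the norm of \<open>k \<epsilon>\<close>.\<close>

lemma projection_error:
  assumes e: "0 < \<epsilon>" "\<epsilon> < \<delta>" "\<epsilon> < 1" and v: "continuous_on UNIV v" "\<And>x. norm (v x) \<le> B"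
    and L: "L \<ge> 0" "\<And>x y. norm (v x - v y) \<le> L * norm (x - y)"
  shows "norm ((\<integral>\<xi>. k \<epsilon> \<xi> * v (sgn \<xi>) \<partial>lborel) - (\<integral>\<xi>. k \<epsilon> \<xi> * v \<xi> \<partial>lborel))
    \<le> sqrt \<epsilon> * ((D + L\<^sup>2 * measure lborel (cball (0::'a) 2)) / 2)"
proof -
  note [measurable] = k_measurable[OF e(1)]
  have [measurable]: "v \<in> borel_measurable borel" using v(1) by (rule borel_measurable_continuous_onI)
  \<comment> \<open>Cut off to the shell, outside which \<open>k \<epsilon>\<close> vanishes; there
    the difference is at most L \<epsilon>, and the cutoff makes it square integrable.\<close>
  define G where "G \<xi> = (if \<bar>norm \<xi> - 1\<bar> \<le> \<epsilon> then v (sgn \<xi>) - v \<xi> else 0)" for \<xi>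
  have Gm[measurable]: "G \<in> borel_measurable borel" unfolding G_def[abs_def] sgn_div_norm by measurable
  have Gb: "norm (G \<xi>) \<le> L * \<epsilon>" for \<xi>
  proof (cases "\<bar>norm \<xi> - 1\<bar> \<le> \<epsilon>")
    case True
    then have "\<xi> \<noteq> 0" using e by auto
    then have "sgn \<xi> - \<xi> = (1 - norm \<xi>) *\<^sub>R sgn \<xi>" by (simp add: sgn_div_norm algebra_simps)
    then have "norm (sgn \<xi> - \<xi>) = \<bar>1 - norm \<xi>\<bar>" using \<open>\<xi> \<noteq> 0\<close> by (simp add: norm_sgn)
    then have "L * norm (sgn \<xi> - \<xi>) \<le> L * \<epsilon>" using True L(1) by (intro mult_left_mono) auto
    then show ?thesis using True order_trans[OF L(2)] by (simp add: G_def)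
  qed (use L e in \<open>simp add: G_def\<close>)
  have G0: "G \<xi> = 0" if "norm \<xi> > 2" for \<xi> using that e by (auto simp: G_def)
  have GL: "G \<in> L2 lborel" and Gs: "sq_norm lborel G \<le> (L * \<epsilon>)\<^sup>2 * measure lborel (cball (0::'a) 2)"
    using L2_bounded_supportI(1)[OF Gm Gb G0] L2_bounded_supportI(3)[OF Gm Gb G0] by auto
  have "integrable lborel (\<lambda>\<xi>. k \<epsilon> \<xi> * v \<xi>)"
  proof (rule Bochner_Integration.integrable_bound)
    show "integrable lborel (\<lambda>\<xi>. k \<epsilon> \<xi> * of_real B)" using k_L2(2)[OF e] by (rule integrable_mult_left)
    show "AE \<xi> in lborel. norm (k \<epsilon> \<xi> * v \<xi>) \<le> norm (k \<epsilon> \<xi> * of_real B)"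
      by (intro AE_I2) (auto simp: norm_mult intro!: mult_left_mono order_trans[OF v(2) abs_ge_self])
  qed measurable
  then have "(\<integral>\<xi>. k \<epsilon> \<xi> * v (sgn \<xi>) \<partial>lborel) - (\<integral>\<xi>. k \<epsilon> \<xi> * v \<xi> \<partial>lborel) = (\<integral>\<xi>. k \<epsilon> \<xi> * v (sgn \<xi>) - k \<epsilon> \<xi> * v \<xi> \<partial>lborel)"
    using sphere_pairing(2)[OF e v] by simp
  also have "(\<lambda>\<xi>. k \<epsilon> \<xi> * v (sgn \<xi>) - k \<epsilon> \<xi> * v \<xi>) = (\<lambda>\<xi>. k \<epsilon> \<xi> * G \<xi>)"
  proof
    fix \<xi>
    show "k \<epsilon> \<xi> * v (sgn \<xi>) - k \<epsilon> \<xi> * v \<xi> = k \<epsilon> \<xi> * G \<xi>"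
      using k_eq_0[OF e(1,2), of \<xi>] by (cases "\<bar>norm \<xi> - 1\<bar> \<le> \<epsilon>") (auto simp: G_def right_diff_distrib)
  qed
  finally have eq: "(\<integral>\<xi>. k \<epsilon> \<xi> * v (sgn \<xi>) \<partial>lborel) - (\<integral>\<xi>. k \<epsilon> \<xi> * v \<xi> \<partial>lborel) = (\<integral>\<xi>. k \<epsilon> \<xi> * G \<xi> \<partial>lborel)" .
  have s: "sqrt \<epsilon> > 0" "sqrt \<epsilon> * sqrt \<epsilon> = \<epsilon>" using e by auto
  \<comment> \<open>The squared norms are of orders 1/\<epsilon> and \<epsilon>^2; the weight t =
    \<open>\<epsilon> * sqrt \<epsilon>\<close> makes both terms of order
    \<open>sqrt \<epsilon>\<close>.\<close>
  have "norm (\<integral>\<xi>. k \<epsilon> \<xi> * G \<xi> \<partial>lborel) \<le> ((\<epsilon> * sqrt \<epsilon>) * sq_norm lborel (k \<epsilon>) + sq_norm lborel G / (\<epsilon> * sqrt \<epsilon>)) / 2"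
    using e by (intro norm_integral_mult_le k_L2 GL) auto
  also have "\<dots> \<le> ((\<epsilon> * sqrt \<epsilon>) * (D / \<epsilon>) + ((L * \<epsilon>)\<^sup>2 * measure lborel (cball (0::'a) 2)) / (\<epsilon> * sqrt \<epsilon>)) / 2"
    using e by (intro divide_right_mono add_mono mult_left_mono k_L2 Gs) auto
  also have "(\<epsilon> * sqrt \<epsilon>) * (D / \<epsilon>) = sqrt \<epsilon> * D" using e by simp
  also have "((L * \<epsilon>)\<^sup>2 * measure lborel (cball (0::'a) 2)) / (\<epsilon> * sqrt \<epsilon>) = sqrt \<epsilon> * (L\<^sup>2 * measure lborel (cball (0::'a) 2))"
  proof -
    have "\<epsilon>\<^sup>2 / (\<epsilon> * sqrt \<epsilon>) = sqrt \<epsilon>" using e s by (simp add: power2_eq_square real_div_sqrt)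
    then show ?thesis by (simp add: power_mult_distrib mult_ac) (simp add: divide_inverse mult_ac)
  qed
  finally show ?thesis unfolding eq by (simp add: algebra_simps)
qed

text \<open>Fubini's theorem moves the transform from \<open>H \<epsilon>\<close> onto
  \<open>fourier \<phi>\<close>, where inversion undoes it.\<close>

lemma frequency_pairing:
  assumes e: "\<epsilon> > 0" and \<phi>: "\<phi> \<in> test_functions"
  shows "(\<integral>\<xi>. k \<epsilon> \<xi> * fourier \<phi> \<xi> \<partial>lborel) = of_real ((2 * pi) ^ DIM('a)) * (\<integral>x. H \<epsilon> x * \<phi> x \<partial>lborel)"
proof -
  define K where "K = (\<lambda>(\<xi>, x). fourier \<phi> \<xi> * (H \<epsilon> x * exp (- \<i> * of_real (\<xi> \<bullet> (- x)))))"
  have iF: "integrable lborel (fourier \<phi>)" by (intro schwartz_integrable fourier_schwartz \<phi>)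
  note [measurable] = borel_measurable_integrable[OF iF]
  have "integrable (lborel \<Otimes>\<^sub>M lborel) (\<lambda>(\<xi>, x). fourier \<phi> \<xi> * H \<epsilon> x)"
    by (intro lborel_pair.integrable_pair_mult iF H_integrable e)
  then have iK: "integrable (lborel \<Otimes>\<^sub>M lborel) K"
    by (rule Bochner_Integration.integrable_bound) (auto simp: K_def norm_mult)
  have "(\<integral>\<xi>. k \<epsilon> \<xi> * fourier \<phi> \<xi> \<partial>lborel) = (\<integral>\<xi>. (\<integral>x. K (\<xi>, x) \<partial>lborel) \<partial>lborel)"
  proof (rule Bochner_Integration.integral_cong[OF refl])
    fix \<xi>
    show "k \<epsilon> \<xi> * fourier \<phi> \<xi> = (\<integral>x. K (\<xi>, x) \<partial>lborel)"
      unfolding K_def k_def prod.case integral_mult_right_zero by (rule mult.commute)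
  qed
  also have "\<dots> = (\<integral>x. (\<integral>\<xi>. K (\<xi>, x) \<partial>lborel) \<partial>lborel)"
    using lborel_pair.integral_fst'[OF iK] lborel_pair.integral_snd[of "\<lambda>x w. K (x, w)"] iK by simp
  also have "\<dots> = (\<integral>x. of_real ((2 * pi) ^ DIM('a)) * (H \<epsilon> x * \<phi> x) \<partial>lborel)"
  proof (rule Bochner_Integration.integral_cong[OF refl])
    fix x
    have "K (\<xi>, x) = H \<epsilon> x * (fourier \<phi> \<xi> * exp (\<i> * of_real (x \<bullet> \<xi>)))" for \<xi>
      by (simp add: K_def inner_commute)
    then have "(\<integral>\<xi>. K (\<xi>, x) \<partial>lborel) = H \<epsilon> x * (of_real ((2 * pi) ^ DIM('a)) * \<phi> x)"
      unfolding fourier_inversion_test[OF \<phi>, symmetric] by simp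
    then show "(\<integral>\<xi>. K (\<xi>, x) \<partial>lborel) = of_real ((2 * pi) ^ DIM('a)) * (H \<epsilon> x * \<phi> x)"
      by (simp only: mult.left_commute)
  qed
  also have "\<dots> = of_real ((2 * pi) ^ DIM('a)) * (\<integral>x. H \<epsilon> x * \<phi> x \<partial>lborel)" by (rule integral_mult_right_zero)
  finally show ?thesis .
qed

text \<open>The transform of \<rho> is 1 at the origin because \<rho> has integral 1, so
  \<open>H \<epsilon>\<close> tends to g pointwise as \<epsilon> tends to 0.\<close>

lemma H_tendsto:
  assumes s: "s \<longlonglongrightarrow> 0" and \<phi>: "\<phi> \<in> test_functions"
  shows "(\<lambda>n. \<integral>x. H (s n) x * \<phi> x \<partial>lborel) \<longlonglongrightarrow> (\<integral>x. g x * \<phi> x \<partial>lborel)"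
proof -
  have i: "integrable lborel (\<lambda>x. g x * \<phi> x)" by (intro integrable_schwartz test_functions_schwartz \<phi>)
  have [measurable]: "\<phi> \<in> borel_measurable borel" using test_functions_integrable[OF \<phi>] by simp
  have m0: "fourier \<rho> 0 = 1" using \<rho>(2) by (simp add: fourier_def)
  have c: "isCont (fourier \<rho>) x" for x using continuous_m by (simp add: continuous_on_eq_continuous_at)
  have mb: "norm (fourier \<rho> x) \<le> M" for x
  proof -
    have "1 * norm (fourier \<rho> x) \<le> (1 + norm x) * norm (fourier \<rho> x)" by (intro mult_right_mono) auto
    then show ?thesis using M(2)[of x] by simp
  qed
  show ?thesis
  proof (rule integral_dominated_convergence[where w="\<lambda>x. norm (g x * \<phi> x) * M"])
    show "integrable lborel (\<lambda>x. norm (g x * \<phi> x) * M)" using i by (intro integrable_mult_left integrable_norm)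
    show "AE x in lborel. (\<lambda>n. H (s n) x * \<phi> x) \<longlonglongrightarrow> g x * \<phi> x"
    proof (rule AE_I2)
      fix x :: 'a
      have "(\<lambda>n. s n *\<^sub>R x) \<longlonglongrightarrow> 0 *\<^sub>R x" by (intro tendsto_scaleR tendsto_const s)
      then have "(\<lambda>n. fourier \<rho> (s n *\<^sub>R x)) \<longlonglongrightarrow> fourier \<rho> (0 *\<^sub>R x)" by (rule isCont_tendsto_compose[OF c])
      then have "(\<lambda>n. g x * fourier \<rho> (s n *\<^sub>R x) * \<phi> x) \<longlonglongrightarrow> g x * fourier \<rho> (0 *\<^sub>R x) * \<phi> x" by (intro tendsto_intros)
      then show "(\<lambda>n. H (s n) x * \<phi> x) \<longlonglongrightarrow> g x * \<phi> x" by (simp add: H_def m0)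
    qed
    show "AE x in lborel. norm (H (s n) x * \<phi> x) \<le> norm (g x * \<phi> x) * M" for n
    proof (rule AE_I2)
      fix x
      have "norm (H (s n) x * \<phi> x) = norm (g x * \<phi> x) * norm (fourier \<rho> (s n *\<^sub>R x))"
        by (simp add: H_def norm_mult)
      also have "\<dots> \<le> norm (g x * \<phi> x) * M" by (intro mult_left_mono mb) simp
      finally show "norm (H (s n) x * \<phi> x) \<le> norm (g x * \<phi> x) * M" .
    qed
  qed measurable
qed

text \<open>\<open>sphere_pairing\<close>, \<open>projection_error\<close>,
  \<open>frequency_pairing\<close> and \<open>H_tendsto\<close> together give convergence of the
  pairings with \<open>fourier \<phi>\<close> along one sequence of scales common to all \<phi>,
  which is what \<open>L2_weak_limit\<close> needs to identify the pairings of its limit.\<close>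

lemma herglotz_density:
  obtains \<Psi> where "\<Psi> \<in> L2 sphere_measure"
    "\<And>\<phi>. \<phi> \<in> test_functions \<Longrightarrow> (\<integral>\<omega>. \<Psi> \<omega> * fourier \<phi> \<omega> \<partial>sphere_measure) = of_real ((2 * pi) ^ DIM('a)) * U \<phi>"
proof -
  \<comment> \<open>Halving \<delta> and 1 keeps \<open>s n\<close> strictly below both, even at n =
    0, where the other factor is 1.\<close>
  define s where "s n = min (\<delta> / 2) (1/2) * inverse (real (Suc n))" for n
  have s: "0 < s n" "s n < \<delta>" "s n < 1" for n
  proof -
    have "inverse (real (Suc n)) \<le> 1" by (simp add: field_simps)
    then have "s n \<le> min (\<delta> / 2) (1/2) * 1" unfolding s_def using \<delta> by (intro mult_left_mono) auto
    then show "s n < \<delta>" "s n < 1" using \<delta> by auto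
    show "0 < s n" using \<delta> by (simp add: s_def)
  qed
  have sl: "s \<longlonglongrightarrow> 0"
    using tendsto_mult_left[OF LIMSEQ_inverse_real_of_nat, of "min (\<delta> / 2) (1/2)"] by (simp add: s_def[abs_def] del: of_nat_Suc)
  obtain \<Psi> where \<Psi>: "\<Psi> \<in> L2 sphere_measure"
    and lim: "\<And>v l. v \<in> L2 sphere_measure \<Longrightarrow> (\<lambda>n. \<integral>x. \<Phi> (s n) x * v x \<partial>sphere_measure) \<longlonglongrightarrow> l \<Longrightarrow> (\<integral>x. \<Psi> x * v x \<partial>sphere_measure) = l"
    by (rule L2_weak_limit[where \<Phi>="\<lambda>n. \<Phi> (s n)", OF \<Phi>_L2(1)[OF s] \<Phi>_L2(2)[OF s]]) (rule that)
  show ?thesis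
  proof (rule that[OF \<Psi> lim])
    fix \<phi> :: "'a \<Rightarrow> complex" assume \<phi>: "\<phi> \<in> test_functions"
    define v where "v = fourier \<phi>"
    have vs: "v \<in> schwartz" unfolding v_def by (rule fourier_schwartz[OF \<phi>])
    have vc: "continuous_on UNIV v" by (rule smooth_continuous[OF schwartz_smooth[OF vs]])
    define B where "B = (\<integral>x. norm (\<phi> x) \<partial>lborel)"
    have vB: "norm (v x) \<le> B" for x unfolding v_def B_def by (rule norm_fourier_le)
    obtain L where L: "L \<ge> 0" "\<And>x y. norm (v x - v y) \<le> L * norm (x - y)" using schwartz_lipschitz[OF vs] by metis
    have vm: "v \<in> borel_measurable sphere_measure"
      by (rule borel_measurable_sphere[OF borel_measurable_continuous_onI[OF vc]])
    interpret finite_measure "sphere_measure :: 'a measure" by (rule finite_measure_sphere)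
    have "integrable sphere_measure (\<lambda>x. (norm (v x))\<^sup>2)"
      by (rule integrable_const_bound[of _ "B\<^sup>2"]) (use vm in \<open>auto intro!: AE_I2 power_mono vB\<close>)
    then show "fourier \<phi> \<in> L2 sphere_measure" using vm unfolding v_def by (simp add: L2_def)
    let ?a = "\<lambda>n. \<integral>\<xi>. k (s n) \<xi> * v (sgn \<xi>) \<partial>lborel" and ?b = "\<lambda>n. \<integral>\<xi>. k (s n) \<xi> * v \<xi> \<partial>lborel"
    let ?E = "(D + L\<^sup>2 * measure lborel (cball (0::'a) 2)) / 2"
    have "(\<lambda>n. ?a n - ?b n) \<longlonglongrightarrow> 0"
    proof (rule Lim_null_comparison)
      show "\<forall>\<^sub>F n in sequentially. norm (?a n - ?b n) \<le> sqrt (s n) * ?E"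
        by (intro always_eventually allI projection_error[OF s vc vB L])
      have "(\<lambda>n. sqrt (s n) * ?E) \<longlonglongrightarrow> sqrt 0 * ?E" by (intro tendsto_intros sl)
      then show "(\<lambda>n. sqrt (s n) * ?E) \<longlonglongrightarrow> 0" by simp
    qed
    moreover have "?b \<longlonglongrightarrow> of_real ((2 * pi) ^ DIM('a)) * (\<integral>x. g x * \<phi> x \<partial>lborel)"
      unfolding v_def frequency_pairing[OF s(1) \<phi>] by (intro tendsto_intros H_tendsto sl \<phi>)
    ultimately have "?a \<longlonglongrightarrow> of_real ((2 * pi) ^ DIM('a)) * (\<integral>x. g x * \<phi> x \<partial>lborel)"
      using tendsto_add by fastforce
    then show "(\<lambda>n. \<integral>x. \<Phi> (s n) x * fourier \<phi> x \<partial>sphere_measure) \<longlonglongrightarrow> of_real ((2 * pi) ^ DIM('a)) * U \<phi>"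
      unfolding sphere_pairing(1)[OF s vc vB, unfolded v_def] v_def U_schwartz[OF test_functions_schwartz[OF \<phi>]] .
  qed
qed

text \<open>Fubini's theorem turns the pairing of the density with \<open>fourier \<phi>\<close>
  into the integral of w \<phi>, which shows that U is the continuous function w. The factor (2
  pi)^d of \<open>herglotz_density\<close> is divided out here.\<close>

lemma herglotz_representation:
  "\<exists>\<Psi>\<in>L2 sphere_measure. \<exists>w. continuous_on UNIV w \<and> is_function U w \<and>
     (\<forall>x. w x = (\<integral>\<xi>. \<Psi> \<xi> * exp (- \<i> * of_real (x \<bullet> \<xi>)) \<partial>sphere_measure))"
proof -
  let ?c = "complex_of_real ((2 * pi) ^ DIM('a))"
  obtain \<Psi>0 where \<Psi>0: "\<Psi>0 \<in> L2 sphere_measure"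
    "\<And>\<phi>. \<phi> \<in> test_functions \<Longrightarrow> (\<integral>\<omega>. \<Psi>0 \<omega> * fourier \<phi> \<omega> \<partial>sphere_measure) = ?c * U \<phi>"
    using herglotz_density by metis
  define \<Psi> where "\<Psi> \<omega> = inverse ?c * \<Psi>0 \<omega>" for \<omega>
  have \<Psi>: "\<Psi> \<in> L2 sphere_measure" unfolding \<Psi>_def[abs_def] by (rule L2_cmult[OF \<Psi>0(1)])
  have i: "integrable sphere_measure \<Psi>" by (rule L2_finite_integrable[OF finite_measure_sphere \<Psi>])
  define w where "w x = (\<integral>\<xi>. \<Psi> \<xi> * exp (- \<i> * of_real (x \<bullet> \<xi>)) \<partial>sphere_measure)" for x
  have wc: "continuous_on UNIV w"
    unfolding w_def[abs_def] by (rule continuous_fourier_measure[OF i measurable_id_sphere])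
  have "U \<phi> = (\<integral>x. w x * \<phi> x \<partial>lborel)" if \<phi>: "\<phi> \<in> test_functions" for \<phi>
  proof -
    interpret P: pair_sigma_finite lborel "sphere_measure :: 'a measure"
      by (intro pair_sigma_finite.intro sigma_finite_lborel sigma_finite_sphere)
    define K where "K = (\<lambda>(x, \<xi>). \<phi> x * (\<Psi> \<xi> * exp (- \<i> * of_real (x \<bullet> \<xi>))))"
    note [measurable] = borel_measurable_integrable[OF test_functions_integrable[OF \<phi>]] borel_measurable_integrable[OF i] measurable_id_sphere
    have [measurable]: "(\<lambda>z::'a \<times> 'a. fst z \<bullet> snd z) \<in> borel_measurable (lborel \<Otimes>\<^sub>M sphere_measure)"
      by (intro borel_measurable_inner measurable_compose[OF measurable_snd measurable_id_sphere]) simp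
    have Km: "K \<in> borel_measurable (lborel \<Otimes>\<^sub>M sphere_measure)" unfolding K_def case_prod_beta by measurable
    have iK: "integrable (lborel \<Otimes>\<^sub>M sphere_measure) K"
      by (rule Bochner_Integration.integrable_bound[OF P.integrable_pair_mult(1)[OF test_functions_integrable[OF \<phi>] i] Km])
        (auto simp: K_def norm_mult)
    have "(\<integral>x. w x * \<phi> x \<partial>lborel) = (\<integral>x. (\<integral>\<xi>. K (x, \<xi>) \<partial>sphere_measure) \<partial>lborel)"
      unfolding K_def w_def prod.case integral_mult_right_zero by (simp only: mult.commute)
    also have "\<dots> = (\<integral>\<xi>. (\<integral>x. K (x, \<xi>) \<partial>lborel) \<partial>sphere_measure)"
      using P.integral_fst'[OF iK] P.integral_snd[of "\<lambda>x w. K (x, w)"] iK by simp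
    also have "\<dots> = (\<integral>\<xi>. inverse ?c * (\<Psi>0 \<xi> * fourier \<phi> \<xi>) \<partial>sphere_measure)"
    proof (rule Bochner_Integration.integral_cong[OF refl])
      fix \<xi> :: 'a
      have "K (x, \<xi>) = \<Psi> \<xi> * (\<phi> x * exp (- \<i> * of_real (x \<bullet> \<xi>)))" for x by (simp add: K_def)
      then have "(\<integral>x. K (x, \<xi>) \<partial>lborel) = \<Psi> \<xi> * fourier \<phi> \<xi>"
        unfolding fourier_def by (simp only: integral_mult_right_zero)
      then show "(\<integral>x. K (x, \<xi>) \<partial>lborel) = inverse ?c * (\<Psi>0 \<xi> * fourier \<phi> \<xi>)" by (simp only: \<Psi>_def mult.assoc)
    qed
    also have "\<dots> = inverse ?c * (?c * U \<phi>)" unfolding integral_mult_right_zero \<Psi>0(2)[OF \<phi>] ..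
    finally show ?thesis by (simp only: mult.assoc[symmetric] left_inverse[OF two_pi_power_nonzero] mult_1)
  qed
  moreover have "locally_integrable w"
    unfolding locally_integrable_def set_integrable_def
    by (intro allI impI borel_integrable_compact continuous_on_subset[OF wc]) auto
  ultimately have "is_function U w" unfolding is_function_def by blast
  then show ?thesis using \<Psi> wc w_def by blast
qed

end

section \<open>The equivalence\<close>

theorem corollary1p9:
  fixes f :: "real \<Rightarrow> real"
    and u U :: "('a::euclidean_space \<Rightarrow> complex) \<Rightarrow> complex"
  assumes "bernstein f"
    and "\<not> f constant_on {0<..}"
    and "u \<in> solution_space f"
    and "identified_with u U"
  shows "U \<in> B_star \<longleftrightarrow>
    (\<exists>\<Phi> \<in> L2_sphere. \<exists>w. continuous_on UNIV w \<and> is_function U w \<and>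
       (\<forall>x. w x = (LINT \<xi>|sphere_measure. \<Phi> \<xi> * exp (- \<i> * of_real (x \<bullet> \<xi>)))))"
proof
  have U: "U \<in> tempered_distributions" using assms(4) by (simp add: identified_with_def)
  show "U \<in> B_star" if "\<exists>\<Phi> \<in> L2_sphere. \<exists>w. continuous_on UNIV w \<and> is_function U w \<and>
       (\<forall>x. w x = (LINT \<xi>|sphere_measure. \<Phi> \<xi> * exp (- \<i> * of_real (x \<bullet> \<xi>))))"
  proof -
    from that obtain \<Phi> w where "\<Phi> \<in> L2_sphere" "continuous_on UNIV w" "is_function U w"
      "\<And>x. w x = (LINT \<xi>|sphere_measure. \<Phi> \<xi> * exp (- \<i> * of_real (x \<bullet> \<xi>)))" by blast
    then show ?thesis using herglotz_B_star[OF U, of \<Phi> w] by (simp add: L2_sphere_iff)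
  qed
  assume "U \<in> B_star"
  then obtain g where g: "g \<in> borel_measurable lborel" "is_function U g" "B_star_norm_sq g < \<infinity>"
    unfolding B_star_def by blast
  define C where "C = enn2real (B_star_norm_sq g)"
  have C: "ennreal C = B_star_norm_sq g" "C \<ge> 0" using g(3) by (auto simp: C_def)
  obtain \<delta> where \<delta>: "\<delta> > 0"
    "\<And>\<phi> c \<epsilon>. \<phi> \<in> test_functions \<Longrightarrow> 0 < \<epsilon> \<Longrightarrow> \<epsilon> < \<delta> \<Longrightarrow> (\<And>x. norm (x - c) > \<epsilon> \<Longrightarrow> \<phi> x = 0) \<Longrightarrow>
      \<bar>norm c - 1\<bar> > \<epsilon> \<Longrightarrow> U (fourier \<phi>) = 0"
    using solution_fourier_eq_0[OF assms] by blast
  obtain \<rho> :: "'a \<Rightarrow> complex" where \<rho>: "\<rho> \<in> test_functions" "(\<integral>x. \<rho> x \<partial>lborel) = 1" "\<And>x. norm x \<ge> 1 \<Longrightarrow> \<rho> x = 0"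
    using mollifier_exists by blast
  have growth: "(\<integral>\<^sup>+x\<in>ball 0 R. ennreal ((norm (g x))\<^sup>2) \<partial>lborel) \<le> ennreal (C * R)" if R: "R > 1" for R
  proof -
    let ?I = "\<integral>\<^sup>+x\<in>ball 0 R. ennreal ((norm (g x))\<^sup>2) \<partial>lborel"
    have "ennreal (1 / R) * ?I \<le> ennreal C"
      unfolding C(1) B_star_norm_sq_def by (rule SUP_upper) (use R in simp)
    then have "ennreal R * (ennreal (1 / R) * ?I) \<le> ennreal R * ennreal C" by (rule mult_left_mono) simp
    moreover have "ennreal R * ennreal (1 / R) = 1" using R by (subst ennreal_mult[symmetric]) auto
    moreover have "ennreal R * ennreal C = ennreal (C * R)" using R C(2) by (subst ennreal_mult[symmetric]) (auto simp: mult.commute)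
    ultimately show ?thesis by (simp add: mult.assoc[symmetric])
  qed
  have gb: "g \<in> borel_measurable borel" using g(1) by simp
  interpret B_star_solution U g \<rho> C \<delta>
    by (rule B_star_solution.intro[OF U g(2) gb C(2) growth \<rho> \<delta>])
  show "\<exists>\<Phi> \<in> L2_sphere. \<exists>w. continuous_on UNIV w \<and> is_function U w \<and>
       (\<forall>x. w x = (LINT \<xi>|sphere_measure. \<Phi> \<xi> * exp (- \<i> * of_real (x \<bullet> \<xi>))))"
    using herglotz_representation by (simp only: L2_sphere_iff[symmetric] Bex_def)
qed

end
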